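(* Let $(t_m,i_m,J_m)$, $m\ge1$, be a sequence of observations from a multivariate point process of multicast interactions in which the intensity of interaction between sender $i$ and receiver set $J$ is $$\lambda_t(i,J)=\bar\lambda_t(i;|J|)\,\exp\Big\{\sum_{j\in J}\beta_0^{T}x_t(i,j)\Big\}\prod_{j\in J}1\{j\in\mathcal J_t(i)\}.$$ Assume that $\sup_{t,i,j}\|x_t(i,j)\|$ and $\sup_m|J_m|$ are bounded in probability. Define $$\log \mathit{PL}_t(\beta)=\sum_{t_m\le t}\Big\{\sum_{j\in J_m}\beta^{T}x_{t_m}(i_m,j)-\log\Big[\sum_{J\subseteq\mathcal J_{t_m}(i_m),\,|J|=|J_m|}\exp\Big\{\sum_{j\in J}\beta^{T}x_{t_m}(i_m,j)\Big\}\Big]\Big\},$$ $$\log\widetilde{\mathit{PL}}_t(\beta)=\sum_{t_m\le t}\Big\{\sum_{j\in J_m}\beta^{T}x_{t_m}(i_m,j)-|J_m|\log\Big[\sum_{j\in\mathcal J_{t_m}(i_m)}\exp\{\beta^{T}x_{t_m}(i_m,j)\}\Big]\Big\},$$ and $$G_n=\sum_{t_m\le t_n}\frac{1\{|J_m|>1\}}{|\mathcal J_{t_m}(i_m)|}.$$ Let $\hat\beta_n$ maximize $\log \mathit{PL}_{t_n}(\cdot)$ and let $\tilde\beta_n$ maximize $\log\widetilde{\mathit{PL}}_{t_n}(\cdot)$. Suppose that for all $n$ the negative Hessian $-\tfrac1n\nabla^2[\log\widetilde{\mathit{PL}}_{t_n}(\cdot)]$ is uniformly locally Lipschitz and has smallest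 eigenvalue bounded away from zero in a neighborhood of $\hat\beta_n$; that is, there are constants $r,c,C>0$ not depending on $n$ such that on the ball of radius $r$ about $\hat\beta_n$ it is Lipschitz with constant $C$ and its smallest eigenvalue is at least $c$. If $G_n/n\xrightarrow{P}0$, then $$\|\tilde\beta_n-\hat\beta_n\|=\mathcal O_P(G_n/n).$$
   Context: $\mathcal I$ is a set of senders and $\mathcal J$ a set of receivers. An observation $(t,i,J)$ means that at time $t$ sender $i\in\mathcal I$ interacted with the receiver set $J\subseteq\mathcal J$; $t_1,t_2,\dots$ are the successive interaction times. For each $i$ and each positive integer $L$, $\bar\lambda_t(i;L)$ is a non-negative predictable process (baseline $L$-receiver intensity); $\mathcal J_t(i)$ is a predictable finite subset of $\mathcal J$; $x_t(i,j)$ is a predictable locally bounded process with values in $\mathbb{R}^p$; $\beta_0\in\mathbb{R}^p$. $|J|$ denotes cardinality. $\|\cdot\|$ is the Euclidean norm for vectors and the spectral norm for matrices. $\xrightarrow{P}$ is convergence in probability. $A_n=\mathcal O_P(a_n)$ means that for every $\varepsilon>0$ there is a constant $C'$ with $\mathbb P\{A_n>C'a_n\}\le\varepsilon$ for all sufficiently large $n$. *)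

theory Defs
  imports "HOL-Probability.Probability"
begin

section \<open>Stochastic orders of magnitude\<close>

text \<open>
  Probabilities of events are taken with the outer measure, which coincides with the measure on
  measurable sets. Suprema over uncountably many times and maximizers that are not assumed to be
  chosen measurably can thus be treated without the convention that non-measurable sets have
  measure \<open>0\<close>.
\<close>

definition bounded_in_prob :: "'a measure \<Rightarrow> ('a \<Rightarrow> ennreal) \<Rightarrow> bool" where
  "bounded_in_prob M Y \<longleftrightarrow>
    (\<forall>\<epsilon>>0. \<exists>K::real. outer_measure_of M {\<omega> \<in> space M. Y \<omega> > ennreal K} \<le> ennreal \<epsilon>)"

definition tendsto_in_prob :: "'a measure \<Rightarrow> (nat \<Rightarrow> 'a \<Rightarrow> real) \<Rightarrow> real \<Rightarrow> bool" where
  "tendsto_in_prob M X l \<longleftrightarrow>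
    (\<forall>\<epsilon>>0. (\<lambda>n. outer_measure_of M {\<omega> \<in> space M. \<bar>X n \<omega> - l\<bar> > \<epsilon>}) \<longlonglongrightarrow> 0)"

definition bigo_in_prob :: "'a measure \<Rightarrow> (nat \<Rightarrow> 'a \<Rightarrow> real) \<Rightarrow> (nat \<Rightarrow> 'a \<Rightarrow> real) \<Rightarrow> bool" where
  "bigo_in_prob M A a \<longleftrightarrow>
    (\<forall>\<epsilon>>0. \<exists>C. \<forall>\<^sub>F n in sequentially.
      outer_measure_of M {\<omega> \<in> space M. A n \<omega> > C * a n \<omega>} \<le> ennreal \<epsilon>)"

definition with_prob_tending_to_one :: "'a measure \<Rightarrow> (nat \<Rightarrow> 'a \<Rightarrow> bool) \<Rightarrow> bool" where
  "with_prob_tending_to_one M P \<longleftrightarrow>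
    (\<lambda>n. outer_measure_of M {\<omega> \<in> space M. \<not> P n \<omega>}) \<longlonglongrightarrow> 0"

section \<open>Predictable processes and point processes with intensities\<close>

text \<open>
  Filtrations are indexed by the reals, but only the indices \<open>t \<ge> 0\<close> play a role; processes are
  considered on \<open>(0, \<infinity>)\<close>.
\<close>

definition predictable_sigma :: "'a measure \<Rightarrow> (real \<Rightarrow> 'a measure) \<Rightarrow> (real \<times> 'a) measure" where
  "predictable_sigma M F =
    sigma ({0<..} \<times> space M) {{s<..t} \<times> A | s t A. 0 \<le> s \<and> A \<in> sets (F s)}"

definition predictable_process ::
  "'a measure \<Rightarrow> (real \<Rightarrow> 'a measure) \<Rightarrow> 'b measure \<Rightarrow> (real \<Rightarrow> 'a \<Rightarrow> 'b) \<Rightarrow> bool" where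
  "predictable_process M F N X \<longleftrightarrow> (\<lambda>(t, \<omega>). X t \<omega>) \<in> predictable_sigma M F \<rightarrow>\<^sub>M N"

definition locally_bounded_process ::
  "'a measure \<Rightarrow> (real \<Rightarrow> 'a measure) \<Rightarrow> (real \<Rightarrow> 'a \<Rightarrow> 'b::real_normed_vector) \<Rightarrow> bool" where
  "locally_bounded_process M F X \<longleftrightarrow>
    (\<exists>\<sigma> :: nat \<Rightarrow> 'a \<Rightarrow> real.
      (\<forall>k. stopping_time F (\<sigma> k)) \<and>
      (AE \<omega> in M. incseq (\<lambda>k. \<sigma> k \<omega>) \<and> filterlim (\<lambda>k. \<sigma> k \<omega>) at_top sequentially) \<and>
      (\<forall>k. \<exists>B. AE \<omega> in M. \<forall>t\<in>{0<..\<sigma> k \<omega>}. norm (X t \<omega>) \<le> B))"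

text \<open>
  A multivariate point process with marks in a countable set \<open>K\<close>: the \<open>m\<close>-th event, for \<open>m \<ge> 1\<close>,
  happens at time \<open>T m\<close> and has mark \<open>Z m\<close>. The index \<open>0\<close> is not used.
\<close>

definition multivariate_point_process ::
  "'a measure \<Rightarrow> (real \<Rightarrow> 'a measure) \<Rightarrow> 'k set \<Rightarrow> (nat \<Rightarrow> 'a \<Rightarrow> real) \<Rightarrow> (nat \<Rightarrow> 'a \<Rightarrow> 'k) \<Rightarrow> bool"
where
  "multivariate_point_process M F K T Z \<longleftrightarrow>
    countable K \<and>
    (\<forall>m\<ge>1. stopping_time F (T m)) \<and>
    (\<forall>m\<ge>1. Z m \<in> filtration.pre_sigma (space M) F (T m) \<rightarrow>\<^sub>M count_space K) \<and>
    (\<forall>\<omega>\<in>space M. 0 < T 1 \<omega> \<and> (\<forall>m\<ge>1. T m \<omega> < T (Suc m) \<omega>))"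

text \<open>
  The standard definition of a predictable intensity \<open>l\<close> of the process counting the events with
  mark \<open>z\<close>: \<open>E (\<integral> C dN) = E (\<integral> C l dt)\<close> for all non-negative predictable processes \<open>C\<close>.
  Explosion is not excluded; if the event times accumulate, the intensity describes the process
  only before their supremum, as usual for compensators of multivariate point processes.
\<close>

definition has_intensity ::
  "'a measure \<Rightarrow> (real \<Rightarrow> 'a measure) \<Rightarrow> (nat \<Rightarrow> 'a \<Rightarrow> real) \<Rightarrow> (nat \<Rightarrow> 'a \<Rightarrow> 'k) \<Rightarrow> 'k \<Rightarrow>
    (real \<Rightarrow> 'a \<Rightarrow> real) \<Rightarrow> bool" where
  "has_intensity M F T Z z l \<longleftrightarrow>
    predictable_process M F borel l \<and>
    (\<forall>t>0. \<forall>\<omega>\<in>space M. 0 \<le> l t \<omega>) \<and>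
    (\<forall>C :: real \<Rightarrow> 'a \<Rightarrow> ennreal. predictable_process M F borel C \<longrightarrow>
      (\<integral>\<^sup>+\<omega>. (\<Sum>m. if 1 \<le> m \<and> Z m \<omega> = z then C (T m \<omega>) \<omega> else 0) \<partial>M) =
      (\<integral>\<^sup>+\<omega>. (\<integral>\<^sup>+t. C t \<omega> * ennreal (l t \<omega>) * indicator {t. 0 < t \<and> (\<exists>m\<ge>1. t \<le> T m \<omega>)} t \<partial>lborel) \<partial>M))"

section \<open>Hessians and eigenvalues\<close>

definition gradient :: "(real^'p \<Rightarrow> real) \<Rightarrow> real^'p \<Rightarrow> real^'p" where
  "gradient f b = (\<chi> k. frechet_derivative f (at b) (axis k 1))"

definition hessian :: "(real^'p \<Rightarrow> real) \<Rightarrow> real^'p \<Rightarrow> real^'p^'p" where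
  "hessian f b = jacobian (gradient f) (at b)"

definition spectral_norm :: "real^'p^'p \<Rightarrow> real" where
  "spectral_norm A = onorm (\<lambda>v. A *v v)"

text \<open>Only used for symmetric matrices, whose set of real eigenvalues is finite and non-empty.\<close>

definition smallest_eigenvalue :: "real^'p^'p \<Rightarrow> real" where
  "smallest_eigenvalue A = Min {e. \<exists>v. v \<noteq> 0 \<and> A *v v = e *\<^sub>R v}"

section \<open>Multicast interactions\<close>

text \<open>
  Throughout, \<open>x t i j \<omega>\<close> is the covariate vector, \<open>R t i \<omega>\<close> the set of receivers available to
  sender \<open>i\<close> at time \<open>t\<close>, and \<open>T m\<close>, \<open>S m\<close>, \<open>D m\<close> are the time, sender and receiver set of the
  \<open>m\<close>-th interaction.
\<close>

definition multicast_intensity ::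
  "(real \<Rightarrow> 'i \<Rightarrow> nat \<Rightarrow> 'a \<Rightarrow> real) \<Rightarrow> (real \<Rightarrow> 'i \<Rightarrow> 'a \<Rightarrow> 'j set) \<Rightarrow>
    (real \<Rightarrow> 'i \<Rightarrow> 'j \<Rightarrow> 'a \<Rightarrow> real^'p) \<Rightarrow> real^'p \<Rightarrow> 'i \<times> 'j set \<Rightarrow> real \<Rightarrow> 'a \<Rightarrow> real" where
  "multicast_intensity lbar R x \<beta>\<^sub>0 = (\<lambda>(i, J) t \<omega>.
    lbar t i (card J) \<omega> * exp (\<Sum>j\<in>J. \<beta>\<^sub>0 \<bullet> x t i j \<omega>) * (\<Prod>j\<in>J. of_bool (j \<in> R t i \<omega>)))"

definition log_PL ::
  "(nat \<Rightarrow> 'a \<Rightarrow> real) \<Rightarrow> (nat \<Rightarrow> 'a \<Rightarrow> 'i) \<Rightarrow> (nat \<Rightarrow> 'a \<Rightarrow> 'j set) \<Rightarrow>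
    (real \<Rightarrow> 'i \<Rightarrow> 'a \<Rightarrow> 'j set) \<Rightarrow> (real \<Rightarrow> 'i \<Rightarrow> 'j \<Rightarrow> 'a \<Rightarrow> real^'p) \<Rightarrow>
    real \<Rightarrow> 'a \<Rightarrow> real^'p \<Rightarrow> real" where
  "log_PL T S D R x t \<omega> \<beta> =
    (\<Sum>m\<in>{m. 1 \<le> m \<and> T m \<omega> \<le> t}.
      (\<Sum>j\<in>D m \<omega>. \<beta> \<bullet> x (T m \<omega>) (S m \<omega>) j \<omega>) -
      ln (\<Sum>J\<in>{J. J \<subseteq> R (T m \<omega>) (S m \<omega>) \<omega> \<and> card J = card (D m \<omega>)}.
            exp (\<Sum>j\<in>J. \<beta> \<bullet> x (T m \<omega>) (S m \<omega>) j \<omega>)))"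

definition log_PL_approx ::
  "(nat \<Rightarrow> 'a \<Rightarrow> real) \<Rightarrow> (nat \<Rightarrow> 'a \<Rightarrow> 'i) \<Rightarrow> (nat \<Rightarrow> 'a \<Rightarrow> 'j set) \<Rightarrow>
    (real \<Rightarrow> 'i \<Rightarrow> 'a \<Rightarrow> 'j set) \<Rightarrow> (real \<Rightarrow> 'i \<Rightarrow> 'j \<Rightarrow> 'a \<Rightarrow> real^'p) \<Rightarrow>
    real \<Rightarrow> 'a \<Rightarrow> real^'p \<Rightarrow> real" where
  "log_PL_approx T S D R x t \<omega> \<beta> =
    (\<Sum>m\<in>{m. 1 \<le> m \<and> T m \<omega> \<le> t}.
      (\<Sum>j\<in>D m \<omega>. \<beta> \<bullet> x (T m \<omega>) (S m \<omega>) j \<omega>) -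
      real (card (D m \<omega>)) *
        ln (\<Sum>j\<in>R (T m \<omega>) (S m \<omega>) \<omega>. exp (\<beta> \<bullet> x (T m \<omega>) (S m \<omega>) j \<omega>)))"

definition G_sum ::
  "(nat \<Rightarrow> 'a \<Rightarrow> real) \<Rightarrow> (nat \<Rightarrow> 'a \<Rightarrow> 'i) \<Rightarrow> (nat \<Rightarrow> 'a \<Rightarrow> 'j set) \<Rightarrow>
    (real \<Rightarrow> 'i \<Rightarrow> 'a \<Rightarrow> 'j set) \<Rightarrow> nat \<Rightarrow> 'a \<Rightarrow> real" where
  "G_sum T S D R n \<omega> =
    (\<Sum>m\<in>{m. 1 \<le> m \<and> T m \<omega> \<le> T n \<omega>}.
      of_bool (card (D m \<omega>) > 1) / real (card (R (T m \<omega>) (S m \<omega>) \<omega>)))"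

definition neg_hessian_approx ::
  "(nat \<Rightarrow> 'a \<Rightarrow> real) \<Rightarrow> (nat \<Rightarrow> 'a \<Rightarrow> 'i) \<Rightarrow> (nat \<Rightarrow> 'a \<Rightarrow> 'j set) \<Rightarrow>
    (real \<Rightarrow> 'i \<Rightarrow> 'a \<Rightarrow> 'j set) \<Rightarrow> (real \<Rightarrow> 'i \<Rightarrow> 'j \<Rightarrow> 'a \<Rightarrow> real^'p) \<Rightarrow>
    nat \<Rightarrow> 'a \<Rightarrow> real^'p \<Rightarrow> real^'p^'p" where
  "neg_hessian_approx T S D R x n \<omega> b =
    (- 1 / real n) *\<^sub>R hessian (log_PL_approx T S D R x (T n \<omega>) \<omega>) b"

end

theory Submission
  imports Defs
begin

text \<open>
  Both log-likelihoods are sums of log-partition functions of exponential families: sampling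
  \<open>|J_m|\<close> receivers without replacement for \<open>PL\<close>, with replacement for the approximation. As long
  as \<open>\<beta>\<close> and the covariates are bounded, no receiver has more than a share \<open>O(1 / |R|)\<close> of the weight, so
  the scores differ by \<open>O(G_n)\<close> and the strong concavity of the approximation near \<open>\<beta>hat\<close> turns
  this into a bound on the distance of the maximizers.

  The boundedness of \<open>\<beta>hat\<close> is not assumed and has to be derived. The likelihood ratio
  \<open>PL(\<beta>) / PL(\<beta>\<^sub>0)\<close> is a non-negative martingale with mean \<open>1\<close>, so by Markov's inequality
  \<open>PL\<close> increases by less than \<open>\<epsilon> n\<close> between \<open>\<beta>\<^sub>0\<close> and finitely many points around it, and by convexity the
  score at \<open>\<beta>\<^sub>0\<close> is \<open>o(n)\<close>. Moreover, along the ray from \<open>\<beta>\<^sub>0\<close> to \<open>\<beta>hat\<close>, a variance under sampling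
  with replacement that is bounded below forces one under sampling without replacement, however
  large \<open>\<beta>hat\<close> is. The curvature near \<open>\<beta>hat\<close> thus carries over to \<open>PL\<close> and contradicts the small
  score at \<open>\<beta>\<^sub>0\<close> unless \<open>\<beta>hat\<close> is within distance \<open>r\<close> of \<open>\<beta>\<^sub>0\<close>.
\<close>

section \<open>Weighted means and covariances\<close>

text \<open>The comparison of the scores carries a factor \<open>exp (2 * \<rho> * B)\<close> with
  \<open>\<rho>\<close> a bound on the maximizer, which is why \<open>\<beta>hat\<close> has to be
  located first. The curvature hypothesis alone does not locate it: it speaks of the approximate
  likelihood around \<open>\<beta>hat\<close>, wherever that lies, while probability controls the
  exact likelihood at the fixed point \<open>\<beta>\<^sub>0\<close>. The transfer of variance along
  the ray is the bridge, so its lower bound must not depend on the distance from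
  \<open>\<beta>\<^sub>0\<close>. It can fail for events with several receivers and fewer than
  \<open>N0\<close> available ones, but there are at most \<open>N0 * G_n\<close> of these. All this
  is deterministic, for one outcome at a time, with constants fixed by \<open>B\<close>,
  \<open>\<Lambda>\<close>, \<open>r\<close>, \<open>c\<close> and \<open>\<beta>\<^sub>0\<close>.
  Probability enters through the increments from \<open>\<beta>\<^sub>0\<close> to its translates by
  \<open>s\<close> along plus and minus the basis vectors. That the likelihood ratio has mean one
  follows from the defining identity of the intensity, with one predictable process for each
  \<open>n\<close>: reweighting marks by the ratio preserves the total intensity for each sender and
  each size, and the unknown baseline cancels.\<close>

definition wmean :: "'k set \<Rightarrow> ('k \<Rightarrow> real) \<Rightarrow> ('k \<Rightarrow> real) \<Rightarrow> real" where
  "wmean A w z = (\<Sum>k\<in>A. w k * z k) / sum w A"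

definition wcov :: "'k set \<Rightarrow> ('k \<Rightarrow> real) \<Rightarrow> ('k \<Rightarrow> real) \<Rightarrow> ('k \<Rightarrow> real) \<Rightarrow> real" where
  "wcov A w z z' = wmean A w (\<lambda>k. z k * z' k) - wmean A w z * wmean A w z'"

lemma wmean_abs_le:
  fixes w a :: "'k \<Rightarrow> real"
  assumes "\<And>j. j \<in> A \<Longrightarrow> 0 \<le> w j" "\<And>j. j \<in> A \<Longrightarrow> \<bar>a j\<bar> \<le> B" "0 \<le> B"
  shows "\<bar>wmean A w a\<bar> \<le> B"
proof -
  have "\<bar>\<Sum>j\<in>A. w j * a j\<bar> \<le> (\<Sum>j\<in>A. \<bar>w j * a j\<bar>)" by (rule sum_abs)
  also have "\<dots> \<le> (\<Sum>j\<in>A. w j * B)"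
    by (intro sum_mono) (use assms in \<open>auto simp: abs_mult intro: mult_left_mono\<close>)
  finally have 1: "\<bar>\<Sum>j\<in>A. w j * a j\<bar> \<le> B * sum w A"
    by (simp add: sum_distrib_left[symmetric] sum_distrib_right[symmetric] mult.commute)
  have "0 \<le> sum w A" using assms by (intro sum_nonneg)
  \<comment> \<open>If the total weight is zero, \<open>wmean\<close> is 0 by the convention for
    division; \<open>0 \<le> B\<close> covers this case.\<close>
  with 1 assms(3) show ?thesis
    by (cases "sum w A = 0") (auto simp: wmean_def pos_divide_le_eq)
qed

section \<open>Weighted sampling without replacement\<close>

abbreviation ksubsets :: "'k set \<Rightarrow> nat \<Rightarrow> 'k set set" where
  "ksubsets A k \<equiv> {J. J \<subseteq> A \<and> card J = k}"

text \<open>Double counting: a set with a marked element corresponds to the rest of the set together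
  with an element outside it.\<close>

lemma sum_ksubsets_remove:
  fixes F :: "'k set \<Rightarrow> 'k \<Rightarrow> 'b::comm_monoid_add"
  assumes "finite A"
  shows "(\<Sum>J\<in>ksubsets A (Suc k). \<Sum>j\<in>J. F (J - {j}) j) = (\<Sum>I\<in>ksubsets A k. \<Sum>j\<in>A - I. F I j)"
proof -
  have fin: "finite J" if "J \<subseteq> A" for J using that assms finite_subset by blast
  have "(\<Sum>J\<in>ksubsets A (Suc k). \<Sum>j\<in>J. F (J - {j}) j) =
      (\<Sum>(J,j)\<in>(SIGMA J:ksubsets A (Suc k). J). F (J - {j}) j)"
    by (rule sum.Sigma) (use assms fin in auto)
  also have "\<dots> = (\<Sum>(I,j)\<in>(SIGMA I:ksubsets A k. A - I). F I j)"
    by (rule sum.reindex_bij_witness[where i = "\<lambda>(I,j). (insert j I, j)" and j = "\<lambda>(J,j). (J - {j}, j)"])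
      (use fin in \<open>auto simp: card_Diff_singleton\<close>)
  also have "\<dots> = (\<Sum>I\<in>ksubsets A k. \<Sum>j\<in>A - I. F I j)"
    by (rule sum.Sigma[symmetric]) (use assms in auto)
  finally show ?thesis .
qed

text \<open>Samples are built by a last draw \<open>j\<close> outside \<open>I\<close>. A set of
  size \<open>Suc k\<close> arises once for each choice of its last element, which gives the
  factor.\<close>

lemma sum_prod_ksubsets:
  fixes w :: "'k \<Rightarrow> real" and \<phi> :: "'k set \<Rightarrow> real"
  assumes "finite A"
  shows "real (Suc k) * (\<Sum>J\<in>ksubsets A (Suc k). prod w J * \<phi> J) =
    (\<Sum>I\<in>ksubsets A k. prod w I * (\<Sum>j\<in>A - I. w j * \<phi> (insert j I)))"
proof -
  have fin: "finite J" if "J \<subseteq> A" for J using that assms finite_subset by blast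
  have "real (Suc k) * (\<Sum>J\<in>ksubsets A (Suc k). prod w J * \<phi> J) =
      (\<Sum>J\<in>ksubsets A (Suc k). \<Sum>j\<in>J. prod w (J - {j}) * (w j * \<phi> (insert j (J - {j}))))"
    unfolding sum_distrib_left
  proof (rule sum.cong[OF refl])
    fix J assume J: "J \<in> ksubsets A (Suc k)"
    have "prod w (J - {j}) * (w j * \<phi> (insert j (J - {j}))) = prod w J * \<phi> J" if "j \<in> J" for j
      using that fin[of J] J by (simp add: prod.remove[of J j w] insert_absorb)
    then show "real (Suc k) * (prod w J * \<phi> J) =
        (\<Sum>j\<in>J. prod w (J - {j}) * (w j * \<phi> (insert j (J - {j}))))"
      using J by simp
  qed
  also have "\<dots> = (\<Sum>I\<in>ksubsets A k. \<Sum>j\<in>A - I. prod w I * (w j * \<phi> (insert j I)))"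
    by (rule sum_ksubsets_remove[OF assms])
  finally show ?thesis by (simp add: sum_distrib_left)
qed

text \<open>Here \<open>sum a J\<close> itself supplies the sum over the last element, so the factor
  of \<open>sum_prod_ksubsets\<close> does not appear.\<close>

lemma sum_prod_sum_ksubsets:
  fixes w a :: "'k \<Rightarrow> real"
  assumes "finite A"
  shows "(\<Sum>J\<in>ksubsets A (Suc k). prod w J * sum a J) =
    (\<Sum>I\<in>ksubsets A k. prod w I * (\<Sum>j\<in>A - I. w j * a j))"
proof -
  have fin: "finite J" if "J \<subseteq> A" for J using that assms finite_subset by blast
  have "(\<Sum>J\<in>ksubsets A (Suc k). prod w J * sum a J) =
      (\<Sum>J\<in>ksubsets A (Suc k). \<Sum>j\<in>J. prod w (J - {j}) * (w j * a j))"
    unfolding sum_distrib_left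
    by (intro sum.cong refl) (use fin in \<open>auto simp: prod.remove[of _ _ w]\<close>)
  also have "\<dots> = (\<Sum>I\<in>ksubsets A k. \<Sum>j\<in>A - I. prod w I * (w j * a j))"
    by (rule sum_ksubsets_remove[OF assms])
  finally show ?thesis by (simp add: sum_distrib_left)
qed

text \<open>The elementary symmetric polynomial of degree \<open>k\<close> in the weights; it
  normalizes weighted sampling of \<open>k\<close> elements without replacement.\<close>

definition esym :: "'k set \<Rightarrow> ('k \<Rightarrow> real) \<Rightarrow> nat \<Rightarrow> real" where
  "esym A w k = (\<Sum>J\<in>ksubsets A k. prod w J)"

lemma esym_0 [simp]: "finite A \<Longrightarrow> esym A w 0 = 1"
proof -
  assume "finite A"
  then have "ksubsets A 0 = {{}}" using finite_subset by fastforce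
  then show ?thesis by (simp add: esym_def)
qed

lemma ksubsets_nonempty: "finite A \<Longrightarrow> k \<le> card A \<Longrightarrow> ksubsets A k \<noteq> {}"
  by (metis (mono_tags, lifting) empty_Collect_eq obtain_subset_with_card_n)

lemma esym_pos:
  assumes "finite A" "k \<le> card A" "\<And>j. j \<in> A \<Longrightarrow> 0 < w j"
  shows "0 < esym A w k"
  unfolding esym_def
  using ksubsets_nonempty[OF assms(1,2)] assms
  by (intro sum_pos prod_pos) auto

lemma esym_Suc:
  assumes "finite A"
  shows "real (Suc k) * esym A w (Suc k) = (\<Sum>I\<in>ksubsets A k. prod w I * sum w (A - I))"
  using sum_prod_ksubsets[OF assms, of k w "\<lambda>_. 1"] by (simp add: esym_def)

lemma esym_Suc_le:
  assumes "finite A" and w: "\<And>j. j \<in> A \<Longrightarrow> 0 \<le> w j"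
  shows "real (Suc k) * esym A w (Suc k) \<le> sum w A * esym A w k"
proof -
  have "(\<Sum>I\<in>ksubsets A k. prod w I * sum w (A - I)) \<le> (\<Sum>I\<in>ksubsets A k. prod w I * sum w A)"
    by (intro sum_mono mult_left_mono prod_nonneg sum_mono2) (use assms in auto)
  then show ?thesis
    unfolding esym_Suc[OF assms(1)] by (simp add: esym_def sum_distrib_right[symmetric] mult.commute[of "sum w A"])
qed

text \<open>Ordered draws without repetition, counted by \<open>fact k * esym A w k\<close>, are
  among all ordered draws; \<open>esym_Suc_le\<close> is one draw.\<close>

lemma esym_le_power:
  assumes "finite A" and w: "\<And>j. j \<in> A \<Longrightarrow> 0 \<le> w j"
  shows "fact k * esym A w k \<le> sum w A ^ k"
proof (induction k)
  case (Suc k)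
  have "fact (Suc k) * esym A w (Suc k) = fact k * (real (Suc k) * esym A w (Suc k))"
    by simp
  also have "\<dots> \<le> fact k * (sum w A * esym A w k)"
    by (intro mult_left_mono esym_Suc_le assms) auto
  also have "\<dots> = sum w A * (fact k * esym A w k)" by simp
  also have "\<dots> \<le> sum w A * sum w A ^ k"
    by (intro mult_left_mono Suc sum_nonneg assms)
  finally show ?case by simp
qed (use assms in simp)

text \<open>Drawing one element after another, the weight left for the next draw is at least
  \<open>v\<close> whichever fewer than \<open>k\<close> elements came first.\<close>

lemma esym_ge_power:
  assumes "finite A" and w: "\<And>j. j \<in> A \<Longrightarrow> 0 \<le> w j"
    and v: "0 \<le> v" and small: "\<And>I. I \<subseteq> A \<Longrightarrow> card I < k \<Longrightarrow> v \<le> sum w (A - I)"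
  shows "v ^ k \<le> fact k * esym A w k"
  using small
proof (induction k)
  case (Suc k)
  have "v * v ^ k \<le> v * (fact k * esym A w k)"
    by (intro mult_left_mono Suc v) (use Suc.prems in auto)
  also have "\<dots> = fact k * (\<Sum>I\<in>ksubsets A k. prod w I * v)"
    by (simp add: esym_def sum_distrib_left[symmetric] sum_distrib_right[symmetric] mult.commute)
  also have "\<dots> \<le> fact k * (\<Sum>I\<in>ksubsets A k. prod w I * sum w (A - I))"
    by (intro mult_left_mono sum_mono Suc.prems prod_nonneg) (use assms in auto)
  also have "\<dots> = fact (Suc k) * esym A w (Suc k)"
    using esym_Suc[OF assms(1), of k w] by simp
  finally show ?case by simp
qed (use assms in simp)

text \<open>Removing one element from each sample writes both means as sums over \<open>k\<close>-subsets \<open>I\<close>; they differ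
  only in whether the last draw may hit \<open>I\<close> again, and \<open>I\<close> has a share of at most \<open>k q / card A\<close>.\<close>

lemma sampling_mean_diff_aux:
  fixes w a :: "'k \<Rightarrow> real"
  assumes A: "finite A" and w: "\<And>j. j \<in> A \<Longrightarrow> 0 < w j"
    and q: "\<And>j. j \<in> A \<Longrightarrow> w j * real (card A) \<le> q * sum w A"
    and a: "\<And>j. j \<in> A \<Longrightarrow> \<bar>a j\<bar> \<le> B"
    and k: "Suc k \<le> card A" and big: "2 * q * real k \<le> real (card A)"
  shows "\<bar>real (Suc k) * ((\<Sum>j\<in>A. w j * a j) / sum w A) -
      (\<Sum>J\<in>ksubsets A (Suc k). prod w J * sum a J) / esym A w (Suc k)\<bar> * real (card A)
    \<le> 4 * B * q * real k * real (Suc k)"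
proof -
  define W Z Z' A1 AL where "W = sum w A" and "Z = esym A w (Suc k)" and "Z' = esym A w k"
    and "A1 = (\<Sum>j\<in>A. w j * a j)" and "AL = (\<Sum>J\<in>ksubsets A (Suc k). prod w J * sum a J)"
  define N where "N = real (card A)"
  \<comment> \<open>\<open>s\<close> and \<open>sa\<close> collect the draws whose last element
    would repeat one of the first \<open>k\<close>; they are the whole difference between the two
    sampling schemes.\<close>
  define s sa where "s = (\<Sum>I\<in>ksubsets A k. prod w I * sum w I)"
    and "sa = (\<Sum>I\<in>ksubsets A k. prod w I * (\<Sum>j\<in>I. w j * a j))"
  have N: "0 < N" using k by (simp add: N_def)
  have "A \<noteq> {}" using k by auto
  then obtain j0 where j0: "j0 \<in> A" by auto
  have B: "0 \<le> B" using a[OF j0] by linarith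
  have W: "0 < W" unfolding W_def using A w \<open>A \<noteq> {}\<close> by (intro sum_pos) auto
  have q0: "0 \<le> q"
  proof -
    have "0 < w j0 * N" using w[OF j0] N by simp
    then have "0 < q * W" using q[OF j0] by (simp add: N_def W_def)
    then show ?thesis using W by (simp add: zero_less_mult_iff)
  qed
  have Z: "0 < Z" "0 < Z'" unfolding Z_def Z'_def using k by (auto intro!: esym_pos A w)
  have fin: "finite J" if "J \<subseteq> A" for J using that A finite_subset by blast
  have diff: "sum f (A - I) = sum f A - sum f I" if "I \<subseteq> A" for f :: "'k \<Rightarrow> real" and I
    using sum_diff[OF A that] .
  have ZW: "real (Suc k) * Z = W * Z' - s"
  proof -
    have "real (Suc k) * Z = (\<Sum>I\<in>ksubsets A k. prod w I * (W - sum w I))"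
      unfolding Z_def esym_Suc[OF A] W_def by (intro sum.cong refl) (auto simp: diff)
    then show ?thesis
      by (simp add: Z'_def esym_def s_def right_diff_distrib sum_subtractf sum_distrib_left[symmetric] sum_distrib_right[symmetric]
          mult.commute)
  qed
  have AL: "AL = A1 * Z' - sa"
  proof -
    have "AL = (\<Sum>I\<in>ksubsets A k. prod w I * (A1 - (\<Sum>j\<in>I. w j * a j)))"
      unfolding AL_def sum_prod_sum_ksubsets[OF A] A1_def by (intro sum.cong refl) (auto simp: diff)
    then show ?thesis
      by (simp add: Z'_def esym_def sa_def right_diff_distrib sum_subtractf sum_distrib_left[symmetric] sum_distrib_right[symmetric]
          mult.commute)
  qed
  have sa: "\<bar>sa\<bar> \<le> B * s"
  proof -
    have "\<bar>sa\<bar> \<le> (\<Sum>I\<in>ksubsets A k. \<bar>prod w I * (\<Sum>j\<in>I. w j * a j)\<bar>)"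
      unfolding sa_def by (rule sum_abs)
    also have "\<dots> \<le> (\<Sum>I\<in>ksubsets A k. B * (prod w I * sum w I))"
    proof (intro sum_mono)
      fix I assume I: "I \<in> ksubsets A k"
      have pw: "0 \<le> prod w I" using I w by (intro prod_nonneg) (auto intro: less_imp_le)
      have "\<bar>\<Sum>j\<in>I. w j * a j\<bar> \<le> (\<Sum>j\<in>I. \<bar>w j * a j\<bar>)" by (rule sum_abs)
      also have "\<dots> \<le> (\<Sum>j\<in>I. w j * B)"
      proof (intro sum_mono)
        fix j assume "j \<in> I"
        then have "j \<in> A" using I by auto
        with w[OF this] a[OF this] show "\<bar>w j * a j\<bar> \<le> w j * B" by (simp add: abs_mult)
      qed
      finally have "\<bar>\<Sum>j\<in>I. w j * a j\<bar> \<le> B * sum w I" by (simp add: sum_distrib_left[symmetric] sum_distrib_right[symmetric] mult.commute)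
      then have "prod w I * \<bar>\<Sum>j\<in>I. w j * a j\<bar> \<le> prod w I * (B * sum w I)"
        using pw by (rule mult_left_mono)
      then show "\<bar>prod w I * (\<Sum>j\<in>I. w j * a j)\<bar> \<le> B * (prod w I * sum w I)"
        using pw by (simp add: abs_mult mult_ac)
    qed
    finally show ?thesis by (simp add: s_def sum_distrib_left)
  qed
  have A1: "\<bar>A1\<bar> \<le> B * W"
  proof -
    have "\<bar>A1\<bar> \<le> (\<Sum>j\<in>A. \<bar>w j * a j\<bar>)" unfolding A1_def by (rule sum_abs)
    also have "\<dots> \<le> (\<Sum>j\<in>A. w j * B)"
    proof (intro sum_mono)
      fix j assume j: "j \<in> A"
      with w[OF this] a[OF this] show "\<bar>w j * a j\<bar> \<le> w j * B" by (simp add: abs_mult)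
    qed
    finally show ?thesis by (simp add: W_def sum_distrib_left[symmetric] sum_distrib_right[symmetric] mult.commute)
  qed
  have sN: "s * N \<le> real k * q * W * Z'"
  proof -
    have "s * N = (\<Sum>I\<in>ksubsets A k. prod w I * (sum w I * N))"
      by (simp add: s_def sum_distrib_right[where r=N] mult.assoc)
    also have "\<dots> \<le> (\<Sum>I\<in>ksubsets A k. prod w I * (real k * q * W))"
    proof (intro sum_mono mult_left_mono prod_nonneg)
      fix I assume I: "I \<in> ksubsets A k"
      have "sum w I * N = (\<Sum>j\<in>I. w j * N)" by (simp add: sum_distrib_right)
      also have "\<dots> \<le> (\<Sum>j\<in>I. q * W)"
        using I q by (intro sum_mono) (auto simp: N_def W_def)
      also have "\<dots> = real k * q * W" using I by simp
      finally show "sum w I * N \<le> real k * q * W" .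
    qed (use w in \<open>auto intro: less_imp_le\<close>)
    finally show ?thesis by (simp add: Z'_def esym_def sum_distrib_left[symmetric] sum_distrib_right[symmetric] mult_ac)
  qed
  have s0: "0 \<le> s" unfolding s_def using w
    by (intro sum_nonneg mult_nonneg_nonneg prod_nonneg) (auto intro: less_imp_le)
  \<comment> \<open>\<open>big\<close> keeps \<open>s\<close> below half of \<open>W * Z'\<close>,
    so forbidding repetition at most halves the normalizing constant.\<close>
  have WZ: "W * Z' \<le> 2 * (real (Suc k) * Z)"
  proof -
    have "2 * s * N \<le> (2 * q * real k) * (W * Z')" using sN by (simp add: mult_ac)
    also have "\<dots> \<le> N * (W * Z')"
      using big W Z by (intro mult_right_mono) (auto simp: N_def)
    finally have "2 * s \<le> W * Z'" using N by (simp add: mult.commute)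
    then show ?thesis using ZW by linarith
  qed
  \<comment> \<open>The leading terms \<open>A1 * W * Z'\<close> cancel, and every remaining term
    contains \<open>s\<close> or \<open>sa\<close>.\<close>
  have eq: "real (Suc k) * (A1 / W) - AL / Z = (W * sa - A1 * s) / (W * Z)"
  proof -
    have "real (Suc k) * (A1 / W) - AL / Z = (A1 * (real (Suc k) * Z) - W * AL) / (W * Z)"
      using W Z by (simp add: field_simps)
    also have "A1 * (real (Suc k) * Z) - W * AL = W * sa - A1 * s"
      unfolding ZW AL by (simp add: algebra_simps)
    finally show ?thesis .
  qed
  have num: "\<bar>W * sa - A1 * s\<bar> \<le> 2 * B * W * s"
  proof -
    have "\<bar>W * sa\<bar> \<le> W * (B * s)" using W sa by (simp add: abs_mult)
    moreover have "\<bar>A1 * s\<bar> \<le> (B * W) * s" using A1 s0 by (simp add: abs_mult mult_right_mono)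
    ultimately show ?thesis by (simp add: algebra_simps)
  qed
  have "\<bar>W * sa - A1 * s\<bar> * N \<le> 2 * B * W * s * N"
    using num N by (intro mult_right_mono) auto
  also have "\<dots> = 2 * B * W * (s * N)" by simp
  also have "\<dots> \<le> 2 * B * W * (real k * q * W * Z')"
    using sN B W by (intro mult_left_mono) auto
  also have "\<dots> = 2 * B * W * real k * q * (W * Z')" by simp
  also have "\<dots> \<le> 2 * B * W * real k * q * (2 * (real (Suc k) * Z))"
    using WZ B W q0 by (intro mult_left_mono) auto
  also have "\<dots> = (4 * B * q * real k * real (Suc k)) * (W * Z)" by simp
  finally have "\<bar>W * sa - A1 * s\<bar> * N / (W * Z) \<le> 4 * B * q * real k * real (Suc k)"
    using W Z by (simp add: pos_divide_le_eq)
  moreover have "\<bar>real (Suc k) * (A1 / W) - AL / Z\<bar> * N = \<bar>W * sa - A1 * s\<bar> * N / (W * Z)"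
    unfolding eq using W Z by (simp add: abs_mult abs_divide)
  ultimately show ?thesis by (simp add: N_def A1_def W_def AL_def Z_def)
qed

text \<open>Only \<open>L - 1\<close> earlier draws can be hit again, so the error vanishes for
  \<open>L = 1\<close>, in accordance with the indicator in \<open>G_sum\<close>. If
  \<open>2 * q * (L - 1)\<close> exceeds \<open>card A\<close>, the trivial bound
  \<open>2 * L * B\<close> is good enough.\<close>

lemma sampling_mean_diff:
  fixes w a :: "'k \<Rightarrow> real"
  assumes A: "finite A" and w: "\<And>j. j \<in> A \<Longrightarrow> 0 < w j"
    and q: "\<And>j. j \<in> A \<Longrightarrow> w j * real (card A) \<le> q * sum w A" and q0: "0 \<le> q"
    and a: "\<And>j. j \<in> A \<Longrightarrow> \<bar>a j\<bar> \<le> B" and B: "0 \<le> B"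
    and L: "1 \<le> L" "L \<le> card A"
  shows "\<bar>real L * wmean A w a -
      wmean (ksubsets A L) (prod w) (sum a)\<bar>
    \<le> 4 * B * q * (real L)\<^sup>2 * (of_bool (L > 1) / real (card A))"
proof -
  obtain k where k: "L = Suc k" using L by (cases L) auto
  let ?D = "\<bar>real L * wmean A w a -
      wmean (ksubsets A L) (prod w) (sum a)\<bar>"
  have N: "0 < real (card A)" using L by auto
  have "?D * real (card A) \<le> 4 * B * q * real k * real L"
  proof (cases "2 * q * real k \<le> real (card A)")
    case True
    show ?thesis unfolding k wmean_def esym_def[symmetric]
      by (rule sampling_mean_diff_aux) (use assms True k in auto)
  next
    case False
    have "\<bar>wmean (ksubsets A L) (prod w) (sum a)\<bar> \<le> real L * B"
    proof (rule wmean_abs_le)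
      fix J assume J: "J \<in> ksubsets A L"
      show "0 \<le> prod w J" using J w by (intro prod_nonneg) (auto intro: less_imp_le)
      have "\<bar>sum a J\<bar> \<le> (\<Sum>j\<in>J. \<bar>a j\<bar>)" by (rule sum_abs)
      also have "\<dots> \<le> (\<Sum>j\<in>J. B)" using J a by (intro sum_mono) auto
      finally show "\<bar>sum a J\<bar> \<le> real L * B" using J by simp
    qed (use B in auto)
    moreover have "\<bar>wmean A w a\<bar> \<le> B"
      by (rule wmean_abs_le) (use w a B in \<open>auto intro: less_imp_le\<close>)
    then have "\<bar>real L * wmean A w a\<bar> \<le> real L * B"
      unfolding abs_mult by (intro mult_mono) auto
    ultimately have "?D \<le> real L * B + real L * B"
      by (intro order.trans[OF abs_triangle_ineq4] add_mono)
    then have "?D \<le> 2 * (real L * B)" by (simp only: mult_2)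
    then have "?D * real (card A) \<le> 2 * (real L * B) * (2 * q * real k)"
      using False by (intro mult_mono) (use B in auto)
    then show ?thesis by (simp add: mult_ac)
  qed
  also have "\<dots> \<le> 4 * B * q * ((real L)\<^sup>2 * of_bool (L > 1))"
  proof -
    have "real k * real L \<le> (real L)\<^sup>2 * of_bool (L > 1)"
      using k by (auto simp: power2_eq_square)
    then show ?thesis using B q0 mult_left_mono[of _ _ "4 * B * q"] by (simp add: mult.assoc)
  qed
  finally show ?thesis using N by (simp add: pos_le_divide_eq)
qed

section \<open>Variances: tails, and lower bounds under sampling without replacement\<close>

lemma wcov_self:
  assumes "sum w A \<noteq> 0"
  shows "wcov A w z z = wmean A w (\<lambda>k. (z k - wmean A w z)\<^sup>2)"
proof -
  define \<mu> where "\<mu> = wmean A w z"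
  have \<mu>: "(\<Sum>k\<in>A. w k * z k) = \<mu> * sum w A" using assms by (simp add: \<mu>_def wmean_def)
  have "(\<Sum>k\<in>A. w k * (z k - \<mu>)\<^sup>2) =
      (\<Sum>k\<in>A. w k * (z k * z k) - 2 * \<mu> * (w k * z k) + \<mu>\<^sup>2 * w k)"
    by (intro sum.cong refl) (simp add: power2_eq_square algebra_simps)
  also have "\<dots> = (\<Sum>k\<in>A. w k * (z k * z k)) - 2 * \<mu> * (\<Sum>k\<in>A. w k * z k) + \<mu>\<^sup>2 * sum w A"
    by (simp only: sum.distrib sum_subtractf sum_distrib_left[symmetric])
  also have "\<dots> = (\<Sum>k\<in>A. w k * (z k * z k)) - \<mu>\<^sup>2 * sum w A"
    unfolding \<mu> by (simp add: power2_eq_square)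
  finally show ?thesis
    using assms by (simp add: wcov_def \<mu>_def[symmetric])
      (simp add: wmean_def diff_divide_distrib power2_eq_square)
qed

lemma wcov_nonneg:
  assumes "\<And>k. k \<in> A \<Longrightarrow> 0 \<le> w k"
  shows "0 \<le> wcov A w z z"
proof (cases "sum w A = 0")
  case True
  then show ?thesis by (simp add: wcov_def wmean_def)
next
  case False
  then show ?thesis unfolding wcov_self[OF False]
    by (subst wmean_def) (use assms in \<open>auto intro!: divide_nonneg_nonneg sum_nonneg\<close>)
qed

lemma wcov_le_square:
  assumes "\<And>k. k \<in> A \<Longrightarrow> 0 \<le> w k" "\<And>k. k \<in> A \<Longrightarrow> \<bar>z k\<bar> \<le> B"
  shows "wcov A w z z \<le> B\<^sup>2"
proof -
  have "\<bar>wmean A w (\<lambda>k. z k * z k)\<bar> \<le> B\<^sup>2"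
  proof (rule wmean_abs_le)
    show "\<bar>z k * z k\<bar> \<le> B\<^sup>2" if "k \<in> A" for k
      using assms(2)[OF that] abs_le_square_iff[of "z k" B] by (simp add: power2_eq_square)
  qed (use assms in auto)
  then show ?thesis by (simp add: wcov_def) (smt (verit) zero_le_square)
qed

lemma wmean_uminus: "wmean A w (\<lambda>k. - z k) = - wmean A w z"
  by (simp add: wmean_def sum_negf)

text \<open>Deviations from the mean average to zero, so variance \<open>v\<close> forces their
  positive part to have mean at least \<open>v / (4 * B)\<close>. Values below
  \<open>v / (8 * B)\<close> account for at most half of this; as deviations are at most
  \<open>2 * B\<close>, the other half needs a share \<open>v / (16 * B\<^sup>2)\<close> of the
  weight.\<close>

lemma wcov_upper_tail:
  assumes w: "\<And>k. k \<in> A \<Longrightarrow> 0 \<le> w k" and a: "\<And>k. k \<in> A \<Longrightarrow> \<bar>a k\<bar> \<le> B" and B: "0 < B"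
    and W: "0 < sum w A" and A: "finite A"
    and v: "v \<le> wcov A w a a" "0 \<le> v"
  shows "v / (16 * B\<^sup>2) * sum w A \<le> sum w {k\<in>A. wmean A w a + v / (8 * B) \<le> a k}"
proof -
  define \<mu> \<delta> H where "\<mu> = wmean A w a" and "\<delta> = v / (8 * B)" and "H = {k\<in>A. \<mu> + \<delta> \<le> a k}"
  have \<mu>: "\<bar>\<mu>\<bar> \<le> B" unfolding \<mu>_def by (rule wmean_abs_le) (use w a B in auto)
  have \<delta>: "0 \<le> \<delta>" using B v by (simp add: \<delta>_def)
  have "v * sum w A \<le> (\<Sum>k\<in>A. w k * (a k - \<mu>)\<^sup>2)"
    using v W by (simp add: wcov_self \<mu>_def[symmetric]) (simp add: wmean_def pos_le_divide_eq)
  also have "\<dots> \<le> (\<Sum>k\<in>A. w k * (4 * B * (\<delta> + 2 * B * of_bool (k \<in> H)) - 2 * B * (a k - \<mu>)))"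
  proof (intro sum_mono mult_left_mono w)
    fix k assume k: "k \<in> A"
    have b: "\<bar>a k - \<mu>\<bar> \<le> 2 * B" using a[OF k] \<mu> by linarith
    have "(a k - \<mu>)\<^sup>2 = \<bar>a k - \<mu>\<bar> * \<bar>a k - \<mu>\<bar>" by (simp add: power2_eq_square)
    also have "\<dots> \<le> (2 * B) * \<bar>a k - \<mu>\<bar>" using b by (intro mult_right_mono) auto
    \<comment> \<open>An absolute value is twice the positive part minus the number itself. The
      second term is kept because it sums to zero against the weights.\<close>
    also have "\<dots> \<le> (2 * B) * (2 * (\<delta> + 2 * B * of_bool (k \<in> H)) - (a k - \<mu>))"
      using B b \<delta> k by (intro mult_left_mono) (auto simp: H_def)
    finally show "(a k - \<mu>)\<^sup>2 \<le> 4 * B * (\<delta> + 2 * B * of_bool (k \<in> H)) - 2 * B * (a k - \<mu>)"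
      by (simp add: algebra_simps)
  qed
  also have "\<dots> = (\<Sum>k\<in>A. 4 * B * \<delta> * w k + 8 * B\<^sup>2 * (w k * of_bool (k \<in> H)) -
      2 * B * (w k * a k) + 2 * B * \<mu> * w k)"
    by (intro sum.cong refl) (simp add: algebra_simps power2_eq_square)
  also have "\<dots> = 4 * B * \<delta> * sum w A + 8 * B\<^sup>2 * (\<Sum>k\<in>A. w k * of_bool (k \<in> H)) -
      2 * B * (\<Sum>k\<in>A. w k * a k) + 2 * B * \<mu> * sum w A"
    by (simp only: sum.distrib sum_subtractf sum_distrib_left[symmetric])
  also have "(\<Sum>k\<in>A. w k * of_bool (k \<in> H)) = sum w H"
    using A by (simp add: H_def sum.inter_filter of_bool_def if_distrib cong: if_cong)
  also have "(\<Sum>k\<in>A. w k * a k) = \<mu> * sum w A" using W by (simp add: \<mu>_def wmean_def)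
  finally have "v * sum w A \<le> 4 * B * \<delta> * sum w A + 8 * B\<^sup>2 * sum w H" by (simp add: mult_ac)
  moreover have "4 * B * \<delta> * sum w A = v * sum w A / 2" using B by (simp add: \<delta>_def)
  ultimately have "v * sum w A \<le> 16 * B\<^sup>2 * sum w H" by linarith
  then show ?thesis using B by (simp add: H_def \<mu>_def \<delta>_def field_simps)
qed

lemma wcov_lower_tail:
  assumes w: "\<And>k. k \<in> A \<Longrightarrow> 0 \<le> w k" and a: "\<And>k. k \<in> A \<Longrightarrow> \<bar>a k\<bar> \<le> B" and B: "0 < B"
    and W: "0 < sum w A" and A: "finite A"
    and v: "v \<le> wcov A w a a" "0 \<le> v"
  shows "v / (16 * B\<^sup>2) * sum w A \<le> sum w {k\<in>A. a k + v / (8 * B) \<le> wmean A w a}"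
proof -
  have "v / (16 * B\<^sup>2) * sum w A \<le> sum w {k\<in>A. wmean A w (\<lambda>k. - a k) + v / (8 * B) \<le> - a k}"
    by (rule wcov_upper_tail) (use assms in \<open>auto simp: wcov_def wmean_uminus\<close>)
  also have "{k\<in>A. wmean A w (\<lambda>k. - a k) + v / (8 * B) \<le> - a k} = {k\<in>A. a k + v / (8 * B) \<le> wmean A w a}"
    by (auto simp: wmean_uminus)
  finally show ?thesis .
qed

text \<open>Fixing all but one of the sampled elements inside \<open>Lo\<close>, the last one can still fall into
  \<open>Lo\<close> or into \<open>Hi\<close>, and one of the two outcomes is at distance \<open>d / 2\<close> from the mean.\<close>

lemma wcov_ksubsets_ge:
  fixes w a :: "'k \<Rightarrow> real"
  assumes A: "finite A" and w: "\<And>j. j \<in> A \<Longrightarrow> 0 < w j" and L: "1 \<le> L" "L \<le> card A"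
    and sub: "Lo \<subseteq> A" "Hi \<subseteq> A" and gap: "\<And>l h. l \<in> Lo \<Longrightarrow> h \<in> Hi \<Longrightarrow> a l + d \<le> a h" and d: "0 < d"
    and Lo: "p * sum w A \<le> sum w Lo" and Hi: "p * sum w A \<le> sum w Hi" and p: "0 < p"
    and small: "\<And>l. l \<in> Lo \<Longrightarrow> 2 * real (L - 1) * w l \<le> p * sum w A"
  shows "(p / 2) ^ L * (d\<^sup>2 / 4) \<le> wcov (ksubsets A L) (prod w) (sum a) (sum a)"
proof -
  obtain k where k: "L = Suc k" using L by (cases L) auto
  define W where "W = sum w A"
  define \<mu> where "\<mu> = wmean (ksubsets A L) (prod w) (sum a)"
  have fin: "finite J" if "J \<subseteq> A" for J using that A finite_subset by blast
  have w0: "0 \<le> w j" if "j \<in> A" for j using w[OF that] by simp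
  have "A \<noteq> {}" using L by auto
  then have W: "0 < W" unfolding W_def using A w by (intro sum_pos) auto
  have Z: "0 < esym A w L" by (intro esym_pos A w L)
  \<comment> \<open>Half of the mass guaranteed for \<open>Lo\<close>: by \<open>small\<close>, at
    most \<open>L - 1\<close> elements of \<open>Lo\<close> carry no more than the other
    half.\<close>
  define v where "v = p * W / 2"
  have v: "0 < v" using p W by (simp add: v_def)
  have rest: "v \<le> sum w (Lo - I)" if I: "I \<subseteq> Lo" "card I \<le> k" for I
  proof -
    have finI: "finite I" using I sub fin by blast
    have "sum w I \<le> v"
    proof (cases "k = 0")
      case True
      then show ?thesis using I finI v by simp
    next
      case False
      have "2 * real k * sum w I = (\<Sum>j\<in>I. 2 * real k * w j)" by (simp add: sum_distrib_left)
      also have "\<dots> \<le> (\<Sum>j\<in>I. 2 * v)"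
        using I small by (intro sum_mono) (auto simp: k v_def W_def)
      also have "\<dots> \<le> real k * (2 * v)" using I v by (simp add: mult_right_mono)
      finally show ?thesis using False by simp
    qed
    moreover have "sum w (Lo - I) = sum w Lo - sum w I"
      using sum_diff[of Lo I w] I sub fin by auto
    moreover have "2 * v \<le> sum w Lo" using Lo by (simp add: v_def W_def)
    ultimately show ?thesis by linarith
  qed
  have disj: "h \<notin> Lo" if "h \<in> Hi" for h using gap[OF _ that, of h] d by auto
  have inner: "v * (d\<^sup>2 / 4) \<le> (\<Sum>j\<in>A - I. w j * (sum a (insert j I) - \<mu>)\<^sup>2)" if I: "I \<in> ksubsets Lo k" for I
  proof -
    have finI: "finite I" using I sub fin by blast
    define z where "z = \<mu> - sum a I"
    have ins: "sum a (insert j I) - \<mu> = a j - z" if "j \<in> A - I" for j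
      using that finI by (simp add: z_def)
    have one: "v * (d\<^sup>2 / 4) \<le> (\<Sum>j\<in>A - I. w j * (sum a (insert j I) - \<mu>)\<^sup>2)"
      if S: "S \<subseteq> A - I" and vS: "v \<le> sum w S" and far: "\<And>j. j \<in> S \<Longrightarrow> d / 2 \<le> \<bar>a j - z\<bar>" for S
    proof -
      have "v * (d\<^sup>2 / 4) \<le> sum w S * (d\<^sup>2 / 4)" using vS by (intro mult_right_mono) auto
      also have "\<dots> = (\<Sum>j\<in>S. w j * (d / 2)\<^sup>2)" by (simp add: sum_distrib_right power_divide)
      also have "\<dots> \<le> (\<Sum>j\<in>S. w j * (sum a (insert j I) - \<mu>)\<^sup>2)"
      proof (intro sum_mono mult_left_mono)
        fix j assume j: "j \<in> S"
        have "(d / 2)\<^sup>2 \<le> \<bar>a j - z\<bar>\<^sup>2" using far[OF j] d by (intro power_mono) auto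
        then show "(d / 2)\<^sup>2 \<le> (sum a (insert j I) - \<mu>)\<^sup>2" using ins S j by auto
        show "0 \<le> w j" using S j w0 by auto
      qed
      also have "\<dots> \<le> (\<Sum>j\<in>A - I. w j * (sum a (insert j I) - \<mu>)\<^sup>2)"
        by (intro sum_mono2 S) (use A w0 in auto)
      finally show ?thesis .
    qed
    show ?thesis
    proof (cases "\<forall>l\<in>Lo - I. d / 2 \<le> \<bar>a l - z\<bar>")
      case True
      show ?thesis by (rule one[of "Lo - I"]) (use True sub rest[of I] I in auto)
    next
      case False
      then obtain l where l: "l \<in> Lo - I" "\<bar>a l - z\<bar> < d / 2" by force
      have far: "d / 2 \<le> \<bar>a h - z\<bar>" if "h \<in> Hi" for h
        using gap[OF _ that, of l] l by (auto simp: abs_if split: if_splits)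
      have "v \<le> sum w Hi" using Hi v by (simp add: v_def W_def)
      moreover have "Hi \<subseteq> A - I" using sub disj I by auto
      ultimately show ?thesis by (intro one[of Hi] far)
    qed
  qed
  have "v ^ k \<le> fact k * esym Lo w k"
    by (rule esym_ge_power) (use sub fin w0 v rest in auto)
  then have "v ^ k * (v * (d\<^sup>2 / 4)) \<le> fact k * esym Lo w k * (v * (d\<^sup>2 / 4))"
    using v by (intro mult_right_mono) auto
  also have "\<dots> = fact k * (\<Sum>I\<in>ksubsets Lo k. prod w I * (v * (d\<^sup>2 / 4)))"
    by (simp add: esym_def sum_distrib_right)
  also have "\<dots> \<le> fact k * (\<Sum>I\<in>ksubsets Lo k. prod w I * (\<Sum>j\<in>A - I. w j * (sum a (insert j I) - \<mu>)\<^sup>2))"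
    using sub w0 by (intro mult_left_mono sum_mono inner prod_nonneg) auto
  also have "\<dots> \<le> fact k * (\<Sum>I\<in>ksubsets A k. prod w I * (\<Sum>j\<in>A - I. w j * (sum a (insert j I) - \<mu>)\<^sup>2))"
    using sub w0 A
    by (intro mult_left_mono sum_mono2 mult_nonneg_nonneg prod_nonneg sum_nonneg) auto
  also have "\<dots> = fact L * (\<Sum>J\<in>ksubsets A L. prod w J * (sum a J - \<mu>)\<^sup>2)"
    unfolding k sum_prod_ksubsets[OF A, of k w "\<lambda>J. (sum a J - \<mu>)\<^sup>2", symmetric] by simp
  also have "\<dots> = (fact L * esym A w L) * wcov (ksubsets A L) (prod w) (sum a) (sum a)"
    using Z by (simp add: wcov_self esym_def[symmetric] \<mu>_def[symmetric])
      (simp add: wmean_def esym_def)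
  \<comment> \<open>Replacing the normalizing constant by \<open>W ^ L\<close> makes the bound
    independent of the scale of the weights and of the size of \<open>A\<close>.\<close>
  also have "\<dots> \<le> W ^ L * wcov (ksubsets A L) (prod w) (sum a) (sum a)"
    unfolding W_def using A w0
    by (intro mult_right_mono esym_le_power wcov_nonneg prod_nonneg) auto
  finally have "v ^ L * (d\<^sup>2 / 4) \<le> W ^ L * wcov (ksubsets A L) (prod w) (sum a) (sum a)"
    by (simp add: k mult_ac)
  moreover have "v ^ L = W ^ L * (p / 2) ^ L"
    by (simp add: v_def power_mult_distrib[symmetric] mult.commute)
  ultimately show ?thesis using W by (simp add: mult.assoc)
qed

lemma exp_weight_ratio:
  fixes x :: "'k \<Rightarrow> 'v::real_inner"
  assumes "norm b \<le> \<rho>" "norm (x i) \<le> B" "norm (x j) \<le> B" "0 \<le> \<rho>"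
  shows "exp (b \<bullet> x i) \<le> exp (2 * \<rho> * B) * exp (b \<bullet> x j)"
proof -
  have *: "\<bar>b \<bullet> x k\<bar> \<le> \<rho> * B" if "norm (x k) \<le> B" for k
    using Cauchy_Schwarz_ineq2[of b "x k"] mult_mono[OF assms(1) that assms(4)] by simp
  show ?thesis using *[OF assms(2)] *[OF assms(3)] by (simp flip: exp_add)
qed

text \<open>All weights agree up to the factor \<open>exp (2 * \<rho> * B)\<close>, so none exceeds
  this multiple of their average. This is the source of \<open>q\<close> in
  \<open>sampling_mean_diff\<close>.\<close>

lemma exp_weight_share:
  fixes x :: "'k \<Rightarrow> 'v::real_inner"
  assumes "norm b \<le> \<rho>" "\<And>j. j \<in> A \<Longrightarrow> norm (x j) \<le> B" "0 \<le> \<rho>" "j \<in> A"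
  shows "exp (b \<bullet> x j) * real (card A) \<le> exp (2 * \<rho> * B) * (\<Sum>k\<in>A. exp (b \<bullet> x k))"
proof -
  have "exp (b \<bullet> x j) * real (card A) = (\<Sum>k\<in>A. exp (b \<bullet> x j))" by simp
  also have "\<dots> \<le> (\<Sum>k\<in>A. exp (2 * \<rho> * B) * exp (b \<bullet> x k))"
    using assms by (intro sum_mono exp_weight_ratio) auto
  finally show ?thesis by (simp add: sum_distrib_left)
qed

text \<open>The atoms on the lower side of the mean have small weight: for large \<open>s\<close> because of the
  exponential tilting in direction \<open>v\<close>, and for bounded \<open>s\<close> because \<open>A\<close> is large.\<close>

lemma wcov_ksubsets_uniform_ge:
  fixes B \<rho> \<gamma> :: real
  assumes B: "0 < B" and \<rho>: "0 \<le> \<rho>" and \<gamma>: "0 < \<gamma>" and \<Lambda>: "1 \<le> \<Lambda>"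
  shows "\<exists>N0 > 0. \<exists>\<kappa> > 0. \<forall>(A :: 'k set) (x :: 'k \<Rightarrow> 'v::real_inner) b v s L.
    finite A \<longrightarrow> norm v = 1 \<longrightarrow> norm b \<le> \<rho> \<longrightarrow> (\<forall>j\<in>A. norm (x j) \<le> B) \<longrightarrow> 0 \<le> s \<longrightarrow>
    1 \<le> L \<longrightarrow> L \<le> \<Lambda> \<longrightarrow> L \<le> card A \<longrightarrow> L = 1 \<or> N0 \<le> real (card A) \<longrightarrow>
    \<gamma> \<le> wcov A (\<lambda>j. exp ((b + s *\<^sub>R v) \<bullet> x j)) (\<lambda>j. v \<bullet> x j) (\<lambda>j. v \<bullet> x j) \<longrightarrow>
    \<kappa> \<le> wcov (ksubsets A L) (prod (\<lambda>j. exp ((b + s *\<^sub>R v) \<bullet> x j))) (sum (\<lambda>j. v \<bullet> x j)) (sum (\<lambda>j. v \<bullet> x j))"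
proof -
  \<comment> \<open>\<open>p\<close> is the mass of each tail in \<open>wcov_upper_tail\<close> and
    \<open>wcov_lower_tail\<close> for variance \<open>\<gamma>\<close>; \<open>d\<close> is twice
    their threshold, the gap between the two tails.\<close>
  define d p where "d = \<gamma> / (4 * B)" and "p = \<gamma> / (16 * B\<^sup>2)"
  have d: "0 < d" and p: "0 < p" using B \<gamma> by (auto simp: d_def p_def)
  \<comment> \<open>From \<open>s0\<close> on, tilting over the gap \<open>d\<close> outweighs the
    factor \<open>exp (2 * \<rho> * B)\<close>: an atom of the lower tail weighs at most
    \<open>p / (2 * \<Lambda>)\<close> times any atom of the upper tail.\<close>
  define s0 where "s0 = max 0 ((2 * \<rho> * B - ln (p / (2 * real \<Lambda>))) / d)"
  \<comment> \<open>Below \<open>s0\<close> the parameter has norm at most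
    \<open>\<rho> + s0\<close>, and among \<open>N0\<close> or more atoms no single one has a share
    above \<open>p / (2 * \<Lambda>)\<close>.\<close>
  define N0 where "N0 = 2 * real \<Lambda> * exp (2 * (\<rho> + s0) * B) / p"
  \<comment> \<open>With base at most 1 the power decreases in the exponent, so one constant serves
    all \<open>L \<le> \<Lambda>\<close>.\<close>
  define \<kappa> where "\<kappa> = (min 1 (p / 2)) ^ \<Lambda> * (d\<^sup>2 / 4)"
  have N0: "0 < N0" using \<Lambda> p by (simp add: N0_def)
  have \<kappa>: "0 < \<kappa>" using d p by (simp add: \<kappa>_def)
  have s0: "exp (2 * \<rho> * B - s * d) \<le> p / (2 * real \<Lambda>)" if "s0 \<le> s" for s
  proof -
    have "(2 * \<rho> * B - ln (p / (2 * real \<Lambda>))) / d \<le> s" using that by (simp add: s0_def)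
    then have "2 * \<rho> * B - s * d \<le> ln (p / (2 * real \<Lambda>))" using d by (simp add: field_simps)
    then have "exp (2 * \<rho> * B - s * d) \<le> exp (ln (p / (2 * real \<Lambda>)))" by simp
    also have "\<dots> = p / (2 * real \<Lambda>)" using p \<Lambda> by (intro exp_ln) auto
    finally show ?thesis .
  qed
  show ?thesis
  proof (rule exI[of _ N0], intro conjI N0, rule exI[of _ \<kappa>], intro conjI \<kappa> allI impI)
    fix A :: "'k set" and x :: "'k \<Rightarrow> 'v" and b v s and L :: nat
    assume A: "finite A" and v: "norm v = 1" and b: "norm b \<le> \<rho>" and x: "\<forall>j\<in>A. norm (x j) \<le> B"
      and s: "0 \<le> s" and L: "1 \<le> L" "L \<le> \<Lambda>" "L \<le> card A" and N: "L = 1 \<or> N0 \<le> real (card A)"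
      and var: "\<gamma> \<le> wcov A (\<lambda>j. exp ((b + s *\<^sub>R v) \<bullet> x j)) (\<lambda>j. v \<bullet> x j) (\<lambda>j. v \<bullet> x j)"
    define w where "w = (\<lambda>j. exp ((b + s *\<^sub>R v) \<bullet> x j))"
    define a where "a = (\<lambda>j. v \<bullet> x j)"
    define W where "W = sum w A"
    have a: "\<bar>a j\<bar> \<le> B" if "j \<in> A" for j
      using Cauchy_Schwarz_ineq2[of v "x j"] x that v by (auto simp: a_def)
    have "A \<noteq> {}" using L by auto
    then have W: "0 < W" unfolding W_def w_def using A by (intro sum_pos) auto
    define Hi where "Hi = {k\<in>A. wmean A w a + \<gamma> / (8 * B) \<le> a k}"
    define Lo where "Lo = {k\<in>A. a k + \<gamma> / (8 * B) \<le> wmean A w a}"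
    have Hi: "p * W \<le> sum w Hi" unfolding p_def W_def Hi_def
      by (rule wcov_upper_tail) (use A a B W var \<gamma> in \<open>auto simp: w_def a_def W_def\<close>)
    have Lo: "p * W \<le> sum w Lo" unfolding p_def W_def Lo_def
      by (rule wcov_lower_tail) (use A a B W var \<gamma> in \<open>auto simp: w_def a_def W_def\<close>)
    have dd: "d = \<gamma> / (8 * B) + \<gamma> / (8 * B)" using B by (simp add: d_def field_simps)
    have gap: "a l + d \<le> a h" if "l \<in> Lo" "h \<in> Hi" for l h
      using that unfolding Lo_def Hi_def dd by auto
    have small: "2 * real (L - 1) * w l \<le> p * W" if l: "l \<in> Lo" for l
    proof (cases "L = 1")
      case True
      then show ?thesis using p W by simp
    next
      case False
      have lA: "l \<in> A" using l by (simp add: Lo_def)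
      have le: "2 * real (L - 1) * w l \<le> 2 * real \<Lambda> * w l"
        using L by (intro mult_right_mono) (auto simp: w_def)
      show ?thesis
      proof (cases "s0 \<le> s")
        case True
        have "sum w Hi \<noteq> 0" using Hi p W mult_pos_pos[OF p W] by linarith
        then obtain h where h: "h \<in> Hi" by (meson sum.not_neutral_contains_not_neutral)
        then have hA: "h \<in> A" by (simp add: Hi_def)
        have "w l = exp (b \<bullet> x l) * exp (s * a l)"
          by (simp add: w_def a_def inner_add_left exp_add)
        also have "\<dots> \<le> (exp (2 * \<rho> * B) * exp (b \<bullet> x h)) * exp (s * (a h - d))"
        proof (intro mult_mono exp_weight_ratio b \<rho>)
          have "s * a l \<le> s * (a h - d)" using gap[OF l h] s by (intro mult_left_mono) auto
          then show "exp (s * a l) \<le> exp (s * (a h - d))" by simp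
        qed (use x lA hA in auto)
        also have "\<dots> = exp (2 * \<rho> * B - s * d) * w h"
          by (simp add: w_def a_def inner_add_left algebra_simps flip: exp_add)
        also have "\<dots> \<le> p / (2 * real \<Lambda>) * w h"
          using s0[OF True] by (intro mult_right_mono) (auto simp: w_def)
        also have "\<dots> \<le> p / (2 * real \<Lambda>) * W"
          unfolding W_def using p hA A by (intro mult_left_mono member_le_sum) (auto simp: w_def)
        finally have "2 * real \<Lambda> * w l \<le> p * W" using \<Lambda> by (simp add: field_simps)
        with le show ?thesis by linarith
      next
        case s: False
        have nb: "norm (b + s *\<^sub>R v) \<le> \<rho> + s0"
          using norm_triangle_ineq[of b "s *\<^sub>R v"] b v s \<open>0 \<le> s\<close> by simp
        have "w l * real (card A) \<le> exp (2 * (\<rho> + s0) * B) * W"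
          unfolding w_def W_def
          by (rule exp_weight_share[OF nb]) (use x lA \<rho> in \<open>auto simp: s0_def\<close>)
        then have "2 * real \<Lambda> * (w l * real (card A)) \<le> 2 * real \<Lambda> * (exp (2 * (\<rho> + s0) * B) * W)"
          by (intro mult_left_mono) auto
        also have "\<dots> = p * W * N0" using p by (simp add: N0_def)
        also have "\<dots> \<le> p * W * real (card A)" using N False p W by (intro mult_left_mono) auto
        finally have "(2 * real \<Lambda> * w l) * real (card A) \<le> (p * W) * real (card A)" by (simp add: mult_ac)
        then have "2 * real \<Lambda> * w l \<le> p * W"
          by (rule mult_right_le_imp_le) (use L in auto)
        with le show ?thesis by linarith
      qed
    qed
    have "(p / 2) ^ L * (d\<^sup>2 / 4) \<le> wcov (ksubsets A L) (prod w) (sum a) (sum a)"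
      by (rule wcov_ksubsets_ge[where Lo = Lo and Hi = Hi])
        (use A L d p gap Hi Lo small in \<open>auto simp: W_def\<close>, auto simp: w_def Lo_def Hi_def)
    moreover have "\<kappa> \<le> (p / 2) ^ L * (d\<^sup>2 / 4)"
    proof -
      have "(min 1 (p / 2)) ^ \<Lambda> \<le> (min 1 (p / 2)) ^ L"
        using L p by (intro power_decreasing) auto
      also have "\<dots> \<le> (p / 2) ^ L" using p by (intro power_mono) auto
      finally show ?thesis unfolding \<kappa>_def by (intro mult_right_mono) auto
    qed
    ultimately show "\<kappa> \<le> wcov (ksubsets A L) (prod (\<lambda>j. exp ((b + s *\<^sub>R v) \<bullet> x j)))
        (sum (\<lambda>j. v \<bullet> x j)) (sum (\<lambda>j. v \<bullet> x j))"
      by (simp add: w_def a_def)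
  qed
qed

section \<open>Exponential tilting\<close>

lemma sum_exp_pos: "finite A \<Longrightarrow> A \<noteq> {} \<Longrightarrow> 0 < (\<Sum>k\<in>A. exp (f k :: real))"
  by (intro sum_pos) auto

lemma ln_sum_exp_has_derivative:
  fixes y :: "'k \<Rightarrow> 'v::real_inner"
  assumes "finite A" "A \<noteq> {}"
  shows "((\<lambda>b. ln (\<Sum>k\<in>A. exp (b \<bullet> y k))) has_derivative
    (\<lambda>h. wmean A (\<lambda>k. exp (b \<bullet> y k)) (\<lambda>k. h \<bullet> y k))) (at b)"
proof -
  have "((\<lambda>b. \<Sum>k\<in>A. exp (b \<bullet> y k)) has_derivative
      (\<lambda>h. \<Sum>k\<in>A. exp (b \<bullet> y k) * (h \<bullet> y k))) (at b)"
    by (intro has_derivative_sum) (auto intro!: derivative_eq_intros simp: mult_ac)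
  from has_derivative_ln[OF sum_exp_pos[OF assms] this] show ?thesis
    by (simp add: wmean_def divide_inverse)
qed

lemma wmean_exp_has_derivative:
  fixes y :: "'k \<Rightarrow> 'v::real_inner"
  assumes "finite A" "A \<noteq> {}"
  shows "((\<lambda>b. wmean A (\<lambda>k. exp (b \<bullet> y k)) z) has_derivative
    (\<lambda>h. wcov A (\<lambda>k. exp (b \<bullet> y k)) z (\<lambda>k. h \<bullet> y k))) (at b)"
proof -
  define W where "W = (\<Sum>k\<in>A. exp (b \<bullet> y k))"
  have W: "W \<noteq> 0" using sum_exp_pos[OF assms, of "\<lambda>k. b \<bullet> y k"] by (simp add: W_def)
  have num: "((\<lambda>b. \<Sum>k\<in>A. exp (b \<bullet> y k) * z k) has_derivative
      (\<lambda>h. \<Sum>k\<in>A. exp (b \<bullet> y k) * (z k * (h \<bullet> y k)))) (at b)"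
    by (intro has_derivative_sum) (auto intro!: derivative_eq_intros simp: mult_ac)
  have den: "((\<lambda>b. \<Sum>k\<in>A. exp (b \<bullet> y k)) has_derivative
      (\<lambda>h. \<Sum>k\<in>A. exp (b \<bullet> y k) * (h \<bullet> y k))) (at b)"
    by (intro has_derivative_sum) (auto intro!: derivative_eq_intros simp: mult_ac)
  show ?thesis
    unfolding wmean_def[abs_def] wcov_def
    by (rule has_derivative_eq_rhs, rule has_derivative_divide'[OF num den])
      (use W in \<open>auto simp: W_def[symmetric] fun_eq_iff field_simps\<close>)
qed

text \<open>The common form of both likelihoods. The exact one has \<open>\<kappa> = 1\<close>, with
  subsets as atoms and sums of covariates as \<open>y\<close>; the approximation has
  \<open>\<kappa> = card (D m)\<close>, with single receivers as atoms.\<close>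

definition loglik ::
  "'m set \<Rightarrow> ('m \<Rightarrow> 'v::real_inner) \<Rightarrow> ('m \<Rightarrow> real) \<Rightarrow> ('m \<Rightarrow> 'k set) \<Rightarrow> ('m \<Rightarrow> 'k \<Rightarrow> 'v) \<Rightarrow> 'v \<Rightarrow> real"
  where "loglik I l \<kappa> A y b = (\<Sum>m\<in>I. b \<bullet> l m - \<kappa> m * ln (\<Sum>k\<in>A m. exp (b \<bullet> y m k)))"

definition score ::
  "'m set \<Rightarrow> ('m \<Rightarrow> 'v::real_inner) \<Rightarrow> ('m \<Rightarrow> real) \<Rightarrow> ('m \<Rightarrow> 'k set) \<Rightarrow> ('m \<Rightarrow> 'k \<Rightarrow> 'v) \<Rightarrow> 'v \<Rightarrow> 'v \<Rightarrow> real"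
  where "score I l \<kappa> A y b v =
    (\<Sum>m\<in>I. v \<bullet> l m - \<kappa> m * wmean (A m) (\<lambda>k. exp (b \<bullet> y m k)) (\<lambda>k. v \<bullet> y m k))"

text \<open>The negative Hessian of \<open>loglik\<close>, kept as a bilinear form so that estimates
  reduce to variances along one direction.\<close>

definition info ::
  "'m set \<Rightarrow> ('m \<Rightarrow> real) \<Rightarrow> ('m \<Rightarrow> 'k set) \<Rightarrow> ('m \<Rightarrow> 'k \<Rightarrow> 'v::real_inner) \<Rightarrow> 'v \<Rightarrow> 'v \<Rightarrow> 'v \<Rightarrow> real"
  where "info I \<kappa> A y b v u =
    (\<Sum>m\<in>I. \<kappa> m * wcov (A m) (\<lambda>k. exp (b \<bullet> y m k)) (\<lambda>k. v \<bullet> y m k) (\<lambda>k. u \<bullet> y m k))"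

context
  fixes I :: "'m set" and l :: "'m \<Rightarrow> 'v::real_inner" and \<kappa> :: "'m \<Rightarrow> real"
    and A :: "'m \<Rightarrow> 'k set" and y :: "'m \<Rightarrow> 'k \<Rightarrow> 'v"
  assumes finA: "\<And>m. m \<in> I \<Longrightarrow> finite (A m) \<and> A m \<noteq> {}"
begin

lemma loglik_has_derivative: "(loglik I l \<kappa> A y has_derivative score I l \<kappa> A y b) (at b)"
  unfolding loglik_def[abs_def] score_def[abs_def]
proof (intro has_derivative_sum)
  fix m assume m: "m \<in> I"
  have "((\<lambda>b. \<kappa> m * ln (\<Sum>k\<in>A m. exp (b \<bullet> y m k))) has_derivative
      (\<lambda>v. \<kappa> m * wmean (A m) (\<lambda>k. exp (b \<bullet> y m k)) (\<lambda>k. v \<bullet> y m k))) (at b)"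
    using finA[OF m] by (intro has_derivative_mult_right ln_sum_exp_has_derivative) auto
  from has_derivative_diff[OF has_derivative_inner_left[OF has_derivative_ident] this]
  show "((\<lambda>b. b \<bullet> l m - \<kappa> m * ln (\<Sum>k\<in>A m. exp (b \<bullet> y m k))) has_derivative
      (\<lambda>v. v \<bullet> l m - \<kappa> m * wmean (A m) (\<lambda>k. exp (b \<bullet> y m k)) (\<lambda>k. v \<bullet> y m k))) (at b)" .
qed

lemma score_has_derivative:
  "((\<lambda>b. score I l \<kappa> A y b v) has_derivative (\<lambda>u. - info I \<kappa> A y b v u)) (at b)"
  unfolding score_def[abs_def] info_def[abs_def] sum_negf[symmetric]
proof (intro has_derivative_sum)
  fix m assume m: "m \<in> I"
  have "((\<lambda>b. \<kappa> m * wmean (A m) (\<lambda>k. exp (b \<bullet> y m k)) (\<lambda>k. v \<bullet> y m k)) has_derivative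
      (\<lambda>u. \<kappa> m * wcov (A m) (\<lambda>k. exp (b \<bullet> y m k)) (\<lambda>k. v \<bullet> y m k) (\<lambda>k. u \<bullet> y m k))) (at b)"
    using finA[OF m] by (intro has_derivative_mult_right wmean_exp_has_derivative) auto
  from has_derivative_diff[OF has_derivative_const this]
  show "((\<lambda>b. v \<bullet> l m - \<kappa> m * wmean (A m) (\<lambda>k. exp (b \<bullet> y m k)) (\<lambda>k. v \<bullet> y m k)) has_derivative
      (\<lambda>u. - (\<kappa> m * wcov (A m) (\<lambda>k. exp (b \<bullet> y m k)) (\<lambda>k. v \<bullet> y m k) (\<lambda>k. u \<bullet> y m k)))) (at b)"
    by simp
qed

lemma linear_score: "linear (score I l \<kappa> A y b)"
  by (rule has_derivative_linear[OF loglik_has_derivative])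

lemma info_commute: "info I \<kappa> A y b v u = info I \<kappa> A y b u v"
  by (simp add: info_def wcov_def mult.commute)

lemma linear_info: "linear (info I \<kappa> A y b v)"
  using linear_compose_neg[OF has_derivative_linear[OF score_has_derivative]] by simp

lemma loglik_line: "((\<lambda>s. loglik I l \<kappa> A y (b + s *\<^sub>R v)) has_real_derivative
    score I l \<kappa> A y (b + s *\<^sub>R v) v) (at s)"
proof -
  have "((\<lambda>s. loglik I l \<kappa> A y (b + s *\<^sub>R v)) has_derivative
      (\<lambda>h. score I l \<kappa> A y (b + s *\<^sub>R v) (h *\<^sub>R v))) (at s)"
    by (rule has_derivative_compose[where g = "loglik I l \<kappa> A y", OF _ loglik_has_derivative])
      (auto intro!: derivative_eq_intros)
  then show ?thesis
    by (simp add: has_field_derivative_def linear_cmul[OF linear_score] mult_commute_abs)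
qed

lemma score_line: "((\<lambda>s. score I l \<kappa> A y (b + s *\<^sub>R v) v) has_real_derivative
    - info I \<kappa> A y (b + s *\<^sub>R v) v v) (at s)"
proof -
  have "((\<lambda>s. score I l \<kappa> A y (b + s *\<^sub>R v) v) has_derivative
      (\<lambda>h. - info I \<kappa> A y (b + s *\<^sub>R v) v (h *\<^sub>R v))) (at s)"
    by (rule has_derivative_compose[where g = "\<lambda>b. score I l \<kappa> A y b v", OF _ score_has_derivative])
      (auto intro!: derivative_eq_intros)
  then show ?thesis
    by (rule has_derivative_imp_has_field_derivative) (simp add: linear_cmul[OF linear_info])
qed

text \<open>By the mean value theorem. The curvature bound is required only strictly between
  \<open>s\<close> and \<open>t\<close>, so a segment may end on the boundary of the open ball in
  which curvature is known.\<close>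

lemma score_decrease:
  assumes "s < t" and "\<And>u. s < u \<Longrightarrow> u < t \<Longrightarrow> K \<le> info I \<kappa> A y (b + u *\<^sub>R v) v v"
  shows "score I l \<kappa> A y (b + t *\<^sub>R v) v \<le> score I l \<kappa> A y (b + s *\<^sub>R v) v - (t - s) * K"
proof -
  obtain u where u: "s < u" "u < t"
    "score I l \<kappa> A y (b + t *\<^sub>R v) v - score I l \<kappa> A y (b + s *\<^sub>R v) v =
      (t - s) * (- info I \<kappa> A y (b + u *\<^sub>R v) v v)"
    using MVT2[OF assms(1), of "\<lambda>s. score I l \<kappa> A y (b + s *\<^sub>R v) v"
        "\<lambda>u. - info I \<kappa> A y (b + u *\<^sub>R v) v v"] score_line by blast
  have "(t - s) * K \<le> (t - s) * info I \<kappa> A y (b + u *\<^sub>R v) v v"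
    using assms u by (intro mult_left_mono) auto
  then have "(t - s) * (- info I \<kappa> A y (b + u *\<^sub>R v) v v) \<le> - ((t - s) * K)" by simp
  with u(3) show ?thesis by linarith
qed

lemma score_antimono:
  assumes "s \<le> t" and "\<And>m. m \<in> I \<Longrightarrow> 0 \<le> \<kappa> m"
  shows "score I l \<kappa> A y (b + t *\<^sub>R v) v \<le> score I l \<kappa> A y (b + s *\<^sub>R v) v"
proof (cases "s = t")
  case False
  have "0 \<le> info I \<kappa> A y (b + u *\<^sub>R v) v v" for u
    unfolding info_def by (intro sum_nonneg mult_nonneg_nonneg wcov_nonneg assms) auto
  then show ?thesis using score_decrease[of s t 0 b v] False assms by auto
qed simp

text \<open>The mean value theorem, twice: the difference quotient is the score at an intermediate
  point, and going back from there to \<open>b\<close> costs at most \<open>s * K\<close>. So a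
  bound on one increment controls the score at \<open>b\<close> itself.\<close>

lemma score_le_increment:
  assumes s: "0 < s" and K: "\<And>u. info I \<kappa> A y (b + u *\<^sub>R v) v v \<le> K"
    and \<kappa>: "\<And>m. m \<in> I \<Longrightarrow> 0 \<le> \<kappa> m"
  shows "score I l \<kappa> A y b v \<le> (loglik I l \<kappa> A y (b + s *\<^sub>R v) - loglik I l \<kappa> A y b) / s + s * K"
proof -
  obtain u where u: "0 < u" "u < s"
    "loglik I l \<kappa> A y (b + s *\<^sub>R v) - loglik I l \<kappa> A y (b + 0 *\<^sub>R v) =
      (s - 0) * score I l \<kappa> A y (b + u *\<^sub>R v) v"
    using MVT2[OF s, of "\<lambda>s. loglik I l \<kappa> A y (b + s *\<^sub>R v)"
        "\<lambda>u. score I l \<kappa> A y (b + u *\<^sub>R v) v"] loglik_line by blast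
  obtain z where z: "0 < z" "z < u"
    "score I l \<kappa> A y (b + u *\<^sub>R v) v - score I l \<kappa> A y (b + 0 *\<^sub>R v) v =
      (u - 0) * (- info I \<kappa> A y (b + z *\<^sub>R v) v v)"
    using MVT2[OF u(1), of "\<lambda>s. score I l \<kappa> A y (b + s *\<^sub>R v) v"
        "\<lambda>u. - info I \<kappa> A y (b + u *\<^sub>R v) v v"] score_line by blast
  have "0 \<le> info I \<kappa> A y (b + z *\<^sub>R v) v v"
    unfolding info_def by (intro sum_nonneg mult_nonneg_nonneg wcov_nonneg \<kappa>) auto
  then have "u * info I \<kappa> A y (b + z *\<^sub>R v) v v \<le> s * K" using u K by (intro mult_mono) auto
  moreover have "score I l \<kappa> A y b v = score I l \<kappa> A y (b + u *\<^sub>R v) v +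
      u * info I \<kappa> A y (b + z *\<^sub>R v) v v"
    using z(3) by simp
  moreover have "(loglik I l \<kappa> A y (b + s *\<^sub>R v) - loglik I l \<kappa> A y b) / s =
      score I l \<kappa> A y (b + u *\<^sub>R v) v"
    using u(3) s by simp
  ultimately show ?thesis by linarith
qed

lemma score_eq_0_of_max:
  assumes "is_arg_max (loglik I l \<kappa> A y) (\<lambda>_. True) b"
  shows "score I l \<kappa> A y b v = 0"
proof -
  have "loglik I l \<kappa> A y b' \<le> loglik I l \<kappa> A y b" for b'
    using assms by (simp add: is_arg_max_linorder)
  then have "score I l \<kappa> A y b = (\<lambda>v. 0)"
    by (intro has_derivative_local_max[OF loglik_has_derivative]) auto
  then show ?thesis by simp
qed

end

text \<open>Connects the coordinate definition of \<open>hessian\<close> with \<open>info\<close>: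
  differentiate the gradient componentwise, then expand \<open>u\<close> in the standard
  basis.\<close>

lemma hessian_loglik:
  fixes l :: "'m \<Rightarrow> real^'p"
  assumes finA: "\<And>m. m \<in> I \<Longrightarrow> finite (A m) \<and> A m \<noteq> {}"
  shows "u \<bullet> (hessian (loglik I l \<kappa> A y) b *v v) = - info I \<kappa> A y b u v"
proof -
  have "frechet_derivative (loglik I l \<kappa> A y) (at b) = score I l \<kappa> A y b" for b
    by (rule frechet_derivative_at[symmetric, OF loglik_has_derivative[where A=A and I=I, OF finA]])
  then have grad: "gradient (loglik I l \<kappa> A y) = (\<lambda>b. \<chi> k. score I l \<kappa> A y b (axis k 1))"
    by (simp add: gradient_def[abs_def])
  have der: "((\<lambda>b. \<chi> k. score I l \<kappa> A y b (axis k 1)) has_derivative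
      (\<lambda>h. \<chi> k. - info I \<kappa> A y b (axis k 1) h)) (at b)"
    unfolding has_derivative_componentwise_within[of "\<lambda>b. \<chi> k. score I l \<kappa> A y b (axis k 1)"]
    by (auto simp: Basis_vec_def inner_axis score_has_derivative[where A=A and I=I, OF finA])
  have fd: "frechet_derivative (gradient (loglik I l \<kappa> A y)) (at b) =
      (\<lambda>h. \<chi> k. - info I \<kappa> A y b (axis k 1) h)"
    unfolding grad by (rule frechet_derivative_at[OF der, symmetric])
  have lin: "linear (\<lambda>h. \<chi> k. - info I \<kappa> A y b (axis k 1) h)"
    by (rule has_derivative_linear[OF der])
  have "hessian (loglik I l \<kappa> A y) b *v v = (\<chi> k. - info I \<kappa> A y b (axis k 1) v)"
    unfolding hessian_def jacobian_def fd by (rule matrix_works) (use lin in \<open>simp add: linear_def[symmetric] scalar_mult_eq_scaleR[abs_def]\<close>)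
  then have "u \<bullet> (hessian (loglik I l \<kappa> A y) b *v v) = - (\<Sum>k\<in>UNIV. u $ k * info I \<kappa> A y b v (axis k 1))"
    by (simp add: inner_vec_def sum_negf info_commute[where u=v, of I A, OF finA])
  also have "(\<Sum>k\<in>UNIV. u $ k * info I \<kappa> A y b v (axis k 1)) =
      info I \<kappa> A y b v (\<Sum>k\<in>UNIV. u $ k *\<^sub>R axis k 1)"
    using linear_info[where A=A and I=I, OF finA, of \<kappa> y b v]
    by (simp add: linear_sum linear_cmul)
  also have "(\<Sum>k\<in>UNIV. u $ k *\<^sub>R axis k 1) = u"
    using basis_expansion[of u] by (simp add: scalar_mult_eq_scaleR)
  finally show ?thesis by (simp add: info_commute[where u=v, of I A, OF finA])
qed

text \<open>The Rayleigh quotient. Two facts make the \<open>Min\<close> usable: the set of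
  eigenvalues is finite, and the minimum of the quadratic form on the unit sphere belongs to
  it.\<close>

lemma smallest_eigenvalue_le:
  fixes A :: "real^'p^'p"
  assumes sym: "\<And>u v. u \<bullet> (A *v v) = v \<bullet> (A *v u)" and v: "norm v = 1"
  shows "smallest_eigenvalue A \<le> v \<bullet> (A *v v)"
proof -
  define E where "E = {e. \<exists>v. v \<noteq> 0 \<and> A *v v = e *\<^sub>R v}"
  \<comment> \<open>One eigenvector per eigenvalue. By symmetry they are pairwise orthogonal, hence
    independent, hence finitely many.\<close>
  have "\<exists>f. \<forall>e\<in>E. f e \<noteq> 0 \<and> A *v f e = e *\<^sub>R f e" unfolding E_def by (intro bchoice) auto
  then obtain f where f: "\<And>e. e \<in> E \<Longrightarrow> f e \<noteq> 0 \<and> A *v f e = e *\<^sub>R f e" by blast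
  have orth: "f e \<bullet> f e' = 0" if "e \<in> E" "e' \<in> E" "e \<noteq> e'" for e e'
    using sym[of "f e" "f e'"] f[OF that(1)] f[OF that(2)] that(3)
    by (simp add: inner_commute)
  have inj: "inj_on f E"
  proof (rule inj_onI, rule ccontr)
    fix e e' assume "e \<in> E" "e' \<in> E" "f e = f e'" "e \<noteq> e'"
    then show False using orth[of e e'] f[of e] by simp
  qed
  have "pairwise orthogonal (f ` E)"
    by (auto simp: pairwise_def orthogonal_def intro: orth)
  moreover have "0 \<notin> f ` E" using f by auto
  ultimately have "finite (f ` E)"
    using pairwise_orthogonal_independent independent_imp_finite by blast
  then have finE: "finite E" using inj finite_image_iff by blast
  have "continuous_on (sphere 0 1) (\<lambda>v. v \<bullet> (A *v v))"
    by (intro continuous_on_inner continuous_on_id matrix_vector_mult_linear_continuous_on)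
  moreover have "sphere (0 :: real^'p) 1 \<noteq> {}" using v by force
  ultimately have "\<exists>v0\<in>sphere 0 1. \<forall>u\<in>sphere 0 1. v0 \<bullet> (A *v v0) \<le> u \<bullet> (A *v u)"
    by (intro continuous_attains_inf compact_sphere)
  then obtain v0 where v0: "v0 \<in> sphere 0 1"
    and min: "\<And>u. u \<in> sphere 0 1 \<Longrightarrow> v0 \<bullet> (A *v v0) \<le> u \<bullet> (A *v u)"
    by blast
  define e where "e = v0 \<bullet> (A *v v0)"
  \<comment> \<open>\<open>h\<close> is non-negative and vanishes at the minimizer
    \<open>v0\<close>. If the residual \<open>g\<close> were non-zero, a small step from
    \<open>v0\<close> against it would make \<open>h\<close> negative.\<close>
  define h where "h = (\<lambda>u. u \<bullet> (A *v u) - e * (u \<bullet> u))"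
  have v01: "v0 \<bullet> v0 = 1" using v0 by (simp add: dot_square_norm)
  have h0: "h v0 = 0" by (simp add: h_def v01 e_def)
  have h: "0 \<le> h u" for u
  proof (cases "u = 0")
    case False
    have "e \<le> (u /\<^sub>R norm u) \<bullet> (A *v (u /\<^sub>R norm u))"
      unfolding e_def by (rule min) (use False in simp)
    also have "\<dots> = (u \<bullet> (A *v u)) / (u \<bullet> u)"
      by (simp add: matrix_vector_mult_scaleR dot_square_norm power2_eq_square divide_inverse)
    finally show ?thesis using False by (simp add: h_def pos_le_divide_eq)
  qed (simp add: h_def)
  define g where "g = A *v v0 - e *\<^sub>R v0"
  have quad: "h (v0 + t *\<^sub>R g) = 2 * t * (g \<bullet> g) + t\<^sup>2 * h g" for t
  proof -
    have A: "A *v (v0 + t *\<^sub>R g) = A *v v0 + t *\<^sub>R (A *v g)"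
      by (simp add: matrix_vector_mult_scaleR matrix_vector_right_distrib)
    have "h (v0 + t *\<^sub>R g) = h v0 + 2 * t * (g \<bullet> (A *v v0) - e * (g \<bullet> v0)) + t\<^sup>2 * h g"
      unfolding h_def A by (simp add: inner_add_left inner_add_right sym[of v0 g]
          inner_commute[of v0 g] power2_eq_square) (simp add: algebra_simps)
    also have "g \<bullet> (A *v v0) - e * (g \<bullet> v0) = g \<bullet> g" by (simp add: g_def inner_diff_right)
    finally show ?thesis using h0 by simp
  qed
  have "g = 0"
  proof (rule ccontr)
    assume "g \<noteq> 0"
    then have G: "0 < g \<bullet> g" by simp
    \<comment> \<open>Small enough for the linear term of \<open>quad\<close> to dominate the
      quadratic one; the summand 1 covers \<open>h g = 0\<close>.\<close>
    define t where "t = (g \<bullet> g) / (h g + 1)"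
    have t: "0 < t" "t * h g < g \<bullet> g" using G h[of g] by (auto simp: t_def divide_simps)
    have "h (v0 + (- t) *\<^sub>R g) = t * (t * h g - 2 * (g \<bullet> g))"
      unfolding quad by (simp add: power2_eq_square algebra_simps)
    also have "\<dots> < 0" by (intro mult_pos_neg t(1)) (use t(2) G in linarith)
    finally show False using h[of "v0 + (- t) *\<^sub>R g"] by linarith
  qed
  moreover have "v0 \<noteq> 0" using v01 by auto
  ultimately have "e \<in> E" by (auto simp: E_def g_def)
  then have "Min E \<le> e" using finE by (rule Min_le[rotated])
  also have "e \<le> v \<bullet> (A *v v)" unfolding e_def by (rule min) (use v in simp)
  finally show ?thesis by (simp add: smallest_eigenvalue_def E_def)
qed

section \<open>The two partial likelihoods\<close>

text \<open>The properties of a single outcome on which the deterministic part relies. Neither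
  \<open>B\<close> nor \<open>\<Lambda>\<close> may depend on the number of events.\<close>

definition bounded_data ::
  "real \<Rightarrow> nat \<Rightarrow> 'm set \<Rightarrow> ('m \<Rightarrow> 'j set) \<Rightarrow> ('m \<Rightarrow> 'j set) \<Rightarrow> ('m \<Rightarrow> 'j \<Rightarrow> 'v::real_normed_vector) \<Rightarrow> bool"
  where "bounded_data B \<Lambda> I R D X \<longleftrightarrow> finite I \<and> I \<noteq> {} \<and>
    (\<forall>m\<in>I. finite (R m) \<and> D m \<subseteq> R m \<and> D m \<noteq> {} \<and> card (D m) \<le> \<Lambda> \<and> (\<forall>j\<in>R m. norm (X m j) \<le> B))"

abbreviation "exact_loglik I R D X \<equiv>
  loglik I (\<lambda>m. \<Sum>j\<in>D m. X m j) (\<lambda>_. 1) (\<lambda>m. ksubsets (R m) (card (D m))) (\<lambda>m. sum (X m))"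

abbreviation "exact_score I R D X \<equiv>
  score I (\<lambda>m. \<Sum>j\<in>D m. X m j) (\<lambda>_. 1) (\<lambda>m. ksubsets (R m) (card (D m))) (\<lambda>m. sum (X m))"

abbreviation "exact_info I R D X \<equiv>
  info I (\<lambda>_. 1) (\<lambda>m. ksubsets (R m) (card (D m))) (\<lambda>m. sum (X m))"

abbreviation "approx_loglik I R D X \<equiv>
  loglik I (\<lambda>m. \<Sum>j\<in>D m. X m j) (\<lambda>m. real (card (D m))) R X"

abbreviation "approx_score I R D X \<equiv>
  score I (\<lambda>m. \<Sum>j\<in>D m. X m j) (\<lambda>m. real (card (D m))) R X"

abbreviation "approx_info I R D X \<equiv> info I (\<lambda>m. real (card (D m))) R X"

abbreviation "inverse_sizes I R D \<equiv> (\<Sum>m\<in>I. of_bool (card (D m) > 1) / real (card (R m)))"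

lemma bounded_dataD:
  assumes "bounded_data B \<Lambda> I R D X" "m \<in> I"
  shows "finite (R m)" "R m \<noteq> {}" "D m \<subseteq> R m" "1 \<le> card (D m)" "card (D m) \<le> \<Lambda>"
    "card (D m) \<le> card (R m)" "\<And>j. j \<in> R m \<Longrightarrow> norm (X m j) \<le> B"
    "finite (ksubsets (R m) (card (D m)))" "ksubsets (R m) (card (D m)) \<noteq> {}"
proof -
  have *: "finite (R m)" "D m \<subseteq> R m" "D m \<noteq> {}" "card (D m) \<le> \<Lambda>" "\<And>j. j \<in> R m \<Longrightarrow> norm (X m j) \<le> B"
    using assms by (auto simp: bounded_data_def)
  then show "finite (R m)" "R m \<noteq> {}" "D m \<subseteq> R m" "card (D m) \<le> \<Lambda>" "card (D m) \<le> card (R m)"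
    "\<And>j. j \<in> R m \<Longrightarrow> norm (X m j) \<le> B" "finite (ksubsets (R m) (card (D m)))"
    "ksubsets (R m) (card (D m)) \<noteq> {}"
    by (auto intro: card_mono)
  show "1 \<le> card (D m)" using * finite_subset by (metis One_nat_def Suc_leI card_gt_0_iff)
qed

lemma exp_inner_sum: "exp (b \<bullet> sum X J) = (\<Prod>j\<in>J. exp (b \<bullet> X j))"
  by (cases "finite J") (simp_all add: inner_sum_right exp_sum)

lemma inner_sum_fun: "(\<lambda>J. v \<bullet> sum X J) = sum (\<lambda>j. v \<bullet> X j)"
  by (simp add: fun_eq_iff inner_sum_right)

lemma abs_inner_unit_le: "norm (v :: 'v::real_inner) = 1 \<Longrightarrow> norm x \<le> B \<Longrightarrow> \<bar>v \<bullet> x\<bar> \<le> B"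
  using Cauchy_Schwarz_ineq2[of v x] by simp

text \<open>The scores differ by the two sampling means of \<open>v \<bullet> X m j\<close>, event
  by event. \<open>sampling_mean_diff\<close> applies with \<open>q = exp (2 * \<rho> * B)\<close>,
  and its factor \<open>1 / card A\<close> adds up to \<open>inverse_sizes\<close>.\<close>

lemma score_diff_le:
  fixes X :: "'m \<Rightarrow> 'j \<Rightarrow> 'v::real_inner"
  assumes data: "bounded_data B \<Lambda> I R D X" and B: "0 < B"
    and b: "norm b \<le> \<rho>" and v: "norm v = 1"
  shows "\<bar>exact_score I R D X b v - approx_score I R D X b v\<bar>
    \<le> 4 * B * exp (2 * \<rho> * B) * (real \<Lambda>)\<^sup>2 * inverse_sizes I R D"
proof -
  have \<rho>: "0 \<le> \<rho>" using b norm_ge_zero order_trans by blast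
  define w where "w = (\<lambda>m j. exp (b \<bullet> X m j))"
  define a where "a = (\<lambda>m j. v \<bullet> X m j)"
  have "exact_score I R D X b v - approx_score I R D X b v =
      (\<Sum>m\<in>I. real (card (D m)) * wmean (R m) (w m) (a m) -
        wmean (ksubsets (R m) (card (D m))) (prod (w m)) (sum (a m)))"
    unfolding score_def sum_subtractf[symmetric]
    by (intro sum.cong refl) (simp add: exp_inner_sum inner_sum_fun w_def a_def)
  also have "\<bar>\<dots>\<bar> \<le> (\<Sum>m\<in>I. \<bar>real (card (D m)) * wmean (R m) (w m) (a m) -
        wmean (ksubsets (R m) (card (D m))) (prod (w m)) (sum (a m))\<bar>)"
    by (rule sum_abs)
  also have "\<dots> \<le> (\<Sum>m\<in>I. 4 * B * exp (2 * \<rho> * B) * (real \<Lambda>)\<^sup>2 *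
      (of_bool (card (D m) > 1) / real (card (R m))))"
  proof (rule sum_mono)
    fix m assume m: "m \<in> I"
    note R = bounded_dataD[OF data m]
    have "\<bar>real (card (D m)) * wmean (R m) (w m) (a m) -
        wmean (ksubsets (R m) (card (D m))) (prod (w m)) (sum (a m))\<bar>
        \<le> 4 * B * exp (2 * \<rho> * B) * (real (card (D m)))\<^sup>2 * (of_bool (card (D m) > 1) / real (card (R m)))"
    proof (rule sampling_mean_diff)
      fix j assume j: "j \<in> R m"
      show "w m j * real (card (R m)) \<le> exp (2 * \<rho> * B) * sum (w m) (R m)"
        unfolding w_def by (rule exp_weight_share[OF b R(7) \<rho> j])
      show "\<bar>a m j\<bar> \<le> B" unfolding a_def by (rule abs_inner_unit_le[OF v R(7)[OF j]])
    qed (use R B in \<open>auto simp: w_def\<close>)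
    also have "\<dots> \<le> 4 * B * exp (2 * \<rho> * B) * (real \<Lambda>)\<^sup>2 * (of_bool (card (D m) > 1) / real (card (R m)))"
      using R B by (intro mult_right_mono mult_left_mono power_mono) auto
    finally show "\<bar>real (card (D m)) * wmean (R m) (w m) (a m) -
        wmean (ksubsets (R m) (card (D m))) (prod (w m)) (sum (a m))\<bar>
        \<le> 4 * B * exp (2 * \<rho> * B) * (real \<Lambda>)\<^sup>2 * (of_bool (card (D m) > 1) / real (card (R m)))" .
  qed
  finally show ?thesis unfolding sum_distrib_left[symmetric] .
qed

text \<open>A sum of at most \<open>\<Lambda>\<close> projections bounded by \<open>B\<close> has
  variance at most \<open>(\<Lambda> * B)\<^sup>2\<close>. The bound is uniform in \<open>b\<close>,
  as \<open>score_le_increment\<close> requires.\<close>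

lemma exact_info_le:
  fixes X :: "'m \<Rightarrow> 'j \<Rightarrow> 'v::real_inner"
  assumes data: "bounded_data B \<Lambda> I R D X" and B: "0 < B" and v: "norm v = 1"
  shows "exact_info I R D X b v v \<le> real (card I) * (real \<Lambda> * B)\<^sup>2"
proof -
  have "exact_info I R D X b v v \<le> (\<Sum>m\<in>I. (real \<Lambda> * B)\<^sup>2)"
    unfolding info_def
  proof (rule sum_mono)
    fix m assume m: "m \<in> I"
    note R = bounded_dataD[OF data m]
    have "\<bar>v \<bullet> sum (X m) J\<bar> \<le> real \<Lambda> * B" if J: "J \<in> ksubsets (R m) (card (D m))" for J
    proof -
      have "norm (sum (X m) J) \<le> (\<Sum>j\<in>J. B)"
        using J R by (intro sum_norm_le) auto
      also have "\<dots> \<le> real \<Lambda> * B" using J R B by simp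
      finally show ?thesis by (rule abs_inner_unit_le[OF v])
    qed
    then show "1 * wcov (ksubsets (R m) (card (D m))) (\<lambda>k. exp (b \<bullet> sum (X m) k))
        (\<lambda>k. v \<bullet> sum (X m) k) (\<lambda>k. v \<bullet> sum (X m) k) \<le> (real \<Lambda> * B)\<^sup>2"
      unfolding mult_1 by (intro wcov_le_square) auto
  qed
  then show ?thesis by simp
qed

text \<open>If \<open>bh\<close> were at distance at least \<open>r\<close>, the curvature on the last part of the segment from \<open>b0\<close> to
  \<open>bh\<close> would make the score decrease by more than its value at \<open>b0\<close>.\<close>

lemma maximizer_near_true_parameter:
  fixes b0 :: "'v::real_inner"
  assumes B: "0 < B" and \<Lambda>: "1 \<le> \<Lambda>" and r: "0 < r" and c: "0 < c"
  shows "\<exists>\<eta>>0. \<forall>(I :: 'm set) (R :: 'm \<Rightarrow> 'j set) D X bh. bounded_data B \<Lambda> I R D X \<longrightarrow>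
    (\<forall>v. norm v = 1 \<longrightarrow> exact_score I R D X b0 v \<le> \<eta> * real (card I)) \<longrightarrow>
    inverse_sizes I R D \<le> \<eta> * real (card I) \<longrightarrow>
    (\<forall>v. exact_score I R D X bh v = 0) \<longrightarrow>
    (\<forall>b\<in>ball bh r. \<forall>v. norm v = 1 \<longrightarrow> c * real (card I) \<le> approx_info I R D X b v v) \<longrightarrow>
    norm (bh - b0) < r"
proof -
  \<comment> \<open>An event that contributes more than \<open>c / 2\<close> to the approximate
    information has variance at least \<open>\<gamma>\<close>, because it has at most
    \<open>\<Lambda>\<close> receivers.\<close>
  define \<gamma> where "\<gamma> = c / (2 * real \<Lambda>)"
  have \<gamma>: "0 < \<gamma>" using c \<Lambda> by (simp add: \<gamma>_def)
  obtain N0 \<kappa> where N0: "0 < N0" and \<kappa>: "0 < \<kappa>" and unif: "\<forall>(A :: 'j set) x b v s L.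
    finite A \<longrightarrow> norm v = 1 \<longrightarrow> norm b \<le> norm b0 \<longrightarrow> (\<forall>j\<in>A. norm (x j :: 'v) \<le> B) \<longrightarrow> 0 \<le> s \<longrightarrow>
    1 \<le> L \<longrightarrow> L \<le> \<Lambda> \<longrightarrow> L \<le> card A \<longrightarrow> L = 1 \<or> N0 \<le> real (card A) \<longrightarrow>
    \<gamma> \<le> wcov A (\<lambda>j. exp ((b + s *\<^sub>R v) \<bullet> x j)) (\<lambda>j. v \<bullet> x j) (\<lambda>j. v \<bullet> x j) \<longrightarrow>
    \<kappa> \<le> wcov (ksubsets A L) (prod (\<lambda>j. exp ((b + s *\<^sub>R v) \<bullet> x j))) (sum (\<lambda>j. v \<bullet> x j)) (sum (\<lambda>j. v \<bullet> x j))"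
    using wcov_ksubsets_uniform_ge[OF B norm_ge_zero \<gamma> \<Lambda>, of b0]
    by (elim exE conjE) (rule that, assumption+)
  \<comment> \<open>The most that one event can contribute to the approximate information.\<close>
  define M where "M = real \<Lambda> * B\<^sup>2"
  have M: "0 < M" using \<Lambda> B by (simp add: M_def)
  define \<kappa>1 where "\<kappa>1 = \<kappa> / M"
  have \<kappa>1: "0 < \<kappa>1" using \<kappa> M by (simp add: \<kappa>1_def)
  \<comment> \<open>Of the curvature \<open>c * n\<close>, at most \<open>c * n / 2\<close> is lost
    to events with small contributions and \<open>c * n / 4\<close> to events with too few available
    receivers.\<close>
  define K where "K = \<kappa>1 * (c / 4)"
  have K: "0 < K" using \<kappa>1 c by (simp add: K_def)
  \<comment> \<open>The first bound limits the loss from events with few available receivers, as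
    \<open>G\<close> counts each of them with at least \<open>1 / N0\<close>. The second makes the
    score at \<open>b0\<close> too small for a decrease by \<open>r * K * n\<close>.\<close>
  define \<eta> where "\<eta> = min (c / (4 * M * N0)) (r * K / 2)"
  have \<eta>: "0 < \<eta>" using c M N0 r K by (simp add: \<eta>_def)
  show ?thesis
  proof (rule exI[of _ \<eta>], intro conjI \<eta> allI impI)
    fix I :: "'m set" and R D :: "'m \<Rightarrow> 'j set" and X and bh :: 'v
    assume data: "bounded_data B \<Lambda> I R D X"
      and sc0: "\<forall>v. norm v = 1 \<longrightarrow> exact_score I R D X b0 v \<le> \<eta> * real (card I)"
      and G: "inverse_sizes I R D \<le> \<eta> * real (card I)"
      and sch: "\<forall>v. exact_score I R D X bh v = 0"
      and curv: "\<forall>b\<in>ball bh r. \<forall>v. norm v = 1 \<longrightarrow> c * real (card I) \<le> approx_info I R D X b v v"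
    define n where "n = real (card I)"
    have n: "0 < n" using data by (auto simp: n_def bounded_data_def card_gt_0_iff)
    have finA: "finite (ksubsets (R m) (card (D m))) \<and> ksubsets (R m) (card (D m)) \<noteq> {}" if "m \<in> I" for m
      using bounded_dataD[OF data that] by blast
    show "norm (bh - b0) < r"
    proof (rule ccontr)
      assume "\<not> norm (bh - b0) < r"
      define d where "d = norm (bh - b0)"
      have d: "r \<le> d" "0 < d" using \<open>\<not> norm (bh - b0) < r\<close> r by (auto simp: d_def)
      define v where "v = (bh - b0) /\<^sub>R d"
      have v: "norm v = 1" using d by (simp add: v_def d_def)
      have bh: "bh = b0 + d *\<^sub>R v" using d by (simp add: v_def)
      have info: "K * n \<le> exact_info I R D X (b0 + u *\<^sub>R v) v v" if u: "d - r < u" "u < d" for u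
      proof -
        define b where "b = b0 + u *\<^sub>R v"
        have u0: "0 \<le> u" using u d by simp
        have "bh - b = (d - u) *\<^sub>R v" unfolding bh b_def by (simp add: algebra_simps)
        then have "b \<in> ball bh r" using v u by (simp add: dist_norm)
        then have cv: "c * n \<le> approx_info I R D X b v v" using curv v by (simp add: n_def)
        define g where "g = (\<lambda>m. of_bool (card (D m) > 1) / real (card (R m)))"
        define w where "w = (\<lambda>m j. exp (b \<bullet> X m j))"
        define a where "a = (\<lambda>m j. v \<bullet> X m j)"
        have Gg: "sum g I \<le> c / (4 * M * N0) * n"
        proof -
          have "sum g I \<le> \<eta> * n" using G by (simp add: g_def n_def)
          also have "\<dots> \<le> c / (4 * M * N0) * n" using n by (intro mult_right_mono) (auto simp: \<eta>_def)
          finally show ?thesis .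
        qed
        \<comment> \<open>A linear lower bound valid for every event, so that it can be summed. It
          is non-positive for small contributions; with several receivers and fewer than
          \<open>N0\<close> available, \<open>N0 * g m\<close> is at least 1 and the penalty exceeds
          \<open>M\<close>. Otherwise the variance transfer applies.\<close>
        have per_term: "\<kappa>1 * (real (card (D m)) * wcov (R m) (w m) (a m) (a m) - c / 2 - M * N0 * g m)
            \<le> wcov (ksubsets (R m) (card (D m))) (prod (w m)) (sum (a m)) (sum (a m))" if m: "m \<in> I" for m
        proof -
          note R = bounded_dataD[OF data m]
          define V where "V = wcov (R m) (w m) (a m) (a m)"
          define V' where "V' = wcov (ksubsets (R m) (card (D m))) (prod (w m)) (sum (a m)) (sum (a m))"
          define L where "L = card (D m)"
          have V'0: "0 \<le> V'" unfolding V'_def by (intro wcov_nonneg prod_nonneg) (auto simp: w_def)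
          have V0: "0 \<le> V" unfolding V_def by (intro wcov_nonneg) (auto simp: w_def)
          have VB: "V \<le> B\<^sup>2" unfolding V_def
            by (rule wcov_le_square) (use abs_inner_unit_le[OF v] R in \<open>auto simp: w_def a_def\<close>)
          have L\<Lambda>: "real L \<le> real \<Lambda>" "1 \<le> real L" using R by (auto simp: L_def)
          have LV: "real L * V \<le> M" unfolding M_def using L\<Lambda> VB V0 by (intro mult_mono) auto
          have g0: "0 \<le> g m" by (simp add: g_def)
          have Mg: "0 \<le> M * N0 * g m" using M N0 g0 by simp
          consider (small) "real L * V \<le> c / 2" | (bad) "L \<noteq> 1" "real (card (R m)) < N0"
            | (good) "c / 2 < real L * V" "L = 1 \<or> N0 \<le> real (card (R m))" by linarith
          then have "\<kappa>1 * (real L * V - c / 2 - M * N0 * g m) \<le> V'"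
          proof cases
            case small
            then have "\<kappa>1 * (real L * V - c / 2 - M * N0 * g m) \<le> 0"
              using Mg \<kappa>1 by (intro mult_nonneg_nonpos) auto
            with V'0 show ?thesis by linarith
          next
            case bad
            have "0 < card (R m)" using R by (simp add: card_gt_0_iff)
            then have "1 \<le> N0 * g m" using bad R by (simp add: g_def L_def)
            then have "M \<le> M * N0 * g m" using M by (simp add: mult.assoc)
            then have "\<kappa>1 * (real L * V - c / 2 - M * N0 * g m) \<le> 0"
              using LV c \<kappa>1 by (intro mult_nonneg_nonpos) auto
            with V'0 show ?thesis by linarith
          next
            case good
            have "c / 2 \<le> real \<Lambda> * V" using good L\<Lambda> V0 mult_right_mono[of "real L" "real \<Lambda>" V] by linarith
            then have \<gamma>V: "\<gamma> \<le> V" using \<Lambda> by (simp add: \<gamma>_def field_simps)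
            have "\<kappa> \<le> V'"
              unfolding V'_def w_def a_def b_def L_def[symmetric]
            \<comment> \<open>The parameter is split as \<open>b0\<close> plus a multiple of
              \<open>v\<close>, the same direction in which the variance is taken. So
              \<open>u\<close> may be arbitrarily large without affecting
              \<open>\<kappa>\<close>.\<close>
            proof (rule unif[rule_format])
              show "\<gamma> \<le> wcov (R m) (\<lambda>j. exp ((b0 + u *\<^sub>R v) \<bullet> X m j)) (\<lambda>j. v \<bullet> X m j) (\<lambda>j. v \<bullet> X m j)"
                using \<gamma>V unfolding V_def w_def a_def b_def .
              show "L = 1 \<or> N0 \<le> real (card (R m))" by (rule good(2))
              show "1 \<le> L" "L \<le> \<Lambda>" "L \<le> card (R m)" using R by (simp_all add: L_def)
            qed (fact R(1) v order_refl u0 R(7))+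
            moreover have "\<kappa>1 * (real L * V - c / 2 - M * N0 * g m) \<le> \<kappa>1 * M"
              using LV c Mg \<kappa>1 by (intro mult_left_mono) auto
            moreover have "\<kappa>1 * M = \<kappa>" using M by (simp add: \<kappa>1_def)
            ultimately show ?thesis by linarith
          qed
          then show ?thesis by (simp add: V_def V'_def L_def)
        qed
        have MG: "M * N0 * sum g I \<le> c * n / 4"
        proof -
          have "M * N0 * sum g I \<le> M * N0 * (c / (4 * M * N0) * n)"
            using Gg M N0 by (intro mult_left_mono) auto
          then show ?thesis using M N0 by simp
        qed
        have "K * n = \<kappa>1 * (c * n - c * n / 2 - c * n / 4)" by (simp add: K_def)
        also have "\<dots> \<le> \<kappa>1 * (approx_info I R D X b v v - c * n / 2 - M * N0 * sum g I)"
          using cv MG \<kappa>1 by (intro mult_left_mono) auto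
        also have "\<dots> = (\<Sum>m\<in>I. \<kappa>1 * (real (card (D m)) * wcov (R m) (w m) (a m) (a m) - c / 2 - M * N0 * g m))"
          by (simp add: info_def n_def w_def a_def sum_distrib_left[symmetric] sum_subtractf)
        also have "\<dots> \<le> exact_info I R D X b v v"
          unfolding info_def mult_1 exp_inner_sum inner_sum_fun
          using sum_mono[OF per_term] by (simp add: w_def a_def)
        finally show ?thesis by (simp add: b_def)
      qed
      have "exact_score I R D X (b0 + d *\<^sub>R v) v \<le>
          exact_score I R D X (b0 + (d - r) *\<^sub>R v) v - (d - (d - r)) * (K * n)"
        by (rule score_decrease) (use r info finA in auto)
      also have "exact_score I R D X (b0 + (d - r) *\<^sub>R v) v \<le> exact_score I R D X (b0 + 0 *\<^sub>R v) v"
        by (rule score_antimono) (use d finA in auto)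
      also have "exact_score I R D X (b0 + 0 *\<^sub>R v) v \<le> \<eta> * n" using sc0 v by (simp add: n_def)
      finally have "0 \<le> \<eta> * n - r * (K * n)" using sch bh by simp
      moreover have "\<eta> * n \<le> r * K / 2 * n" using n by (intro mult_right_mono) (auto simp: \<eta>_def)
      moreover have "0 < r * K * n" using r K n by simp
      ultimately show False by simp
    qed
  qed
qed

text \<open>The exact score vanishes at \<open>bh\<close>, so the approximate one is at most
  \<open>K * G\<close> there. It falls at rate \<open>c * n\<close> towards \<open>bt\<close>, where
  it vanishes.\<close>

lemma maximizers_close:
  fixes X :: "'m \<Rightarrow> 'j \<Rightarrow> 'v::real_inner"
  assumes data: "bounded_data B \<Lambda> I R D X" and B: "0 < B" and r: "0 < r" and c: "0 < c"
    and bh: "norm bh \<le> \<rho>" "\<And>v. exact_score I R D X bh v = 0"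
    and bt: "\<And>v. approx_score I R D X bt v = 0"
    and curv: "\<And>b v. b \<in> ball bh r \<Longrightarrow> norm v = 1 \<Longrightarrow> c * real (card I) \<le> approx_info I R D X b v v"
    and K: "K = 4 * B * exp (2 * \<rho> * B) * (real \<Lambda>)\<^sup>2"
    and G: "K * inverse_sizes I R D < c * r * real (card I)"
  shows "norm (bt - bh) \<le> K / c * (inverse_sizes I R D / real (card I))"
proof (cases "bt = bh")
  case True
  then show ?thesis using B c by (auto simp: K intro!: mult_nonneg_nonneg divide_nonneg_nonneg sum_nonneg)
next
  case False
  define G n where "G = inverse_sizes I R D" and "n = real (card I)"
  have n: "0 < n" using data by (auto simp: n_def bounded_data_def card_gt_0_iff)
  define d where "d = norm (bt - bh)"
  have d: "0 < d" using False by (simp add: d_def)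
  define v where "v = (bt - bh) /\<^sub>R d"
  have v: "norm v = 1" using d by (simp add: v_def d_def)
  have bt_eq: "bt = bh + d *\<^sub>R v" using d by (simp add: v_def)
  \<comment> \<open>Curvature is known only within \<open>r\<close> of \<open>bh\<close>. If
    \<open>bt\<close> were farther away, the fall over length \<open>r\<close> would already exceed
    \<open>K * G\<close>, against the hypothesis \<open>G\<close>.\<close>
  define t where "t = min d r"
  have t: "0 < t" "t \<le> d" "t \<le> r" using d r by (auto simp: t_def)
  have finA: "finite (R m) \<and> R m \<noteq> {}" if "m \<in> I" for m
    using bounded_dataD[OF data that] by blast
  have "approx_score I R D X (bh + d *\<^sub>R v) v \<le> approx_score I R D X (bh + t *\<^sub>R v) v"
    by (rule score_antimono) (use t finA in auto)
  also have "\<dots> \<le> approx_score I R D X (bh + 0 *\<^sub>R v) v - (t - 0) * (c * n)"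
  proof (rule score_decrease)
    fix u assume u: "0 < u" "u < t"
    show "c * n \<le> approx_info I R D X (bh + u *\<^sub>R v) v v"
      unfolding n_def by (rule curv) (use u t v in \<open>auto simp: dist_norm\<close>)
  qed (use t finA in auto)
  also have "approx_score I R D X (bh + 0 *\<^sub>R v) v \<le> K * G"
    using score_diff_le[OF data B bh(1) v] bh(2)[of v] by (simp add: K G_def)
  finally have tK: "t * (c * n) \<le> K * G" using bt[of v] by (simp add: bt_eq[symmetric])
  have "t = d"
  proof (rule ccontr)
    assume "t \<noteq> d"
    then have "t = r" by (simp add: t_def split: if_splits)
    then show False using tK G by (simp add: G_def n_def mult_ac)
  qed
  then show ?thesis
    unfolding d_def[symmetric] G_def[symmetric] n_def[symmetric] using tK n c by (simp add: field_simps)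
qed

text \<open>By linearity, bounds along plus and minus each basis vector control the score in all
  directions. The increments are allowed order \<open>s\<^sup>2\<close> so that, divided by
  \<open>s\<close>, they match the second-order error of \<open>score_le_increment\<close>.\<close>

lemma exact_score_le_of_increments:
  fixes X :: "'m \<Rightarrow> 'j \<Rightarrow> 'v::euclidean_space"
  assumes data: "bounded_data B \<Lambda> I R D X" and B: "0 < B" and s: "0 < s"
    and inc: "\<And>e. e \<in> Basis \<union> uminus ` Basis \<Longrightarrow>
      exact_loglik I R D X (b0 + s *\<^sub>R e) - exact_loglik I R D X b0 \<le> s\<^sup>2 * real (card I)"
    and v: "norm v = 1"
  shows "exact_score I R D X b0 v \<le> real DIM('v) * (s * (1 + (real \<Lambda> * B)\<^sup>2)) * real (card I)"
proof -
  define n where "n = real (card I)"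
  have finA: "finite (ksubsets (R m) (card (D m))) \<and> ksubsets (R m) (card (D m)) \<noteq> {}" if "m \<in> I" for m
    using bounded_dataD[OF data that] by blast
  define Q where "Q = s * (1 + (real \<Lambda> * B)\<^sup>2) * n"
  have one: "exact_score I R D X b0 e \<le> Q" if e: "e \<in> Basis \<union> uminus ` Basis" for e
  proof -
    have ne: "norm e = 1" using e by auto
    have "exact_score I R D X b0 e \<le>
        (exact_loglik I R D X (b0 + s *\<^sub>R e) - exact_loglik I R D X b0) / s + s * (n * (real \<Lambda> * B)\<^sup>2)"
    proof (rule score_le_increment[OF finA s])
      show "exact_info I R D X (b0 + u *\<^sub>R e) e e \<le> n * (real \<Lambda> * B)\<^sup>2" for u
        unfolding n_def by (rule exact_info_le[OF data B ne])
    qed simp_all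
    also have "\<dots> \<le> s\<^sup>2 * n / s + s * (n * (real \<Lambda> * B)\<^sup>2)"
      using inc[OF e] s by (intro add_right_mono divide_right_mono) (auto simp: n_def)
    also have "\<dots> = Q" using s by (simp add: Q_def power2_eq_square algebra_simps)
    finally show ?thesis .
  qed
  note lin = linear_score[where I=I and A="\<lambda>m. ksubsets (R m) (card (D m))", OF finA]
  have abs: "\<bar>exact_score I R D X b0 e\<bar> \<le> Q" if e: "e \<in> Basis" for e
  proof -
    have "exact_score I R D X b0 (- e) = - exact_score I R D X b0 e" by (rule linear_neg[OF lin])
    moreover have "exact_score I R D X b0 e \<le> Q" "exact_score I R D X b0 (- e) \<le> Q"
      using e by (auto intro!: one)
    ultimately show ?thesis by linarith
  qed
  have "exact_score I R D X b0 v = exact_score I R D X b0 (\<Sum>e\<in>Basis. (v \<bullet> e) *\<^sub>R e)"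
    by (simp add: euclidean_representation)
  also have "\<dots> = (\<Sum>e\<in>Basis. (v \<bullet> e) * exact_score I R D X b0 e)"
    by (simp add: linear_sum[OF lin] linear_cmul[OF lin])
  also have "\<dots> \<le> (\<Sum>e\<in>(Basis::'v set). Q)"
  proof (rule sum_mono)
    fix e :: 'v assume e: "e \<in> Basis"
    have "(v \<bullet> e) * exact_score I R D X b0 e \<le> \<bar>v \<bullet> e\<bar> * \<bar>exact_score I R D X b0 e\<bar>"
      unfolding abs_mult[symmetric] by (rule abs_ge_self)
    also have "\<dots> \<le> 1 * Q"
      using abs[OF e] Basis_le_norm[OF e, of v] v by (intro mult_mono) auto
    finally show "(v \<bullet> e) * exact_score I R D X b0 e \<le> Q" by simp
  qed
  finally show ?thesis by (simp add: Q_def n_def mult.assoc)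
qed

text \<open>The outcome of the deterministic part. The order of quantifiers matters:
  \<open>s\<close>, \<open>\<eta>\<close> and \<open>K\<close> are fixed before the data, hence
  serve all \<open>n\<close> and all outcomes in a good event.\<close>

lemma maximizers_close_of_increments:
  fixes b0 :: "'v::euclidean_space"
  assumes B: "0 < B" and \<Lambda>: "1 \<le> \<Lambda>" and r: "0 < r" and c: "0 < c"
  shows "\<exists>s>0. \<exists>\<eta>>0. \<exists>K. \<forall>(I :: 'm set) (R :: 'm \<Rightarrow> 'j set) D X bh bt. bounded_data B \<Lambda> I R D X \<longrightarrow>
    (\<forall>e\<in>Basis \<union> uminus ` Basis.
      exact_loglik I R D X (b0 + s *\<^sub>R e) - exact_loglik I R D X b0 \<le> s\<^sup>2 * real (card I)) \<longrightarrow>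
    inverse_sizes I R D \<le> \<eta> * real (card I) \<longrightarrow>
    is_arg_max (exact_loglik I R D X) (\<lambda>_. True) bh \<longrightarrow>
    is_arg_max (approx_loglik I R D X) (\<lambda>_. True) bt \<longrightarrow>
    (\<forall>b\<in>ball bh r. \<forall>v. norm v = 1 \<longrightarrow> c * real (card I) \<le> approx_info I R D X b v v) \<longrightarrow>
    norm (bt - bh) \<le> K * (inverse_sizes I R D / real (card I))"
proof -
  obtain \<eta>1 where \<eta>1: "0 < \<eta>1" and near: "\<forall>(I :: 'm set) (R :: 'm \<Rightarrow> 'j set) D X bh. bounded_data B \<Lambda> I R D X \<longrightarrow>
    (\<forall>v. norm v = 1 \<longrightarrow> exact_score I R D X b0 v \<le> \<eta>1 * real (card I)) \<longrightarrow>
    inverse_sizes I R D \<le> \<eta>1 * real (card I) \<longrightarrow>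
    (\<forall>v. exact_score I R D X bh v = 0) \<longrightarrow>
    (\<forall>b\<in>ball bh r. \<forall>v. norm v = 1 \<longrightarrow> c * real (card I) \<le> approx_info I R D X b v v) \<longrightarrow>
    norm (bh - b0) < r"
    using maximizer_near_true_parameter[OF assms, of b0] by (elim exE conjE) (rule that, assumption+)
  define \<rho> where "\<rho> = norm b0 + r"
  define K where "K = 4 * B * exp (2 * \<rho> * B) * (real \<Lambda>)\<^sup>2"
  have K: "0 < K" using B \<Lambda> by (simp add: K_def)
  define P where "P = real DIM('v) * (1 + (real \<Lambda> * B)\<^sup>2)"
  have P: "0 < P" unfolding P_def by (intro mult_pos_pos add_pos_nonneg) auto
  \<comment> \<open>\<open>exact_score_le_of_increments\<close> gives the bound
    \<open>s * P * n\<close>, to be turned into \<open>\<eta>1 * n\<close>.\<close>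
  define s where "s = \<eta>1 / P"
  have s: "0 < s" using \<eta>1 P by (simp add: s_def)
  \<comment> \<open>The factor 2 yields the strict inequality on \<open>K * G\<close> required by
    \<open>maximizers_close\<close>.\<close>
  define \<eta> where "\<eta> = min \<eta>1 (c * r / (2 * K))"
  have \<eta>: "0 < \<eta>" using \<eta>1 c r K by (simp add: \<eta>_def)
  show ?thesis
  proof (rule exI[of _ s], intro conjI s, rule exI[of _ \<eta>], intro conjI \<eta>, rule exI[of _ "K / c"],
      intro allI impI)
    fix I :: "'m set" and R D :: "'m \<Rightarrow> 'j set" and X and bh bt :: 'v
    assume data: "bounded_data B \<Lambda> I R D X"
      and inc: "\<forall>e\<in>Basis \<union> uminus ` Basis.
        exact_loglik I R D X (b0 + s *\<^sub>R e) - exact_loglik I R D X b0 \<le> s\<^sup>2 * real (card I)"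
      and G: "inverse_sizes I R D \<le> \<eta> * real (card I)"
      and bh: "is_arg_max (exact_loglik I R D X) (\<lambda>_. True) bh"
      and bt: "is_arg_max (approx_loglik I R D X) (\<lambda>_. True) bt"
      and curv: "\<forall>b\<in>ball bh r. \<forall>v. norm v = 1 \<longrightarrow> c * real (card I) \<le> approx_info I R D X b v v"
    have n: "0 < real (card I)" using data by (auto simp: bounded_data_def card_gt_0_iff)
    have sch: "exact_score I R D X bh v = 0" for v
    proof (rule score_eq_0_of_max[OF _ bh])
      show "finite (ksubsets (R m) (card (D m))) \<and> ksubsets (R m) (card (D m)) \<noteq> {}" if "m \<in> I" for m
        using bounded_dataD(8,9)[OF data that] by blast
    qed
    have sct: "approx_score I R D X bt v = 0" for v
    proof (rule score_eq_0_of_max[OF _ bt])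
      show "finite (R m) \<and> R m \<noteq> {}" if "m \<in> I" for m
        using bounded_dataD(1,2)[OF data that] by blast
    qed
    have a1: "\<forall>v. norm v = 1 \<longrightarrow> exact_score I R D X b0 v \<le> \<eta>1 * real (card I)"
    proof (intro allI impI)
      fix v :: 'v assume v: "norm v = 1"
      have "exact_score I R D X b0 v \<le> real DIM('v) * (s * (1 + (real \<Lambda> * B)\<^sup>2)) * real (card I)"
        by (rule exact_score_le_of_increments[OF data B s _ v]) (use inc in auto)
      also have "real DIM('v) * (s * (1 + (real \<Lambda> * B)\<^sup>2)) = s * P" by (simp add: P_def)
      also have "s * P = \<eta>1" using P by (simp add: s_def)
      finally show "exact_score I R D X b0 v \<le> \<eta>1 * real (card I)" .
    qed
    have "\<eta> * real (card I) \<le> \<eta>1 * real (card I)"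
      using n by (intro mult_right_mono) (auto simp: \<eta>_def)
    with G have a2: "inverse_sizes I R D \<le> \<eta>1 * real (card I)" by (rule order_trans)
    have a3: "\<forall>v. exact_score I R D X bh v = 0" using sch by blast
    have "norm (bh - b0) < r"
      by (rule near[THEN spec, THEN spec, THEN spec, THEN spec, THEN spec, THEN mp, OF data,
            THEN mp, OF a1, THEN mp, OF a2, THEN mp, OF a3, THEN mp, OF curv])
    then have \<rho>: "norm bh \<le> \<rho>" using norm_triangle_ineq2[of bh b0] by (simp add: \<rho>_def)
    have "K * inverse_sizes I R D \<le> K * (\<eta> * real (card I))"
      using G K by (intro mult_left_mono) auto
    also have "\<dots> \<le> K * (c * r / (2 * K) * real (card I))"
      using K n by (intro mult_left_mono mult_right_mono) (auto simp: \<eta>_def)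
    also have "\<dots> < c * r * real (card I)" using K c r n by simp
    finally show "norm (bt - bh) \<le> K / c * (inverse_sizes I R D / real (card I))"
      using curv by (intro maximizers_close[OF data B r c \<rho> sch sct _ K_def]) blast+
  qed
qed

section \<open>Predictable processes\<close>

locale filtered_space = prob_space M + filtration "space M" F
  for M :: "'a measure" and F :: "real \<Rightarrow> 'a measure" +
  assumes sets_F_le: "\<And>t. sets (F t) \<subseteq> sets M"
begin

lemma predictable_generator_subset:
  "{{s<..t} \<times> A | s t A. 0 \<le> s \<and> A \<in> sets (F s)} \<subseteq> Pow ({0<..} \<times> space M)"
  using sets.sets_into_space[of _ "F _"] by (fastforce simp: space_F)

lemma space_predictable_sigma [simp]: "space (predictable_sigma M F) = {0<..} \<times> space M"
  unfolding predictable_sigma_def by (rule space_measure_of[OF predictable_generator_subset])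

lemma predictable_rectangle:
  "0 \<le> s \<Longrightarrow> A \<in> sets (F s) \<Longrightarrow> {s<..t} \<times> A \<in> sets (predictable_sigma M F)"
  unfolding predictable_sigma_def using predictable_generator_subset
  by (auto simp: sets_measure_of intro!: sigma_sets.Basic)

lemma predictable_ray:
  assumes "0 \<le> s" "A \<in> sets (F s)"
  shows "{s<..} \<times> A \<in> sets (predictable_sigma M F)"
proof -
  have "{s<..} \<times> A = (\<Union>n::nat. {s<..real n} \<times> A)"
    using real_arch_simple by fastforce
  then show ?thesis using assms by (auto intro!: predictable_rectangle)
qed

text \<open>A rational strictly between \<open>\<tau> \<omega>\<close> and \<open>t\<close> shows
  that the set is a countable union of predictable rectangles; the part of \<open>A\<close> with
  \<open>\<tau> \<le> q\<close> is known at time \<open>q\<close>.\<close>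

lemma predictable_after_stopping_time:
  assumes \<tau>: "stopping_time F \<tau>" and pos: "\<And>\<omega>. \<omega> \<in> space M \<Longrightarrow> 0 < \<tau> \<omega>"
    and A: "A \<in> sets (pre_sigma \<tau>)"
  shows "{(t, \<omega>). \<omega> \<in> A \<and> \<tau> \<omega> < t} \<in> sets (predictable_sigma M F)"
proof -
  have sub: "A \<subseteq> space M" using sets.sets_into_space[OF A] by (simp add: space_pre_sigma)
  have "{(t, \<omega>). \<omega> \<in> A \<and> \<tau> \<omega> < t} = (\<Union>q\<in>\<rat> \<inter> {0..}. {q<..} \<times> {\<omega>\<in>A. \<tau> \<omega> \<le> q})"
  proof (intro set_eqI iffI)
    fix p assume p: "p \<in> {(t, \<omega>). \<omega> \<in> A \<and> \<tau> \<omega> < t}"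
    obtain t \<omega> where [simp]: "p = (t, \<omega>)" by (cases p)
    obtain q where "q \<in> \<rat>" "\<tau> \<omega> < q" "q < t" using p Rats_dense_in_real[of "\<tau> \<omega>" t] by auto
    moreover have "0 < \<tau> \<omega>" using p sub pos by auto
    ultimately show "p \<in> (\<Union>q\<in>\<rat> \<inter> {0..}. {q<..} \<times> {\<omega>\<in>A. \<tau> \<omega> \<le> q})"
      using p by (auto intro!: bexI[of _ q])
  qed auto
  also have "\<dots> \<in> sets (predictable_sigma M F)"
  proof (intro sets.countable_UN')
    show "countable (\<rat> \<inter> {0..} :: real set)" using countable_rat by (rule countable_subset[rotated]) auto
  qed (auto intro!: predictable_ray sets_pre_sigmaD[OF \<tau> A])
  finally show ?thesis .
qed

text \<open>Checked on generators: the point lies over \<open>A\<close> in the interval from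
  \<open>s\<close> to \<open>t\<close> iff \<open>\<omega> \<in> A\<close> and
  \<open>s < \<tau> \<omega> \<le> t\<close>. Whether this has happened by time \<open>u\<close> is
  decided in \<open>F u\<close>, trivially so for \<open>u < s\<close>.\<close>

lemma measurable_at_stopping_time:
  assumes \<tau>: "stopping_time F \<tau>" and pos: "\<And>\<omega>. \<omega> \<in> space M \<Longrightarrow> 0 < \<tau> \<omega>"
  shows "(\<lambda>\<omega>. (\<tau> \<omega>, \<omega>)) \<in> pre_sigma \<tau> \<rightarrow>\<^sub>M predictable_sigma M F"
  unfolding predictable_sigma_def
proof (rule measurable_measure_of[OF predictable_generator_subset])
  show "(\<lambda>\<omega>. (\<tau> \<omega>, \<omega>)) \<in> space (pre_sigma \<tau>) \<rightarrow> {0<..} \<times> space M"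
    using pos by (auto simp: space_pre_sigma)
next
  fix P assume "P \<in> {{s<..t} \<times> A | s t A. 0 \<le> s \<and> A \<in> sets (F s)}"
  then obtain s t A where P: "P = {s<..t} \<times> A" and A: "A \<in> sets (F s)" by auto
  have "{\<omega> \<in> (\<lambda>\<omega>. (\<tau> \<omega>, \<omega>)) -` P \<inter> space (pre_sigma \<tau>). \<tau> \<omega> \<le> u} \<in> sets (F u)" for u
  proof (cases "s \<le> u")
    case True
    have "{\<omega> \<in> (\<lambda>\<omega>. (\<tau> \<omega>, \<omega>)) -` P \<inter> space (pre_sigma \<tau>). \<tau> \<omega> \<le> u} =
        A \<inter> ({\<omega>\<in>space (F u). \<tau> \<omega> \<le> min t u} - {\<omega>\<in>space (F u). \<tau> \<omega> \<le> s})"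
      using sets.sets_into_space[OF A] by (auto simp: P space_pre_sigma space_F)
    moreover have "A \<in> sets (F u)" using A sets_F_mono[OF True] by auto
    moreover have "{\<omega>\<in>space (F u). \<tau> \<omega> \<le> min t u} \<in> sets (F u)" "{\<omega>\<in>space (F u). \<tau> \<omega> \<le> s} \<in> sets (F u)"
      using stopping_time_le_const[OF \<tau>, of "min t u" u] stopping_time_le_const[OF \<tau> True]
      by (auto simp: pred_def)
    ultimately show ?thesis by auto
  next
    case False
    then have "{\<omega> \<in> (\<lambda>\<omega>. (\<tau> \<omega>, \<omega>)) -` P \<inter> space (pre_sigma \<tau>). \<tau> \<omega> \<le> u} = {}"
      by (auto simp: P)
    then show ?thesis by (simp only: sets.empty_sets)
  qed
  then show "(\<lambda>\<omega>. (\<tau> \<omega>, \<omega>)) -` P \<inter> space (pre_sigma \<tau>) \<in> sets (pre_sigma \<tau>)"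
    by (rule sets_pre_sigmaI[OF \<tau>])
qed

lemma predictable_process_at_stopping_time:
  assumes "predictable_process M F N X" "stopping_time F \<tau>" "\<And>\<omega>. \<omega> \<in> space M \<Longrightarrow> 0 < \<tau> \<omega>"
  shows "(\<lambda>\<omega>. X (\<tau> \<omega>) \<omega>) \<in> pre_sigma \<tau> \<rightarrow>\<^sub>M N"
  using measurable_compose[OF measurable_at_stopping_time[OF assms(2,3)] assms(1)[unfolded predictable_process_def]]
  by simp

lemma sets_pre_sigma_le:
  assumes "stopping_time F \<tau>"
  shows "sets (pre_sigma \<tau>) \<subseteq> sets M"
proof
  fix A assume A: "A \<in> sets (pre_sigma \<tau>)"
  have "A = (\<Union>n::nat. {\<omega>\<in>A. \<tau> \<omega> \<le> real n})" using real_arch_simple by fastforce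
  moreover have "{\<omega>\<in>A. \<tau> \<omega> \<le> real n} \<in> sets M" for n
    using sets_pre_sigmaD[OF assms A] sets_F_le by blast
  ultimately show "A \<in> sets M" using sets.countable_UN[of "\<lambda>n. {\<omega>\<in>A. \<tau> \<omega> \<le> real n}" UNIV M] by auto
qed

lemma measurable_pre_sigma_imp:
  assumes "stopping_time F \<tau>" "f \<in> pre_sigma \<tau> \<rightarrow>\<^sub>M N"
  shows "f \<in> M \<rightarrow>\<^sub>M N"
  using assms(2) sets_pre_sigma_le[OF assms(1)] by (auto simp: measurable_def space_pre_sigma)

text \<open>What is known at \<open>\<tau>\<close> may be used at all strictly later times. This
  turns likelihood ratios of past events into predictable integrands.\<close>

lemma predictable_process_after:
  assumes \<tau>: "stopping_time F \<tau>" "\<And>\<omega>. \<omega> \<in> space M \<Longrightarrow> 0 < \<tau> \<omega>"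
    and Y: "Y \<in> pre_sigma \<tau> \<rightarrow>\<^sub>M N" and c: "c \<in> space N"
  shows "predictable_process M F N (\<lambda>t \<omega>. if \<tau> \<omega> < t then Y \<omega> else c)"
  unfolding predictable_process_def
proof (rule measurableI)
  show "(case p of (t, \<omega>) \<Rightarrow> if \<tau> \<omega> < t then Y \<omega> else c) \<in> space N" if "p \<in> space (predictable_sigma M F)" for p
    using that c measurable_space[OF Y] by (auto simp: space_pre_sigma)
next
  fix B assume B: "B \<in> sets N"
  let ?S = "\<lambda>A. {(t, \<omega>). \<omega> \<in> A \<and> \<tau> \<omega> < t}"
  have 1: "?S (Y -` B \<inter> space (pre_sigma \<tau>)) \<in> sets (predictable_sigma M F)"
    by (intro predictable_after_stopping_time \<tau> measurable_sets[OF Y B])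
  have "space M \<in> sets (pre_sigma \<tau>)"
    using sets.top[of "pre_sigma \<tau>"] unfolding space_pre_sigma .
  then have 2: "?S (space M) \<in> sets (predictable_sigma M F)"
    by (intro predictable_after_stopping_time \<tau>)
  have pos: "0 < t" if "\<tau> \<omega> < t" "\<omega> \<in> space M" for t \<omega>
    using \<tau>(2)[OF that(2)] that(1) by simp
  have "(\<lambda>(t, \<omega>). if \<tau> \<omega> < t then Y \<omega> else c) -` B \<inter> space (predictable_sigma M F) =
      ?S (Y -` B \<inter> space (pre_sigma \<tau>)) \<union>
      (if c \<in> B then space (predictable_sigma M F) - ?S (space M) else {})"
    by (auto simp: space_pre_sigma pos split: if_splits)
  also have "\<dots> \<in> sets (predictable_sigma M F)"
    using sets.Un[OF 1 sets.compl_sets[OF 2]] 1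
    by (cases "c \<in> B") (simp_all only: if_True if_False Un_empty_right)
  finally show "(\<lambda>(t, \<omega>). if \<tau> \<omega> < t then Y \<omega> else c) -` B \<inter> space (predictable_sigma M F)
      \<in> sets (predictable_sigma M F)" .
qed

text \<open>Joint measurability with the coordinates in the order of Tonelli's theorem. The
  indicator extends the process by zero, since the predictable sigma-algebra lives on positive
  times.\<close>

lemma predictable_imp_pair_measurable:
  assumes "predictable_process M F borel (X :: real \<Rightarrow> 'a \<Rightarrow> ennreal)"
  shows "(\<lambda>(\<omega>, t). X t \<omega> * indicator {0<..} t) \<in> borel_measurable (M \<Otimes>\<^sub>M lborel)"
proof -
  have "(\<lambda>(\<omega>, t). (t, \<omega>)) \<in> restrict_space (M \<Otimes>\<^sub>M lborel) (space M \<times> {0<..}) \<rightarrow>\<^sub>M predictable_sigma M F"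
    unfolding predictable_sigma_def
  proof (rule measurable_measure_of[OF predictable_generator_subset])
    show "(\<lambda>(\<omega>, t). (t, \<omega>)) \<in> space (restrict_space (M \<Otimes>\<^sub>M lborel) (space M \<times> {0<..})) \<rightarrow> {0<..} \<times> space M"
      by (auto simp: space_restrict_space space_pair_measure)
  next
    fix P assume "P \<in> {{s<..t} \<times> A | s t A. 0 \<le> s \<and> A \<in> sets (F s)}"
    then obtain s t A where P: "P = {s<..t} \<times> A" "0 \<le> s" and A: "A \<in> sets M"
      using sets_F_le by blast
    have "(\<lambda>(\<omega>, t). (t, \<omega>)) -` P \<inter> space (restrict_space (M \<Otimes>\<^sub>M lborel) (space M \<times> {0<..})) = A \<times> {s<..t}"
      using P sets.sets_into_space[OF A] by (auto simp: space_restrict_space space_pair_measure)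
    also have "\<dots> = (space M \<times> {0<..}) \<inter> (A \<times> {s<..t})"
      using P sets.sets_into_space[OF A] by auto
    also have "\<dots> \<in> sets (restrict_space (M \<Otimes>\<^sub>M lborel) (space M \<times> {0<..}))"
      unfolding sets_restrict_space using A by (intro imageI pair_measureI) auto
    finally show "(\<lambda>(\<omega>, t). (t, \<omega>)) -` P \<inter> space (restrict_space (M \<Otimes>\<^sub>M lborel) (space M \<times> {0<..}))
      \<in> sets (restrict_space (M \<Otimes>\<^sub>M lborel) (space M \<times> {0<..}))" .
  qed
  from measurable_compose[OF this assms[unfolded predictable_process_def]]
  have "(\<lambda>(\<omega>, t). X t \<omega>) \<in> borel_measurable (restrict_space (M \<Otimes>\<^sub>M lborel) (space M \<times> {0<..}))"
    by (simp add: case_prod_beta')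
  then have "(\<lambda>p. (case p of (\<omega>, t) \<Rightarrow> X t \<omega>) * indicator (space M \<times> {0<..}) p) \<in> borel_measurable (M \<Otimes>\<^sub>M lborel)"
    by (subst (asm) borel_measurable_restrict_space_iff_ennreal) (auto simp: space_pair_measure)
  then show ?thesis
    by (rule measurable_cong[THEN iffD1, rotated]) (auto simp: space_pair_measure indicator_def)
qed

lemma predictable_process_times:
  fixes X Y :: "real \<Rightarrow> 'a \<Rightarrow> ennreal"
  assumes "predictable_process M F borel X" "predictable_process M F borel Y"
  shows "predictable_process M F borel (\<lambda>t \<omega>. X t \<omega> * Y t \<omega>)"
  using borel_measurable_times_ennreal[OF assms[unfolded predictable_process_def]]
  by (simp add: predictable_process_def case_prod_beta')

lemma predictable_process_prod:
  fixes X :: "'b \<Rightarrow> real \<Rightarrow> 'a \<Rightarrow> ennreal"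
  assumes "\<And>k. k \<in> A \<Longrightarrow> predictable_process M F borel (X k)"
  shows "predictable_process M F borel (\<lambda>t \<omega>. \<Prod>k\<in>A. X k t \<omega>)"
  using assms by (induction A rule: infinite_finite_induct)
    (auto simp: predictable_process_times, auto simp: predictable_process_def case_prod_beta')

end

section \<open>Likelihood ratios of multicast interactions\<close>

locale multicast = filtered_space M F
  for M :: "'a measure" and F :: "real \<Rightarrow> 'a measure" +
  fixes \<I> :: "'i set" and \<J> :: "'j set"
    and T :: "nat \<Rightarrow> 'a \<Rightarrow> real" and S :: "nat \<Rightarrow> 'a \<Rightarrow> 'i" and D :: "nat \<Rightarrow> 'a \<Rightarrow> 'j set"
    and lbar :: "real \<Rightarrow> 'i \<Rightarrow> nat \<Rightarrow> 'a \<Rightarrow> real"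
    and R :: "real \<Rightarrow> 'i \<Rightarrow> 'a \<Rightarrow> 'j set"
    and x :: "real \<Rightarrow> 'i \<Rightarrow> 'j \<Rightarrow> 'a \<Rightarrow> real^'p"
    and \<beta>\<^sub>0 :: "real^'p"
  assumes countable_J: "countable \<J>"
    and lbar_nonneg: "\<And>i L t \<omega>. i \<in> \<I> \<Longrightarrow> 1 \<le> L \<Longrightarrow> 0 < t \<Longrightarrow> \<omega> \<in> space M \<Longrightarrow> 0 \<le> lbar t i L \<omega>"
    and R_predictable: "\<And>i. i \<in> \<I> \<Longrightarrow> predictable_process M F (count_space (Fpow \<J>)) (\<lambda>t. R t i)"
    and x_predictable: "\<And>i j. i \<in> \<I> \<Longrightarrow> j \<in> \<J> \<Longrightarrow> predictable_process M F borel (\<lambda>t. x t i j)"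
    and point_process: "multivariate_point_process M F (\<I> \<times> (Fpow \<J> - {{}})) T (\<lambda>m \<omega>. (S m \<omega>, D m \<omega>))"
    and intensity: "\<And>i J. i \<in> \<I> \<Longrightarrow> J \<in> Fpow \<J> - {{}} \<Longrightarrow>
      has_intensity M F T (\<lambda>m \<omega>. (S m \<omega>, D m \<omega>)) (i, J) (multicast_intensity lbar R x \<beta>\<^sub>0 (i, J))"
begin

abbreviation marks :: "('i \<times> 'j set) set" where "marks \<equiv> \<I> \<times> (Fpow \<J> - {{}})"

abbreviation mark :: "nat \<Rightarrow> 'a \<Rightarrow> 'i \<times> 'j set" where "mark m \<omega> \<equiv> (S m \<omega>, D m \<omega>)"

abbreviation "\<Lambda> \<equiv> multicast_intensity lbar R x \<beta>\<^sub>0"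

lemma countable_marks: "countable marks"
  and stopping_time_T: "1 \<le> m \<Longrightarrow> stopping_time F (T m)"
  and measurable_mark: "1 \<le> m \<Longrightarrow> mark m \<in> pre_sigma (T m) \<rightarrow>\<^sub>M count_space marks"
  and T_1_pos: "\<omega> \<in> space M \<Longrightarrow> 0 < T 1 \<omega>"
  and T_Suc: "\<omega> \<in> space M \<Longrightarrow> 1 \<le> m \<Longrightarrow> T m \<omega> < T (Suc m) \<omega>"
  using point_process by (auto simp: multivariate_point_process_def)

lemma mark_in: "1 \<le> m \<Longrightarrow> \<omega> \<in> space M \<Longrightarrow> mark m \<omega> \<in> marks"
  using measurable_space[OF measurable_mark, of m \<omega>] by (simp add: space_pre_sigma)

lemma T_less: "\<omega> \<in> space M \<Longrightarrow> 1 \<le> k \<Longrightarrow> k < m \<Longrightarrow> T k \<omega> < T m \<omega>"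
proof (induction m)
  case (Suc m)
  then show ?case using T_Suc[of \<omega> m] by (cases "k = m") auto
qed simp

lemma T_less_iff: "\<omega> \<in> space M \<Longrightarrow> 1 \<le> k \<Longrightarrow> 1 \<le> m \<Longrightarrow> T k \<omega> < T m \<omega> \<longleftrightarrow> k < m"
  using T_less[of \<omega> k m] T_less[of \<omega> m k] by (metis less_asym not_less_iff_gr_or_eq)

lemma T_pos: "\<omega> \<in> space M \<Longrightarrow> 1 \<le> m \<Longrightarrow> 0 < T m \<omega>"
  using T_1_pos[of \<omega>] T_less[of \<omega> 1 m] by (cases "m = 1") auto

lemma T_measurable: "1 \<le> m \<Longrightarrow> T m \<in> borel_measurable M"
  using measurable_stopping_time[OF stopping_time_T] sets_F_le space_F by auto

lemma R_Fpow: "i \<in> \<I> \<Longrightarrow> 0 < t \<Longrightarrow> \<omega> \<in> space M \<Longrightarrow> R t i \<omega> \<in> Fpow \<J>"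
  using measurable_space[OF R_predictable[unfolded predictable_process_def], of i "(t, \<omega>)"] by simp

lemma intensity_predictable:
  assumes "z \<in> marks" shows "predictable_process M F borel (\<Lambda> z)"
proof (cases z)
  case (Pair i J)
  with assms have "i \<in> \<I>" "J \<in> Fpow \<J> - {{}}" by auto
  from intensity[OF this] show ?thesis unfolding has_intensity_def Pair by (elim conjE)
qed

lemma measurable_at_event:
  assumes "1 \<le> m" "\<And>z. z \<in> marks \<Longrightarrow> predictable_process M F N (C z)"
  shows "(\<lambda>\<omega>. C (mark m \<omega>) (T m \<omega>) \<omega>) \<in> pre_sigma (T m) \<rightarrow>\<^sub>M N"
  by (rule measurable_compose_countable'[where f = "\<lambda>z \<omega>. C z (T m \<omega>) \<omega>", OF _ measurable_mark[OF assms(1)] countable_marks])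
    (intro predictable_process_at_stopping_time assms stopping_time_T T_pos)

text \<open>Extends the intensity identity from a single mark to integrands that depend on the mark,
  by summing over the countably many marks and interchanging sums and integrals of non-negative
  functions.\<close>

lemma nn_integral_events:
  fixes C :: "'i \<times> 'j set \<Rightarrow> real \<Rightarrow> 'a \<Rightarrow> ennreal"
  assumes C: "\<And>z. z \<in> marks \<Longrightarrow> predictable_process M F borel (C z)"
  shows "(\<integral>\<^sup>+\<omega>. (\<Sum>m. if 1 \<le> m then C (mark m \<omega>) (T m \<omega>) \<omega> else 0) \<partial>M) =
    (\<integral>\<^sup>+\<omega>. \<integral>\<^sup>+t. \<integral>\<^sup>+z. C z t \<omega> * ennreal (\<Lambda> z t \<omega>) *
      indicator {t. 0 < t \<and> (\<exists>m\<ge>1. t \<le> T m \<omega>)} t \<partial>count_space marks \<partial>lborel \<partial>M)"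
proof -
  define c where "c = (\<lambda>z m \<omega>. if 1 \<le> m \<and> mark m \<omega> = z then C z (T m \<omega>) \<omega> else 0)"
  have c_meas: "c z m \<in> borel_measurable M" if z: "z \<in> marks" for z m
  proof (cases "1 \<le> m")
    case True
    have 1: "(\<lambda>\<omega>. C z (T m \<omega>) \<omega>) \<in> borel_measurable (pre_sigma (T m))"
      by (intro predictable_process_at_stopping_time[OF C[OF z]] stopping_time_T True T_pos)
    have 2: "{\<omega> \<in> space (pre_sigma (T m)). 1 \<le> m \<and> mark m \<omega> = z} \<in> sets (pre_sigma (T m))"
    proof -
      have "mark m -` {z} \<inter> space (pre_sigma (T m)) \<in> sets (pre_sigma (T m))"
        by (rule measurable_sets[OF measurable_mark[OF True]]) (use z in simp)
      also have "mark m -` {z} \<inter> space (pre_sigma (T m)) =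
          {\<omega> \<in> space (pre_sigma (T m)). 1 \<le> m \<and> mark m \<omega> = z}"
        using True by fast
      finally show ?thesis .
    qed
    have "c z m \<in> borel_measurable (pre_sigma (T m))"
      unfolding c_def by (rule measurable_If[OF 1 measurable_const 2]) simp
    then show ?thesis by (rule measurable_pre_sigma_imp[OF stopping_time_T[OF True]])
  qed (simp add: c_def)
  have c_sum: "(\<integral>\<^sup>+z. c z m \<omega> \<partial>count_space marks) = (if 1 \<le> m then C (mark m \<omega>) (T m \<omega>) \<omega> else 0)"
    if \<omega>: "\<omega> \<in> space M" for m \<omega>
  proof (cases "1 \<le> m")
    case True
    have "(\<integral>\<^sup>+z. c z m \<omega> \<partial>count_space marks) = (\<Sum>z\<in>{mark m \<omega>}. c z m \<omega>)"
      using mark_in[OF True \<omega>] by (intro nn_integral_count_space') (auto simp: c_def)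
    then show ?thesis using True by (simp add: c_def)
  qed (simp add: c_def)
  define h where "h = (\<lambda>z \<omega> t. C z t \<omega> * ennreal (\<Lambda> z t \<omega>) * indicator {t. 0 < t \<and> (\<exists>m\<ge>1. t \<le> T m \<omega>)} t)"
  have h_meas: "(\<lambda>(\<omega>, t). h z \<omega> t) \<in> borel_measurable (M \<Otimes>\<^sub>M lborel)" if z: "z \<in> marks" for z
  proof -
    have "predictable_process M F borel (\<lambda>t \<omega>. C z t \<omega> * ennreal (\<Lambda> z t \<omega>))"
      using intensity_predictable[OF z]
      by (intro predictable_process_times C z) (simp add: predictable_process_def case_prod_beta')
    from predictable_imp_pair_measurable[OF this]
    have [measurable]: "(\<lambda>(\<omega>, t). C z t \<omega> * ennreal (\<Lambda> z t \<omega>) * indicator {0<..} t) \<in> borel_measurable (M \<Otimes>\<^sub>M lborel)" .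
    have [measurable]: "(\<lambda>p. T (Suc m) (fst p)) \<in> borel_measurable (M \<Otimes>\<^sub>M lborel)" for m
      using measurable_compose[OF measurable_fst T_measurable[of "Suc m"]] by simp
    have "Measurable.pred (M \<Otimes>\<^sub>M lborel) (\<lambda>p. \<exists>m. snd p \<le> T (Suc m) (fst p))" by measurable
    then have [measurable]: "{p \<in> space (M \<Otimes>\<^sub>M lborel). \<exists>m. snd p \<le> T (Suc m) (fst p)} \<in> sets (M \<Otimes>\<^sub>M lborel)"
      by (simp add: pred_def)
    have "(\<lambda>p. if \<exists>m. snd p \<le> T (Suc m) (fst p) then
        (case p of (\<omega>, t) \<Rightarrow> C z t \<omega> * ennreal (\<Lambda> z t \<omega>) * indicator {0<..} t) else 0) \<in>
        borel_measurable (M \<Otimes>\<^sub>M lborel)"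
      by measurable
    also have "(\<lambda>p. if \<exists>m. snd p \<le> T (Suc m) (fst p) then
        (case p of (\<omega>, t) \<Rightarrow> C z t \<omega> * ennreal (\<Lambda> z t \<omega>) * indicator {0<..} t) else 0) = (\<lambda>(\<omega>, t). h z \<omega> t)"
    proof (rule ext, clarify)
      fix \<omega> t
      have "(\<exists>m\<ge>1. t \<le> T m \<omega>) \<longleftrightarrow> (\<exists>m. t \<le> T (Suc m) \<omega>)"
        by (metis One_nat_def Suc_le_D Suc_le_mono zero_le)
      then show "(if \<exists>m. snd (\<omega>, t) \<le> T (Suc m) (fst (\<omega>, t)) then
          C z t \<omega> * ennreal (\<Lambda> z t \<omega>) * indicator {0<..} t else 0) = h z \<omega> t"
        by (simp add: h_def indicator_def)
    qed
    finally show ?thesis .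
  qed
  have "(\<integral>\<^sup>+\<omega>. (\<Sum>m. if 1 \<le> m then C (mark m \<omega>) (T m \<omega>) \<omega> else 0) \<partial>M) =
      (\<integral>\<^sup>+\<omega>. (\<Sum>m. \<integral>\<^sup>+z. c z m \<omega> \<partial>count_space marks) \<partial>M)"
    by (intro nn_integral_cong) (simp only: c_sum)
  also have "\<dots> = (\<integral>\<^sup>+\<omega>. \<integral>\<^sup>+z. (\<Sum>m. c z m \<omega>) \<partial>count_space marks \<partial>M)"
    by (intro nn_integral_cong nn_integral_suminf[symmetric]) simp
  also have "\<dots> = (\<integral>\<^sup>+z. \<integral>\<^sup>+\<omega>. (\<Sum>m. c z m \<omega>) \<partial>M \<partial>count_space marks)"
    by (intro nn_integral_count_space_nn_integral countable_marks borel_measurable_suminf_order c_meas)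
  also have "\<dots> = (\<integral>\<^sup>+z. \<integral>\<^sup>+\<omega>. \<integral>\<^sup>+t. h z \<omega> t \<partial>lborel \<partial>M \<partial>count_space marks)"
  proof (rule nn_integral_cong)
    fix z assume "z \<in> space (count_space marks)"
    then have z: "z \<in> marks" by simp
    obtain i J where iJ: "z = (i, J)" by (cases z)
    then have "i \<in> \<I>" "J \<in> Fpow \<J> - {{}}" using z by auto
    from intensity[OF this] have "\<forall>C. predictable_process M F borel C \<longrightarrow>
      (\<integral>\<^sup>+\<omega>. (\<Sum>m. if 1 \<le> m \<and> mark m \<omega> = z then C (T m \<omega>) \<omega> else 0) \<partial>M) =
      (\<integral>\<^sup>+\<omega>. (\<integral>\<^sup>+t. C t \<omega> * ennreal (\<Lambda> z t \<omega>) *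
        indicator {t. 0 < t \<and> (\<exists>m\<ge>1. t \<le> T m \<omega>)} t \<partial>lborel) \<partial>M)"
      unfolding has_intensity_def iJ by (elim conjE)
    from this[THEN spec, THEN mp, OF C[OF z]] show "(\<integral>\<^sup>+\<omega>. (\<Sum>m. c z m \<omega>) \<partial>M) = (\<integral>\<^sup>+\<omega>. \<integral>\<^sup>+t. h z \<omega> t \<partial>lborel \<partial>M)"
      unfolding c_def h_def .
  qed
  also have "\<dots> = (\<integral>\<^sup>+\<omega>. \<integral>\<^sup>+z. \<integral>\<^sup>+t. h z \<omega> t \<partial>lborel \<partial>count_space marks \<partial>M)"
    by (intro nn_integral_count_space_nn_integral[symmetric] countable_marks
        lborel.borel_measurable_nn_integral h_meas)
  also have "\<dots> = (\<integral>\<^sup>+\<omega>. \<integral>\<^sup>+t. \<integral>\<^sup>+z. h z \<omega> t \<partial>count_space marks \<partial>lborel \<partial>M)"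
  proof (intro nn_integral_cong nn_integral_count_space_nn_integral[symmetric] countable_marks)
    fix \<omega> z assume "\<omega> \<in> space M" "z \<in> marks"
    then show "h z \<omega> \<in> borel_measurable lborel"
      using measurable_Pair2[OF h_meas] by simp
  qed
  finally show ?thesis by (simp only: h_def)
qed

lemma AE_receivers_available: "AE \<omega> in M. \<forall>m\<ge>1. D m \<omega> \<subseteq> R (T m \<omega>) (S m \<omega>) \<omega>"
proof -
  define C :: "'i \<times> 'j set \<Rightarrow> real \<Rightarrow> 'a \<Rightarrow> ennreal"
    where "C = (\<lambda>z t \<omega>. of_bool (\<not> snd z \<subseteq> R t (fst z) \<omega>))"
  have C: "predictable_process M F borel (C z)" if "z \<in> marks" for z
  proof -
    have i: "fst z \<in> \<I>" using that by auto
    have "(\<lambda>p. of_bool (\<not> snd z \<subseteq> (case p of (t, \<omega>) \<Rightarrow> R t (fst z) \<omega>)) :: ennreal)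
        \<in> borel_measurable (predictable_sigma M F)"
      by (rule measurable_compose_countable'[where f = "\<lambda>A _. of_bool (\<not> snd z \<subseteq> A) :: ennreal",
            OF _ R_predictable[OF i, unfolded predictable_process_def] countable_Fpow[OF countable_J]]) simp
    then show ?thesis by (simp add: predictable_process_def C_def case_prod_beta')
  qed
  have zero: "C z t \<omega> * ennreal (\<Lambda> z t \<omega>) = 0" if "z \<in> marks" for z t \<omega>
  proof (cases "snd z \<subseteq> R t (fst z) \<omega>")
    case False
    have fin: "finite (snd z)" using that by (auto simp: Fpow_def)
    have "(\<Prod>j\<in>snd z. of_bool (j \<in> R t (fst z) \<omega>) :: real) = 0"
      using False fin by (auto simp: prod_zero_iff)
    then show ?thesis by (simp add: multicast_intensity_def case_prod_beta')
  qed (simp add: C_def)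
  have meas: "(\<lambda>\<omega>. if 1 \<le> m then C (mark m \<omega>) (T m \<omega>) \<omega> else 0) \<in> borel_measurable M" for m
  proof (cases "1 \<le> m")
    case True
    show ?thesis
      using measurable_pre_sigma_imp[OF stopping_time_T[OF True] measurable_at_event[OF True C]] True by simp
  qed simp
  have "(\<integral>\<^sup>+\<omega>. (\<Sum>m. if 1 \<le> m then C (mark m \<omega>) (T m \<omega>) \<omega> else 0) \<partial>M) =
      (\<integral>\<^sup>+\<omega>. \<integral>\<^sup>+t. \<integral>\<^sup>+z. C z t \<omega> * ennreal (\<Lambda> z t \<omega>) *
        indicator {t. 0 < t \<and> (\<exists>m\<ge>1. t \<le> T m \<omega>)} t \<partial>count_space marks \<partial>lborel \<partial>M)"
    by (rule nn_integral_events) (rule C)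
  also have "(\<integral>\<^sup>+\<omega>. \<integral>\<^sup>+t. \<integral>\<^sup>+z. C z t \<omega> * ennreal (\<Lambda> z t \<omega>) *
      indicator {t. 0 < t \<and> (\<exists>m\<ge>1. t \<le> T m \<omega>)} t \<partial>count_space marks \<partial>lborel \<partial>M) =
      (\<integral>\<^sup>+\<omega>. \<integral>\<^sup>+(t::real). \<integral>\<^sup>+z. 0 \<partial>count_space marks \<partial>lborel \<partial>M)"
    by (intro nn_integral_cong) (simp only: zero space_count_space mult_zero_left)
  finally have int0: "(\<integral>\<^sup>+\<omega>. (\<Sum>m. if 1 \<le> m then C (mark m \<omega>) (T m \<omega>) \<omega> else 0) \<partial>M) = 0"
    by (simp only: nn_integral_const mult_zero_left)
  have "AE \<omega> in M. (\<Sum>m. if 1 \<le> m then C (mark m \<omega>) (T m \<omega>) \<omega> else 0) = 0"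
    by (rule nn_integral_0_iff_AE[THEN iffD1, OF _ int0]) (intro borel_measurable_suminf_order meas)
  then show ?thesis
  proof eventually_elim
    case (elim \<omega>)
    show ?case
    proof (intro allI impI)
      fix m :: nat assume m: "1 \<le> m"
      have "(if 1 \<le> m then C (mark m \<omega>) (T m \<omega>) \<omega> else 0) = 0"
        using elim by (subst (asm) suminf_eq_zero_iff) auto
      then show "D m \<omega> \<subseteq> R (T m \<omega>) (S m \<omega>) \<omega>" using m by (auto simp: C_def)
    qed
  qed
qed

end

text \<open>Summation by groups, each with finitely many relevant members. Comparing group by group
  remains valid when the total intensity over all marks is infinite.\<close>

lemma nn_integral_count_space_eq_by_groups:
  fixes f g :: "'b \<Rightarrow> ennreal" and key :: "'b \<Rightarrow> 'k"
  assumes A: "countable A"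
    and group: "\<And>k. k \<in> key ` A \<Longrightarrow> \<exists>B. finite B \<and> B \<subseteq> {z\<in>A. key z = k} \<and>
      (\<forall>z\<in>{z\<in>A. key z = k} - B. f z = 0 \<and> g z = 0) \<and> sum f B = sum g B"
  shows "(\<integral>\<^sup>+z. f z \<partial>count_space A) = (\<integral>\<^sup>+z. g z \<partial>count_space A)"
proof -
  define K where "K = key ` A"
  have K: "countable K" using A by (simp add: K_def)
  have split: "(\<integral>\<^sup>+z. h z \<partial>count_space A) =
      (\<integral>\<^sup>+k. \<integral>\<^sup>+z. h z * of_bool (key z = k) \<partial>count_space A \<partial>count_space K)" for h :: "'b \<Rightarrow> ennreal"
  proof -
    have "h z = (\<integral>\<^sup>+k. h z * of_bool (key z = k) \<partial>count_space K)" if "z \<in> A" for z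
    proof -
      have "(\<integral>\<^sup>+k. h z * of_bool (key z = k) \<partial>count_space K) = (\<Sum>k\<in>{key z}. h z * of_bool (key z = k))"
        using that by (intro nn_integral_count_space') (auto simp: K_def)
      then show ?thesis by simp
    qed
    then have "(\<integral>\<^sup>+z. h z \<partial>count_space A) =
        (\<integral>\<^sup>+z. \<integral>\<^sup>+k. h z * of_bool (key z = k) \<partial>count_space K \<partial>count_space A)"
      by (intro nn_integral_cong) simp
    also have "\<dots> = (\<integral>\<^sup>+k. \<integral>\<^sup>+z. h z * of_bool (key z = k) \<partial>count_space A \<partial>count_space K)"
      by (intro nn_integral_count_space_nn_integral K) simp
    finally show ?thesis .
  qed
  have "(\<integral>\<^sup>+z. f z * of_bool (key z = k) \<partial>count_space A) = (\<integral>\<^sup>+z. g z * of_bool (key z = k) \<partial>count_space A)"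
    if k: "k \<in> K" for k
  proof -
    from group[OF k[unfolded K_def]] obtain B where B: "finite B" "B \<subseteq> {z\<in>A. key z = k}"
      "\<forall>z\<in>{z\<in>A. key z = k} - B. f z = 0 \<and> g z = 0" "sum f B = sum g B"
      by (elim exE conjE)
    have one: "(\<integral>\<^sup>+z. h z * of_bool (key z = k) \<partial>count_space A) = sum h B"
      if h: "\<forall>z\<in>{z\<in>A. key z = k} - B. h z = 0" for h :: "'b \<Rightarrow> ennreal"
    proof -
      have "(\<integral>\<^sup>+z. h z * of_bool (key z = k) \<partial>count_space A) = (\<Sum>z\<in>B. h z * of_bool (key z = k))"
      proof (rule nn_integral_count_space'[OF B(1)])
        show "h z * of_bool (key z = k) = 0" if "z \<in> A" "z \<notin> B" for z
          using h that by (cases "key z = k") auto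
      qed (use B(2) in blast)
      also have "\<dots> = sum h B" using B(2) by (intro sum.cong) auto
      finally show ?thesis .
    qed
    have "(\<integral>\<^sup>+z. f z * of_bool (key z = k) \<partial>count_space A) = sum f B" using B(3) by (intro one) blast
    moreover have "(\<integral>\<^sup>+z. g z * of_bool (key z = k) \<partial>count_space A) = sum g B" using B(3) by (intro one) blast
    ultimately show ?thesis using B(4) by simp
  qed
  then show ?thesis
    unfolding split[of f] split[of g] by (rule nn_integral_cong) (simp only: space_count_space)
qed

section \<open>Likelihood ratios of single events and their products\<close>

context multicast
begin

definition mark_prob :: "real^'p \<Rightarrow> 'i \<times> 'j set \<Rightarrow> real \<Rightarrow> 'a \<Rightarrow> real" where
  "mark_prob b z t \<omega> = exp (b \<bullet> (\<Sum>j\<in>snd z. x t (fst z) j \<omega>)) /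
    (\<Sum>J\<in>ksubsets (R t (fst z) \<omega>) (card (snd z)). exp (b \<bullet> (\<Sum>j\<in>J. x t (fst z) j \<omega>)))"

definition ratio :: "real^'p \<Rightarrow> 'i \<times> 'j set \<Rightarrow> real \<Rightarrow> 'a \<Rightarrow> ennreal" where
  "ratio b z t \<omega> = ennreal (mark_prob b z t \<omega> / mark_prob \<beta>\<^sub>0 z t \<omega>)"

lemma mark_prob_nonneg: "0 \<le> mark_prob b z t \<omega>"
  unfolding mark_prob_def by (intro divide_nonneg_nonneg sum_nonneg) simp_all

text \<open>The range of summation is itself random, but it is determined by a predictable set with
  only countably many possible values.\<close>

lemma mark_prob_measurable:
  assumes z: "z \<in> marks"
  shows "(\<lambda>p. mark_prob b z (fst p) (snd p)) \<in> borel_measurable (predictable_sigma M F)"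
proof -
  define P where "P = predictable_sigma M F"
  define i where "i = fst z"
  have i: "i \<in> \<I>" and J: "snd z \<subseteq> \<J>" "finite (snd z)" using z by (auto simp: i_def Fpow_def)
  have xm: "(\<lambda>p. x (fst p) i j (snd p)) \<in> borel_measurable P" if "j \<in> \<J>" for j
    using x_predictable[OF i that] by (simp add: predictable_process_def P_def case_prod_beta')
  have e: "(\<lambda>p. exp (b \<bullet> (\<Sum>j\<in>J. x (fst p) i j (snd p)))) \<in> borel_measurable P" if "J \<subseteq> \<J>" for J
    using that xm by (intro borel_measurable_exp[THEN measurable_compose[rotated]] borel_measurable_inner
        borel_measurable_const borel_measurable_sum) auto
  have Rm: "(\<lambda>p. R (fst p) i (snd p)) \<in> P \<rightarrow>\<^sub>M count_space (Fpow \<J>)"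
    using R_predictable[OF i] by (simp add: predictable_process_def P_def case_prod_beta')
  have "(\<lambda>p. \<Sum>J\<in>ksubsets (R (fst p) i (snd p)) (card (snd z)).
      exp (b \<bullet> (\<Sum>j\<in>J. x (fst p) i j (snd p)))) \<in> borel_measurable P"
  proof (rule measurable_compose_countable'[where f = "\<lambda>A p. \<Sum>J\<in>ksubsets A (card (snd z)).
      exp (b \<bullet> (\<Sum>j\<in>J. x (fst p) i j (snd p)))", OF _ Rm countable_Fpow[OF countable_J]])
    fix A assume "A \<in> Fpow \<J>"
    then have "J \<subseteq> \<J>" if "J \<in> ksubsets A (card (snd z))" for J using that by (auto simp: Fpow_def)
    then show "(\<lambda>p. \<Sum>J\<in>ksubsets A (card (snd z)).
        exp (b \<bullet> (\<Sum>j\<in>J. x (fst p) i j (snd p)))) \<in> borel_measurable P"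
      by (intro borel_measurable_sum e)
  qed
  then show ?thesis
    unfolding mark_prob_def P_def[symmetric] i_def[symmetric] by (intro borel_measurable_divide e J)
qed

lemma ratio_predictable: "z \<in> marks \<Longrightarrow> predictable_process M F borel (ratio b z)"
  unfolding predictable_process_def ratio_def case_prod_beta'
  by (rule measurable_compose[OF _ measurable_ennreal]) (intro borel_measurable_divide mark_prob_measurable)

text \<open>For a fixed sender and size, the intensity is a total times the probability of the set
  under \<open>\<beta>\<^sub>0\<close>. The ratio replaces this by the probability under
  \<open>b\<close>, and both add up to one.\<close>

lemma nn_integral_ratio_intensity:
  assumes t: "0 < t" and \<omega>: "\<omega> \<in> space M"
  shows "(\<integral>\<^sup>+z. ratio b z t \<omega> * ennreal (\<Lambda> z t \<omega>) \<partial>count_space marks) =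
    (\<integral>\<^sup>+z. ennreal (\<Lambda> z t \<omega>) \<partial>count_space marks)"
proof (rule nn_integral_count_space_eq_by_groups[where key = "\<lambda>z. (fst z, card (snd z))", OF countable_marks])
  fix k assume "k \<in> (\<lambda>z. (fst z, card (snd z))) ` marks"
  then obtain z0 where z0: "k = (fst z0, card (snd z0))" "z0 \<in> marks" by (elim imageE)
  define i J0 where "i = fst z0" and "J0 = snd z0"
  have k: "k = (i, card J0)" and i: "i \<in> \<I>" and J0: "J0 \<in> Fpow \<J> - {{}}"
    using z0 mem_Times_iff[of z0] by (simp_all add: i_def J0_def)
  define L where "L = card J0"
  have L: "1 \<le> L" using J0 by (auto simp: L_def Fpow_def Suc_le_eq card_gt_0_iff)
  define A where "A = R t i \<omega>"
  have A: "finite A" "A \<subseteq> \<J>" using R_Fpow[OF i t \<omega>] by (auto simp: A_def Fpow_def)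
  define e where "e = (\<lambda>b J. exp (b \<bullet> (\<Sum>j\<in>J. x t i j \<omega>)))"
  define l where "l = lbar t i L \<omega>"
  have l: "0 \<le> l" unfolding l_def by (rule lbar_nonneg[OF i L t \<omega>])
  have fin: "finite J" if "J \<subseteq> A" for J using that A finite_subset by blast
  have \<Lambda>_in: "\<Lambda> (i, J) t \<omega> = l * e \<beta>\<^sub>0 J" if "J \<in> ksubsets A L" for J
    using that by (auto simp: multicast_intensity_def l_def e_def A_def inner_sum_right intro!: prod.neutral)
  have \<Lambda>_out: "\<Lambda> (i, J) t \<omega> = 0" if "finite J" "\<not> J \<subseteq> A" for J
    using that by (auto simp: multicast_intensity_def A_def prod_zero_iff)
  let ?B = "Pair i ` ksubsets A L"
  have finB: "finite (ksubsets A L)" using A by simp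
  have sums: "sum h ?B = (\<Sum>J\<in>ksubsets A L. h (i, J))" for h :: "'i \<times> 'j set \<Rightarrow> ennreal"
    by (subst sum.reindex) (auto simp: inj_on_def)
  have "(\<Sum>J\<in>ksubsets A L. ratio b (i, J) t \<omega> * ennreal (\<Lambda> (i, J) t \<omega>)) =
      (\<Sum>J\<in>ksubsets A L. ennreal (\<Lambda> (i, J) t \<omega>))"
  proof (cases "ksubsets A L = {}")
    case True
    then show ?thesis by (simp only: sum.empty)
  next
    case False
    define Z where "Z = (\<lambda>b. sum (e b) (ksubsets A L))"
    have Z: "0 < Z b" for b unfolding Z_def e_def using finB False by (intro sum_pos) auto
    have r: "ratio b (i, J) t \<omega> * ennreal (\<Lambda> (i, J) t \<omega>) = ennreal (l * Z \<beta>\<^sub>0 / Z b * e b J)"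
      if J: "J \<in> ksubsets A L" for J
    proof -
      have m: "mark_prob b' (i, J) t \<omega> = e b' J / Z b'" for b'
        using J by (simp add: mark_prob_def e_def Z_def A_def)
      have e0: "0 < e b' J" for b' by (simp add: e_def)
      have "ratio b (i, J) t \<omega> * ennreal (\<Lambda> (i, J) t \<omega>) =
          ennreal ((e b J / Z b) / (e \<beta>\<^sub>0 J / Z \<beta>\<^sub>0) * (l * e \<beta>\<^sub>0 J))"
        unfolding ratio_def m \<Lambda>_in[OF J] using l e0 Z
        by (intro ennreal_mult[symmetric]) (auto intro!: mult_nonneg_nonneg divide_nonneg_nonneg intro: less_imp_le)
      also have "(e b J / Z b) / (e \<beta>\<^sub>0 J / Z \<beta>\<^sub>0) * (l * e \<beta>\<^sub>0 J) = l * Z \<beta>\<^sub>0 / Z b * e b J"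
        using e0[of \<beta>\<^sub>0] Z[of \<beta>\<^sub>0] Z[of b] by (simp add: field_simps)
      finally show ?thesis .
    qed
    have nn: "0 \<le> l * Z \<beta>\<^sub>0 / Z b * e b J" for J
      using l Z by (auto simp: e_def intro!: mult_nonneg_nonneg divide_nonneg_nonneg intro: less_imp_le)
    have "(\<Sum>J\<in>ksubsets A L. ratio b (i, J) t \<omega> * ennreal (\<Lambda> (i, J) t \<omega>)) =
        (\<Sum>J\<in>ksubsets A L. ennreal (l * Z \<beta>\<^sub>0 / Z b * e b J))"
      by (rule sum.cong[OF refl r])
    also have "\<dots> = ennreal (\<Sum>J\<in>ksubsets A L. l * Z \<beta>\<^sub>0 / Z b * e b J)"
      by (rule sum_ennreal) (rule nn)
    also have "(\<Sum>J\<in>ksubsets A L. l * Z \<beta>\<^sub>0 / Z b * e b J) = l * Z \<beta>\<^sub>0 / Z b * Z b"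
      by (simp only: Z_def sum_distrib_left[symmetric])
    also have "\<dots> = l * Z \<beta>\<^sub>0" using Z[of b] by simp
    also have "\<dots> = (\<Sum>J\<in>ksubsets A L. l * e \<beta>\<^sub>0 J)" by (simp only: Z_def sum_distrib_left[symmetric])
    also have "ennreal \<dots> = (\<Sum>J\<in>ksubsets A L. ennreal (l * e \<beta>\<^sub>0 J))"
      using l by (intro sum_ennreal[symmetric]) (auto simp: e_def)
    also have "\<dots> = (\<Sum>J\<in>ksubsets A L. ennreal (\<Lambda> (i, J) t \<omega>))"
      by (rule sum.cong[OF refl]) (simp only: \<Lambda>_in)
    finally show ?thesis .
  qed
  moreover have "?B \<subseteq> {z \<in> marks. (fst z, card (snd z)) = k}"
  proof
    fix z assume "z \<in> ?B"
    then obtain J where J: "z = (i, J)" "J \<subseteq> A" "card J = L" by blast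
    then have "J \<noteq> {}" using L by auto
    with J i A(2) fin[OF J(2)] show "z \<in> {z \<in> marks. (fst z, card (snd z)) = k}"
      by (simp add: k L_def Fpow_def)
  qed
  moreover have "ennreal (\<Lambda> z t \<omega>) = 0" if z: "z \<in> {z \<in> marks. (fst z, card (snd z)) = k} - ?B" for z
  proof -
    have zi: "z = (i, snd z)" "card (snd z) = L" "finite (snd z)" "z \<notin> ?B"
      using z by (auto simp: k L_def Fpow_def prod_eq_iff)
    have "\<not> snd z \<subseteq> A" using zi by (metis (mono_tags, lifting) image_eqI mem_Collect_eq)
    then have "\<Lambda> (i, snd z) t \<omega> = 0" by (rule \<Lambda>_out[OF zi(3)])
    then show ?thesis using zi(1) by simp
  qed
  ultimately show "\<exists>B. finite B \<and> B \<subseteq> {z \<in> marks. (fst z, card (snd z)) = k} \<and>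
      (\<forall>z\<in>{z \<in> marks. (fst z, card (snd z)) = k} - B.
        ratio b z t \<omega> * ennreal (\<Lambda> z t \<omega>) = 0 \<and> ennreal (\<Lambda> z t \<omega>) = 0) \<and>
      (\<Sum>z\<in>B. ratio b z t \<omega> * ennreal (\<Lambda> z t \<omega>)) = (\<Sum>z\<in>B. ennreal (\<Lambda> z t \<omega>))"
    using finB by (intro exI[of _ ?B]) (simp add: sums)
qed

text \<open>The martingale property in integrated form: given the past, encoded by the predictable
  \<open>U\<close>, the ratio of the next event has mean one.\<close>

lemma nn_integral_events_ratio:
  assumes U: "predictable_process M F borel (U :: real \<Rightarrow> 'a \<Rightarrow> ennreal)"
  shows "(\<integral>\<^sup>+\<omega>. (\<Sum>m. if 1 \<le> m then U (T m \<omega>) \<omega> * ratio b (mark m \<omega>) (T m \<omega>) \<omega> else 0) \<partial>M) =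
    (\<integral>\<^sup>+\<omega>. (\<Sum>m. if 1 \<le> m then U (T m \<omega>) \<omega> else 0) \<partial>M)"
proof -
  define ind :: "'a \<Rightarrow> real \<Rightarrow> ennreal"
    where "ind = (\<lambda>\<omega>. indicator {t. 0 < t \<and> (\<exists>m\<ge>1. t \<le> T m \<omega>)})"
  have 1: "(\<integral>\<^sup>+\<omega>. (\<Sum>m. if 1 \<le> m then U (T m \<omega>) \<omega> * ratio b (mark m \<omega>) (T m \<omega>) \<omega> else 0) \<partial>M) =
      (\<integral>\<^sup>+\<omega>. \<integral>\<^sup>+t. \<integral>\<^sup>+z. U t \<omega> * ratio b z t \<omega> * ennreal (\<Lambda> z t \<omega>) * ind \<omega> t
        \<partial>count_space marks \<partial>lborel \<partial>M)"
    unfolding ind_def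
    by (rule nn_integral_events[where C = "\<lambda>z t \<omega>. U t \<omega> * ratio b z t \<omega>"])
      (intro predictable_process_times U ratio_predictable)
  have 2: "(\<integral>\<^sup>+\<omega>. (\<Sum>m. if 1 \<le> m then U (T m \<omega>) \<omega> else 0) \<partial>M) =
      (\<integral>\<^sup>+\<omega>. \<integral>\<^sup>+t. \<integral>\<^sup>+z. U t \<omega> * ennreal (\<Lambda> z t \<omega>) * ind \<omega> t \<partial>count_space marks \<partial>lborel \<partial>M)"
    unfolding ind_def by (rule nn_integral_events[where C = "\<lambda>z. U"]) (rule U)
  have "(\<integral>\<^sup>+z. U t \<omega> * ratio b z t \<omega> * ennreal (\<Lambda> z t \<omega>) * ind \<omega> t \<partial>count_space marks) =
      (\<integral>\<^sup>+z. U t \<omega> * ennreal (\<Lambda> z t \<omega>) * ind \<omega> t \<partial>count_space marks)" if \<omega>: "\<omega> \<in> space M" for \<omega> t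
  proof (cases "0 < t")
    case True
    have "(\<integral>\<^sup>+z. U t \<omega> * ratio b z t \<omega> * ennreal (\<Lambda> z t \<omega>) * ind \<omega> t \<partial>count_space marks) =
        (\<integral>\<^sup>+z. U t \<omega> * ind \<omega> t * (ratio b z t \<omega> * ennreal (\<Lambda> z t \<omega>)) \<partial>count_space marks)"
      by (intro nn_integral_cong) (simp only: mult_ac)
    also have "\<dots> = U t \<omega> * ind \<omega> t * (\<integral>\<^sup>+z. ratio b z t \<omega> * ennreal (\<Lambda> z t \<omega>) \<partial>count_space marks)"
      by (rule nn_integral_cmult) simp
    also have "\<dots> = U t \<omega> * ind \<omega> t * (\<integral>\<^sup>+z. ennreal (\<Lambda> z t \<omega>) \<partial>count_space marks)"
      by (simp only: nn_integral_ratio_intensity[OF True \<omega>])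
    also have "\<dots> = (\<integral>\<^sup>+z. U t \<omega> * ind \<omega> t * ennreal (\<Lambda> z t \<omega>) \<partial>count_space marks)"
      by (rule nn_integral_cmult[symmetric]) simp
    also have "\<dots> = (\<integral>\<^sup>+z. U t \<omega> * ennreal (\<Lambda> z t \<omega>) * ind \<omega> t \<partial>count_space marks)"
      by (intro nn_integral_cong) (simp only: mult_ac)
    finally show ?thesis .
  next
    case False
    then have "ind \<omega> t = 0" by (simp add: ind_def)
    then show ?thesis by (simp only: mult_zero_right)
  qed
  then have "(\<integral>\<^sup>+t. \<integral>\<^sup>+z. U t \<omega> * ratio b z t \<omega> * ennreal (\<Lambda> z t \<omega>) * ind \<omega> t \<partial>count_space marks \<partial>lborel) =
      (\<integral>\<^sup>+t. \<integral>\<^sup>+z. U t \<omega> * ennreal (\<Lambda> z t \<omega>) * ind \<omega> t \<partial>count_space marks \<partial>lborel)"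
    if "\<omega> \<in> space M" for \<omega>
    using that by (simp only:)
  then show ?thesis unfolding 1 2 by (rule nn_integral_cong)
qed

definition lik_ratio :: "real^'p \<Rightarrow> nat \<Rightarrow> 'a \<Rightarrow> ennreal" where
  "lik_ratio b n \<omega> = (\<Prod>k\<in>{1..n}. ratio b (mark k \<omega>) (T k \<omega>) \<omega>)"

lemma ratio_at_event_measurable:
  assumes "1 \<le> k"
  shows "(\<lambda>\<omega>. ratio b (mark k \<omega>) (T k \<omega>) \<omega>) \<in> borel_measurable (pre_sigma (T k))"
  by (rule measurable_at_event[OF assms ratio_predictable])

lemma lik_ratio_measurable: "lik_ratio b n \<in> borel_measurable M"
  unfolding lik_ratio_def[abs_def]
proof (rule borel_measurable_prod_ennreal)
  fix k assume "k \<in> {1..n}"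
  then have k: "1 \<le> k" by simp
  show "(\<lambda>\<omega>. ratio b (mark k \<omega>) (T k \<omega>) \<omega>) \<in> borel_measurable M"
    by (rule measurable_pre_sigma_imp[OF stopping_time_T[OF k] ratio_at_event_measurable[OF k]])
qed

text \<open>Induction with \<open>nn_integral_events_ratio\<close>, applied to a process
  \<open>U\<close> for which only the event \<open>Suc n\<close> contributes to the sum over all
  events.\<close>

lemma nn_integral_lik_ratio: "(\<integral>\<^sup>+\<omega>. lik_ratio b n \<omega> \<partial>M) = 1"
proof (induction n)
  case 0
  then show ?case by (simp add: lik_ratio_def emeasure_space_1)
next
  case (Suc n)
  \<comment> \<open>a predictable process that equals \<open>lik_ratio b n\<close> on the interval from \<open>T n\<close> to \<open>T (Suc n)\<close> and vanishes elsewhere\<close>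
  define U :: "real \<Rightarrow> 'a \<Rightarrow> ennreal" where "U = (\<lambda>t \<omega>.
    (\<Prod>k\<in>{1..n}. if T k \<omega> < t then ratio b (mark k \<omega>) (T k \<omega>) \<omega> else 0) * (if T (Suc n) \<omega> < t then 0 else 1))"
  have U: "predictable_process M F borel U"
    unfolding U_def
  proof (intro predictable_process_times predictable_process_prod)
    fix k assume "k \<in> {1..n}"
    then have k: "1 \<le> k" by simp
    show "predictable_process M F borel (\<lambda>t \<omega>. if T k \<omega> < t then ratio b (mark k \<omega>) (T k \<omega>) \<omega> else 0)"
      by (rule predictable_process_after[OF stopping_time_T[OF k] T_pos[OF _ k] ratio_at_event_measurable[OF k]])
        simp_all
  next
    have k: "1 \<le> Suc n" by simp
    show "predictable_process M F borel (\<lambda>t \<omega>. if T (Suc n) \<omega> < t then 0 else (1::ennreal))"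
      by (rule predictable_process_after[OF stopping_time_T[OF k] T_pos[OF _ k]]) simp_all
  qed
  have U_at: "U (T m \<omega>) \<omega> = (if m = Suc n then lik_ratio b n \<omega> else 0)" if \<omega>: "\<omega> \<in> space M" and m: "1 \<le> m" for \<omega> m
  proof -
    have less: "T k \<omega> < T m \<omega> \<longleftrightarrow> k < m" if "1 \<le> k" for k by (rule T_less_iff[OF \<omega> that m])
    consider "m \<le> n" | "m = Suc n" | "Suc n < m" by linarith
    then show ?thesis
    proof cases
      case 1
      \<comment> \<open>The factor with \<open>k = m\<close> is zero, since
        \<open>T m \<omega> < T m \<omega>\<close> fails.\<close>
      then have "(\<Prod>k\<in>{1..n}. if T k \<omega> < T m \<omega> then ratio b (mark k \<omega>) (T k \<omega>) \<omega> else 0) = 0"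
        using m by (intro prod_zero bexI[of _ m]) auto
      then show ?thesis using 1 by (simp add: U_def)
    next
      case 2
      have "(\<Prod>k\<in>{1..n}. if T k \<omega> < T m \<omega> then ratio b (mark k \<omega>) (T k \<omega>) \<omega> else 0) = lik_ratio b n \<omega>"
        unfolding lik_ratio_def
      proof (rule prod.cong[OF refl])
        fix k assume "k \<in> {1..n}"
        then have "T k \<omega> < T m \<omega>" using less[of k] 2 by simp
        then show "(if T k \<omega> < T m \<omega> then ratio b (mark k \<omega>) (T k \<omega>) \<omega> else 0) = ratio b (mark k \<omega>) (T k \<omega>) \<omega>"
          by simp
      qed
      then show ?thesis using 2 by (simp add: U_def)
    next
      case 3
      then show ?thesis using less[of "Suc n"] by (simp add: U_def)
    qed
  qed
  have single: "(\<Sum>m. if m = Suc n then a else 0 :: ennreal) = a" for a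
    using sums_unique[OF sums_single[of "Suc n" "\<lambda>_. a"]] by simp
  have "(\<integral>\<^sup>+\<omega>. lik_ratio b (Suc n) \<omega> \<partial>M) =
      (\<integral>\<^sup>+\<omega>. (\<Sum>m. if 1 \<le> m then U (T m \<omega>) \<omega> * ratio b (mark m \<omega>) (T m \<omega>) \<omega> else 0) \<partial>M)"
  proof (rule nn_integral_cong)
    fix \<omega> assume \<omega>: "\<omega> \<in> space M"
    have "(\<lambda>m. if 1 \<le> m then U (T m \<omega>) \<omega> * ratio b (mark m \<omega>) (T m \<omega>) \<omega> else 0) =
        (\<lambda>m. if m = Suc n then lik_ratio b (Suc n) \<omega> else 0)"
      by (auto simp: fun_eq_iff U_at[OF \<omega>] lik_ratio_def)
    then show "lik_ratio b (Suc n) \<omega> =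
        (\<Sum>m. if 1 \<le> m then U (T m \<omega>) \<omega> * ratio b (mark m \<omega>) (T m \<omega>) \<omega> else 0)"
      by (simp only: single)
  qed
  also have "\<dots> = (\<integral>\<^sup>+\<omega>. (\<Sum>m. if 1 \<le> m then U (T m \<omega>) \<omega> else 0) \<partial>M)"
    by (rule nn_integral_events_ratio[OF U])
  also have "\<dots> = (\<integral>\<^sup>+\<omega>. lik_ratio b n \<omega> \<partial>M)"
  proof (rule nn_integral_cong)
    fix \<omega> assume \<omega>: "\<omega> \<in> space M"
    have "(\<lambda>m. if 1 \<le> m then U (T m \<omega>) \<omega> else 0) = (\<lambda>m. if m = Suc n then lik_ratio b n \<omega> else 0)"
      by (auto simp: fun_eq_iff U_at[OF \<omega>])
    then show "(\<Sum>m. if 1 \<le> m then U (T m \<omega>) \<omega> else 0) = lik_ratio b n \<omega>"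
      by (simp only: single)
  qed
  finally show ?case using Suc.IH by simp
qed

lemma emeasure_lik_ratio_ge: "emeasure M {\<omega>\<in>space M. ennreal (exp a) \<le> lik_ratio b n \<omega>} \<le> ennreal (exp (- a))"
proof -
  have [measurable]: "lik_ratio b n \<in> borel_measurable M" by (rule lik_ratio_measurable)
  have "{\<omega>\<in>space M. ennreal (exp a) \<le> lik_ratio b n \<omega>} \<subseteq>
      {\<omega>\<in>space M. 1 \<le> ennreal (exp (- a)) * lik_ratio b n \<omega>}"
  proof safe
    fix \<omega> assume "ennreal (exp a) \<le> lik_ratio b n \<omega>"
    then have "ennreal (exp (- a)) * ennreal (exp a) \<le> ennreal (exp (- a)) * lik_ratio b n \<omega>"
      by (rule mult_left_mono) simp
    moreover have "ennreal (exp (- a)) * ennreal (exp a) = 1"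
      by (simp add: ennreal_mult[symmetric] flip: exp_add)
    ultimately show "1 \<le> ennreal (exp (- a)) * lik_ratio b n \<omega>" by simp
  qed
  moreover have "{\<omega>\<in>space M. 1 \<le> ennreal (exp (- a)) * lik_ratio b n \<omega>} \<in> sets M"
    by measurable
  ultimately have "emeasure M {\<omega>\<in>space M. ennreal (exp a) \<le> lik_ratio b n \<omega>} \<le>
      emeasure M {\<omega>\<in>space M. 1 \<le> ennreal (exp (- a)) * lik_ratio b n \<omega>}"
    by (rule emeasure_mono)
  also have "\<dots> \<le> ennreal (exp (- a)) * (\<integral>\<^sup>+\<omega>. lik_ratio b n \<omega> * indicator (space M) \<omega> \<partial>M)"
    by (intro nn_integral_Markov_inequality) measurable
  also have "(\<integral>\<^sup>+\<omega>. lik_ratio b n \<omega> * indicator (space M) \<omega> \<partial>M) = (\<integral>\<^sup>+\<omega>. lik_ratio b n \<omega> \<partial>M)"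
    by (intro nn_integral_cong) simp
  finally show ?thesis by (simp add: nn_integral_lik_ratio)
qed

abbreviation "receivers \<omega> \<equiv> (\<lambda>m. R (T m \<omega>) (S m \<omega>) \<omega>)"
abbreviation "chosen \<omega> \<equiv> (\<lambda>m. D m \<omega>)"
abbreviation "covariates \<omega> \<equiv> (\<lambda>m j. x (T m \<omega>) (S m \<omega>) j \<omega>)"

text \<open>Availability puts the observed set into the range of summation, so all normalizing sums
  are positive and the logarithms can be undone.\<close>

lemma lik_ratio_eq:
  assumes \<omega>: "\<omega> \<in> space M" and avail: "\<forall>m\<ge>1. D m \<omega> \<subseteq> R (T m \<omega>) (S m \<omega>) \<omega>"
  shows "lik_ratio b n \<omega> = ennreal (exp (exact_loglik {1..n} (receivers \<omega>) (chosen \<omega>) (covariates \<omega>) b -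
    exact_loglik {1..n} (receivers \<omega>) (chosen \<omega>) (covariates \<omega>) \<beta>\<^sub>0))"
proof -
  define p where "p = (\<lambda>b m. mark_prob b (mark m \<omega>) (T m \<omega>) \<omega>)"
  have pos: "0 < (\<Sum>J\<in>ksubsets (R (T m \<omega>) (S m \<omega>) \<omega>) (card (D m \<omega>)).
      exp (b \<bullet> (\<Sum>j\<in>J. x (T m \<omega>) (S m \<omega>) j \<omega>)))" if m: "1 \<le> m" for b m
  proof -
    have "finite (R (T m \<omega>) (S m \<omega>) \<omega>)"
      using R_Fpow[OF _ T_pos[OF \<omega> m] \<omega>, of "S m \<omega>"] mark_in[OF m \<omega>] by (auto simp: Fpow_def)
    then show ?thesis using avail m by (intro sum_pos) auto
  qed
  have ppos: "0 < p b m" if "1 \<le> m" for b m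
    using pos[OF that] by (simp add: p_def mark_prob_def)
  have ll: "exact_loglik {1..n} (receivers \<omega>) (chosen \<omega>) (covariates \<omega>) b = (\<Sum>m\<in>{1..n}. ln (p b m))" for b
    unfolding loglik_def
  proof (rule sum.cong[OF refl])
    fix m assume "m \<in> {1..n}"
    then have m: "1 \<le> m" by simp
    show "b \<bullet> (\<Sum>j\<in>D m \<omega>. x (T m \<omega>) (S m \<omega>) j \<omega>) - 1 *
        ln (\<Sum>J\<in>ksubsets (R (T m \<omega>) (S m \<omega>) \<omega>) (card (D m \<omega>)). exp (b \<bullet> sum (\<lambda>j. x (T m \<omega>) (S m \<omega>) j \<omega>) J)) =
        ln (p b m)"
      unfolding p_def mark_prob_def using pos[OF m, of b] by (simp add: ln_div)
  qed
  have "lik_ratio b n \<omega> = ennreal (\<Prod>m\<in>{1..n}. p b m / p \<beta>\<^sub>0 m)"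
    unfolding lik_ratio_def ratio_def p_def
    by (rule prod_ennreal) (intro divide_nonneg_nonneg mark_prob_nonneg)
  also have "(\<Prod>m\<in>{1..n}. p b m / p \<beta>\<^sub>0 m) = (\<Prod>m\<in>{1..n}. exp (ln (p b m) - ln (p \<beta>\<^sub>0 m)))"
    by (intro prod.cong refl) (simp add: exp_diff ppos)
  also have "\<dots> = exp (\<Sum>m\<in>{1..n}. ln (p b m) - ln (p \<beta>\<^sub>0 m))" by (simp add: exp_sum)
  finally show ?thesis unfolding ll by (simp add: sum_subtractf)
qed

text \<open>Markov's inequality at level \<open>exp (\<epsilon> * n)\<close> for a variable with
  mean one: the exceptional probability is at most \<open>exp (- (\<epsilon> * n))\<close>, for
  every \<open>b\<close>, however the events depend on each other.\<close>

lemma loglik_increment_le: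
  assumes \<epsilon>: "0 < \<epsilon>"
  shows "with_prob_tending_to_one M (\<lambda>n \<omega>.
    exact_loglik {1..n} (receivers \<omega>) (chosen \<omega>) (covariates \<omega>) b -
    exact_loglik {1..n} (receivers \<omega>) (chosen \<omega>) (covariates \<omega>) \<beta>\<^sub>0 \<le> \<epsilon> * real n)"
proof -
  define inc where "inc = (\<lambda>n \<omega>. exact_loglik {1..n} (receivers \<omega>) (chosen \<omega>) (covariates \<omega>) b -
    exact_loglik {1..n} (receivers \<omega>) (chosen \<omega>) (covariates \<omega>) \<beta>\<^sub>0)"
  obtain N where N: "N \<in> null_sets M" and
    avail: "\<And>\<omega>. \<omega> \<in> space M \<Longrightarrow> \<omega> \<notin> N \<Longrightarrow> \<forall>m\<ge>1. D m \<omega> \<subseteq> R (T m \<omega>) (S m \<omega>) \<omega>"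
    using AE_receivers_available by (elim AE_E3) auto
  have bound: "outer_measure_of M {\<omega>\<in>space M. \<not> inc n \<omega> \<le> \<epsilon> * real n} \<le> ennreal (exp (- (\<epsilon> * real n)))" for n
  proof -
    let ?A = "{\<omega>\<in>space M. ennreal (exp (\<epsilon> * real n)) \<le> lik_ratio b n \<omega>}"
    have [measurable]: "lik_ratio b n \<in> borel_measurable M" by (rule lik_ratio_measurable)
    have A: "?A \<in> sets M" by measurable
    have "{\<omega>\<in>space M. \<not> inc n \<omega> \<le> \<epsilon> * real n} \<subseteq> ?A \<union> N"
    proof safe
      fix \<omega> assume \<omega>: "\<omega> \<in> space M" "\<not> inc n \<omega> \<le> \<epsilon> * real n" "\<omega> \<notin> N"
      show "ennreal (exp (\<epsilon> * real n)) \<le> lik_ratio b n \<omega>"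
        unfolding lik_ratio_eq[OF \<omega>(1) avail[OF \<omega>(1,3)]]
        using \<omega>(2) unfolding inc_def by (intro ennreal_leI) simp
    qed
    then have "outer_measure_of M {\<omega>\<in>space M. \<not> inc n \<omega> \<le> \<epsilon> * real n} \<le> outer_measure_of M (?A \<union> N)"
      by (rule outer_measure_of_mono)
    also have "\<dots> = emeasure M (?A \<union> N)" using A N by (intro outer_measure_of_eq) auto
    also have "\<dots> = emeasure M ?A" using A N by (rule emeasure_Un_null_set)
    also have "\<dots> \<le> ennreal (exp (- (\<epsilon> * real n)))" by (rule emeasure_lik_ratio_ge)
    finally show ?thesis .
  qed
  have "(\<lambda>n. exp (- \<epsilon>) ^ n) \<longlonglongrightarrow> 0" using \<epsilon> by (intro LIMSEQ_power_zero) simp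
  then have "(\<lambda>n. exp (- (\<epsilon> * real n))) \<longlonglongrightarrow> 0"
    by (simp add: exp_of_nat_mult[symmetric] mult.commute)
  from tendsto_ennrealI[OF this] have lim: "(\<lambda>n. ennreal (exp (- (\<epsilon> * real n)))) \<longlonglongrightarrow> 0" by simp
  have "(\<lambda>n. outer_measure_of M {\<omega>\<in>space M. \<not> inc n \<omega> \<le> \<epsilon> * real n}) \<longlonglongrightarrow> 0"
    by (rule tendsto_sandwich[OF always_eventually[OF allI] always_eventually[OF allI] tendsto_const lim])
      (rule zero_le bound)+
  then show ?thesis unfolding with_prob_tending_to_one_def inc_def .
qed

end

section \<open>Events of high probability\<close>

text \<open>Both sets are replaced by measurable covers of the same outer measure.\<close>

lemma outer_measure_of_Un_le:
  assumes "A \<subseteq> space M" "B \<subseteq> space M"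
  shows "outer_measure_of M (A \<union> B) \<le> outer_measure_of M A + outer_measure_of M B"
proof -
  obtain A' where A': "A' \<in> sets M" "A \<subseteq> A'" "outer_measure_of M A = emeasure M A'"
    using outer_measure_of_attain[OF assms(1)] by blast
  obtain B' where B': "B' \<in> sets M" "B \<subseteq> B'" "outer_measure_of M B = emeasure M B'"
    using outer_measure_of_attain[OF assms(2)] by blast
  have "outer_measure_of M (A \<union> B) \<le> outer_measure_of M (A' \<union> B')"
    using A' B' by (intro outer_measure_of_mono) auto
  also have "\<dots> = emeasure M (A' \<union> B')" using A' B' by (intro outer_measure_of_eq) auto
  also have "\<dots> \<le> emeasure M A' + emeasure M B'" by (rule emeasure_subadditive[OF A'(1) B'(1)])
  finally show ?thesis by (simp add: A' B')
qed

lemma with_prob_tending_to_one_mono: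
  assumes "with_prob_tending_to_one M P" and "\<forall>\<^sub>F n in sequentially. \<forall>\<omega>\<in>space M. P n \<omega> \<longrightarrow> Q n \<omega>"
  shows "with_prob_tending_to_one M Q"
proof -
  have le: "\<forall>\<^sub>F n in sequentially. outer_measure_of M {\<omega> \<in> space M. \<not> Q n \<omega>} \<le>
      outer_measure_of M {\<omega> \<in> space M. \<not> P n \<omega>}"
    using assms(2) by eventually_elim (intro outer_measure_of_mono, auto)
  show ?thesis
    unfolding with_prob_tending_to_one_def
    by (rule tendsto_sandwich[OF always_eventually[OF allI] le tendsto_const
          assms(1)[unfolded with_prob_tending_to_one_def]]) (rule zero_le)
qed

lemma with_prob_tending_to_one_conj:
  assumes "with_prob_tending_to_one M P" "with_prob_tending_to_one M Q"
  shows "with_prob_tending_to_one M (\<lambda>n \<omega>. P n \<omega> \<and> Q n \<omega>)"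
proof -
  let ?p = "\<lambda>n. outer_measure_of M {\<omega> \<in> space M. \<not> P n \<omega>}"
  let ?q = "\<lambda>n. outer_measure_of M {\<omega> \<in> space M. \<not> Q n \<omega>}"
  have "{\<omega> \<in> space M. \<not> (P n \<omega> \<and> Q n \<omega>)} = {\<omega> \<in> space M. \<not> P n \<omega>} \<union> {\<omega> \<in> space M. \<not> Q n \<omega>}" for n
    by auto
  then have le: "outer_measure_of M {\<omega> \<in> space M. \<not> (P n \<omega> \<and> Q n \<omega>)} \<le> ?p n + ?q n" for n
    using outer_measure_of_Un_le[of "{\<omega> \<in> space M. \<not> P n \<omega>}" M "{\<omega> \<in> space M. \<not> Q n \<omega>}"] by auto
  have lim: "(\<lambda>n. ?p n + ?q n) \<longlonglongrightarrow> 0"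
    using tendsto_add[OF assms[unfolded with_prob_tending_to_one_def]] by simp
  show ?thesis
    unfolding with_prob_tending_to_one_def
    by (rule tendsto_sandwich[OF always_eventually[OF allI] always_eventually[OF allI] tendsto_const lim])
      (rule zero_le le)+
qed

lemma with_prob_tending_to_one_AE:
  assumes "AE \<omega> in M. Q \<omega>"
  shows "with_prob_tending_to_one M (\<lambda>n. Q)"
proof -
  obtain N where Q: "\<And>\<omega>. \<omega> \<in> space M - N \<Longrightarrow> Q \<omega>" and "N \<in> null_sets M"
    using AE_E3[OF assms] by blast
  then have N: "{\<omega> \<in> space M. \<not> Q \<omega>} \<subseteq> N" "N \<in> null_sets M" by auto
  have "outer_measure_of M {\<omega> \<in> space M. \<not> Q \<omega>} \<le> outer_measure_of M N" by (rule outer_measure_of_mono[OF N(1)])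
  also have "\<dots> = 0" by (simp only: outer_measure_of_eq[OF null_setsD2[OF N(2)]] null_setsD1[OF N(2)])
  finally show ?thesis by (simp add: with_prob_tending_to_one_def)
qed

lemma with_prob_tending_to_one_ball:
  assumes "finite A" "\<And>a. a \<in> A \<Longrightarrow> with_prob_tending_to_one M (P a)"
  shows "with_prob_tending_to_one M (\<lambda>n \<omega>. \<forall>a\<in>A. P a n \<omega>)"
  using assms
proof (induction A)
  case empty
  then show ?case by (simp add: with_prob_tending_to_one_def)
next
  case (insert a A)
  have "with_prob_tending_to_one M (P a)" by (rule insert.prems) simp
  moreover have "with_prob_tending_to_one M (\<lambda>n \<omega>. \<forall>a\<in>A. P a n \<omega>)"
    by (rule insert.IH) (rule insert.prems, simp)
  ultimately have "with_prob_tending_to_one M (\<lambda>n \<omega>. P a n \<omega> \<and> (\<forall>a\<in>A. P a n \<omega>))"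
    by (rule with_prob_tending_to_one_conj)
  then show ?case by (rule with_prob_tending_to_one_mono) (intro always_eventually, blast)
qed

text \<open>The constant can be raised to at least 1, which later makes \<open>B\<close> and the
  bound on the sizes positive.\<close>

lemma bounded_in_probE:
  assumes "bounded_in_prob M Y" "0 < \<epsilon>"
  obtains K where "1 \<le> K" "outer_measure_of M {\<omega> \<in> space M. Y \<omega> > ennreal K} \<le> ennreal \<epsilon>"
proof -
  from assms(1)[unfolded bounded_in_prob_def, THEN spec, THEN mp, OF assms(2)]
  obtain K :: real where K: "outer_measure_of M {\<omega> \<in> space M. Y \<omega> > ennreal K} \<le> ennreal \<epsilon>"
    by (rule exE)
  have le: "ennreal K \<le> ennreal (max 1 K)" by (rule ennreal_leI) simp
  have "{\<omega> \<in> space M. Y \<omega> > ennreal (max 1 K)} \<subseteq> {\<omega> \<in> space M. Y \<omega> > ennreal K}"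
    using le_less_trans[OF le] by blast
  from order_trans[OF outer_measure_of_mono[OF this] K] show ?thesis by (intro that[of "max 1 K"]) simp_all
qed

section \<open>From the point process to data with bounded covariates\<close>

context multicast
begin

text \<open>Event times increase strictly, so exactly \<open>n\<close> events occur up to
  \<open>T n\<close>. This makes division by \<open>n\<close> a division by the number of
  summands.\<close>

lemma events_until:
  assumes "\<omega> \<in> space M" "1 \<le> n"
  shows "{m. 1 \<le> m \<and> T m \<omega> \<le> T n \<omega>} = {1..n}"
proof -
  have "T m \<omega> \<le> T n \<omega> \<longleftrightarrow> m \<le> n" if "1 \<le> m" for m
    using T_less_iff[OF assms(1) assms(2) that] by (meson not_le)
  then show ?thesis by auto
qed

lemma log_PL_eq:
  assumes "\<omega> \<in> space M" "1 \<le> n"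
  shows "log_PL T S D R x (T n \<omega>) \<omega> = exact_loglik {1..n} (receivers \<omega>) (chosen \<omega>) (covariates \<omega>)"
  unfolding log_PL_def[abs_def] loglik_def[abs_def] events_until[OF assms] inner_sum_right mult_1 ..

lemma log_PL_approx_eq:
  assumes "\<omega> \<in> space M" "1 \<le> n"
  shows "log_PL_approx T S D R x (T n \<omega>) \<omega> = approx_loglik {1..n} (receivers \<omega>) (chosen \<omega>) (covariates \<omega>)"
  unfolding log_PL_approx_def[abs_def] loglik_def[abs_def] events_until[OF assms] inner_sum_right ..

lemma G_sum_eq:
  assumes "\<omega> \<in> space M" "1 \<le> n"
  shows "G_sum T S D R n \<omega> = inverse_sizes {1..n} (receivers \<omega>) (chosen \<omega>)"
  unfolding G_sum_def events_until[OF assms] ..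

lemma bounded_data_events:
  assumes \<omega>: "\<omega> \<in> space M" and n: "1 \<le> n"
    and avail: "\<forall>m\<ge>1. D m \<omega> \<subseteq> R (T m \<omega>) (S m \<omega>) \<omega>"
    and X: "(SUP (t, i, j) \<in> {0<..} \<times> \<I> \<times> \<J>. ennreal (norm (x t i j \<omega>))) \<le> ennreal B" and B: "0 \<le> B"
    and C: "(SUP m \<in> {1..}. ennreal (real (card (D m \<omega>)))) \<le> ennreal L" and L: "0 \<le> L"
  shows "bounded_data B (nat \<lceil>L\<rceil>) {1..n} (receivers \<omega>) (chosen \<omega>) (covariates \<omega>)"
  unfolding bounded_data_def
proof (intro conjI ballI)
  fix m assume "m \<in> {1..n}"
  then have m: "1 \<le> m" by simp
  have i: "S m \<omega> \<in> \<I>" and D: "D m \<omega> \<noteq> {}" using mark_in[OF m \<omega>] by auto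
  have R: "finite (R (T m \<omega>) (S m \<omega>) \<omega>)" "R (T m \<omega>) (S m \<omega>) \<omega> \<subseteq> \<J>"
    using R_Fpow[OF i T_pos[OF \<omega> m] \<omega>] by (auto simp: Fpow_def)
  show "finite (R (T m \<omega>) (S m \<omega>) \<omega>)" by (rule R(1))
  show "D m \<omega> \<subseteq> R (T m \<omega>) (S m \<omega>) \<omega>" using avail m by blast
  show "D m \<omega> \<noteq> {}" by (rule D)
  have "ennreal (real (card (D m \<omega>))) \<le> ennreal L" using C m by (simp add: SUP_le_iff)
  then have "real (card (D m \<omega>)) \<le> L" using L by (simp add: ennreal_le_iff)
  then show "card (D m \<omega>) \<le> nat \<lceil>L\<rceil>" by linarith
  show "norm (x (T m \<omega>) (S m \<omega>) j \<omega>) \<le> B" if j: "j \<in> R (T m \<omega>) (S m \<omega>) \<omega>" for j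
  proof -
    have "(T m \<omega>, S m \<omega>, j) \<in> {0<..} \<times> \<I> \<times> \<J>" using T_pos[OF \<omega> m] i R j by auto
    from SUP_upper[OF this, of "\<lambda>(t, i, j). ennreal (norm (x t i j \<omega>))"]
    have "ennreal (norm (x (T m \<omega>) (S m \<omega>) j \<omega>)) \<le> ennreal B" using X by simp
    then show ?thesis using B by (simp add: ennreal_le_iff)
  qed
qed (use n in auto)

text \<open>Translates the eigenvalue hypothesis into the directional form used by the deterministic
  part; the factor \<open>1 / n\<close> of \<open>neg_hessian_approx\<close> becomes
  \<open>n\<close> on the left.\<close>

lemma approx_info_ge:
  assumes \<omega>: "\<omega> \<in> space M" and n: "1 \<le> n"
    and data: "bounded_data B L {1..n} (receivers \<omega>) (chosen \<omega>) (covariates \<omega>)"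
    and c: "c \<le> smallest_eigenvalue (neg_hessian_approx T S D R x n \<omega> b)" and v: "norm v = 1"
  shows "c * real n \<le> approx_info {1..n} (receivers \<omega>) (chosen \<omega>) (covariates \<omega>) b v v"
proof -
  define H where "H = neg_hessian_approx T S D R x n \<omega> b"
  have finA: "finite (receivers \<omega> m) \<and> receivers \<omega> m \<noteq> {}" if "m \<in> {1..n}" for m
    using bounded_dataD(1,2)[OF data that] by blast
  have H: "u \<bullet> (H *v v) = approx_info {1..n} (receivers \<omega>) (chosen \<omega>) (covariates \<omega>) b u v / real n" for u v
  proof -
    have "H *v v = (- 1 / real n) *\<^sub>R (hessian (approx_loglik {1..n} (receivers \<omega>) (chosen \<omega>) (covariates \<omega>)) b *v v)"
      unfolding H_def neg_hessian_approx_def log_PL_approx_eq[OF \<omega> n] scaleR_matrix_vector_assoc ..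
    then have "u \<bullet> (H *v v) = (- 1 / real n) *
        (u \<bullet> (hessian (approx_loglik {1..n} (receivers \<omega>) (chosen \<omega>) (covariates \<omega>)) b *v v))"
      by (simp only: inner_scaleR_right)
    also have "\<dots> = (- 1 / real n) * (- approx_info {1..n} (receivers \<omega>) (chosen \<omega>) (covariates \<omega>) b u v)"
      by (subst hessian_loglik[where A = "receivers \<omega>" and I = "{1..n}", OF finA]) simp_all
    finally show ?thesis by simp
  qed
  have "u \<bullet> (H *v v) = v \<bullet> (H *v u)" for u v
    unfolding H by (subst info_commute[where A = "receivers \<omega>" and I = "{1..n}", OF finA]) simp_all
  from smallest_eigenvalue_le[OF this v] have "c \<le> v \<bullet> (H *v v)" using c by (simp only: H_def[symmetric])
  then show ?thesis unfolding H using n by (simp add: field_simps)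
qed

end

theorem theorem4:
  fixes M :: "'a measure" and F :: "real \<Rightarrow> 'a measure"
    and \<I> :: "'i set" and \<J> :: "'j set"
    and T :: "nat \<Rightarrow> 'a \<Rightarrow> real" and S :: "nat \<Rightarrow> 'a \<Rightarrow> 'i" and D :: "nat \<Rightarrow> 'a \<Rightarrow> 'j set"
    and lbar :: "real \<Rightarrow> 'i \<Rightarrow> nat \<Rightarrow> 'a \<Rightarrow> real"
    and R :: "real \<Rightarrow> 'i \<Rightarrow> 'a \<Rightarrow> 'j set"
    and x :: "real \<Rightarrow> 'i \<Rightarrow> 'j \<Rightarrow> 'a \<Rightarrow> real^'p"
    and \<beta>\<^sub>0 :: "real^'p"
    and \<beta>hat \<beta>tilde :: "nat \<Rightarrow> 'a \<Rightarrow> real^'p"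
    and r c C :: real
  assumes "prob_space M"
    and "filtration (space M) F" and "\<And>t. sets (F t) \<subseteq> sets M"
    and "countable \<I>" and "countable \<J>"
    and "\<And>i L. i \<in> \<I> \<Longrightarrow> 1 \<le> L \<Longrightarrow> predictable_process M F borel (\<lambda>t. lbar t i L)"
    and "\<And>i L t \<omega>. i \<in> \<I> \<Longrightarrow> 1 \<le> L \<Longrightarrow> 0 < t \<Longrightarrow> \<omega> \<in> space M \<Longrightarrow> 0 \<le> lbar t i L \<omega>"
    and "\<And>i. i \<in> \<I> \<Longrightarrow> predictable_process M F (count_space (Fpow \<J>)) (\<lambda>t. R t i)"
    and "\<And>i j. i \<in> \<I> \<Longrightarrow> j \<in> \<J> \<Longrightarrow> predictable_process M F borel (\<lambda>t. x t i j)"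
    and "\<And>i j. i \<in> \<I> \<Longrightarrow> j \<in> \<J> \<Longrightarrow> locally_bounded_process M F (\<lambda>t. x t i j)"
    and "multivariate_point_process M F (\<I> \<times> (Fpow \<J> - {{}})) T (\<lambda>m \<omega>. (S m \<omega>, D m \<omega>))"
    and "\<And>i J. i \<in> \<I> \<Longrightarrow> J \<in> Fpow \<J> - {{}} \<Longrightarrow>
      has_intensity M F T (\<lambda>m \<omega>. (S m \<omega>, D m \<omega>)) (i, J) (multicast_intensity lbar R x \<beta>\<^sub>0 (i, J))"
    and "bounded_in_prob M (\<lambda>\<omega>. SUP (t, i, j) \<in> {0<..} \<times> \<I> \<times> \<J>. ennreal (norm (x t i j \<omega>)))"
    and "bounded_in_prob M (\<lambda>\<omega>. SUP m \<in> {1..}. ennreal (real (card (D m \<omega>))))"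
    and "with_prob_tending_to_one M
      (\<lambda>n \<omega>. is_arg_max (log_PL T S D R x (T n \<omega>) \<omega>) (\<lambda>_. True) (\<beta>hat n \<omega>))"
    and "with_prob_tending_to_one M
      (\<lambda>n \<omega>. is_arg_max (log_PL_approx T S D R x (T n \<omega>) \<omega>) (\<lambda>_. True) (\<beta>tilde n \<omega>))"
    and "0 < r" and "0 < c" and "0 < C"
    and "with_prob_tending_to_one M
      (\<lambda>n \<omega>. \<forall>b \<in> ball (\<beta>hat n \<omega>) r.
         c \<le> smallest_eigenvalue (neg_hessian_approx T S D R x n \<omega> b) \<and>
         (\<forall>b' \<in> ball (\<beta>hat n \<omega>) r.
            spectral_norm (neg_hessian_approx T S D R x n \<omega> b - neg_hessian_approx T S D R x n \<omega> b')
              \<le> C * norm (b - b')))"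
    and "tendsto_in_prob M (\<lambda>n \<omega>. G_sum T S D R n \<omega> / real n) 0"
  shows "bigo_in_prob M (\<lambda>n \<omega>. norm (\<beta>tilde n \<omega> - \<beta>hat n \<omega>)) (\<lambda>n \<omega>. G_sum T S D R n \<omega> / real n)"
proof -
  have filtered: "filtered_space M F"
    using assms(1-3) by (simp add: filtered_space_def filtered_space_axioms_def)
  interpret multicast M F \<I> \<J> T S D lbar R x \<beta>\<^sub>0
    by (intro multicast.intro multicast_axioms.intro filtered assms(5,7,8,9,11,12))
  show ?thesis
    unfolding bigo_in_prob_def
  proof (intro allI impI)
    fix \<epsilon> :: real assume \<epsilon>: "0 < \<epsilon>"
    define X where "X = (\<lambda>\<omega>. SUP (t, i, j) \<in> {0<..} \<times> \<I> \<times> \<J>. ennreal (norm (x t i j \<omega>)))"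
    define Y where "Y = (\<lambda>\<omega>. SUP m \<in> {1..}. ennreal (real (card (D m \<omega>))))"
    \<comment> \<open>The budget: \<open>\<epsilon> / 4\<close> for each of the bounds on covariates
      and sizes, and \<open>\<epsilon> / 2\<close> for the events whose probability tends to
      one.\<close>
    have \<epsilon>4: "0 < \<epsilon> / 4" using \<epsilon> by simp
    obtain B where B: "1 \<le> B" "outer_measure_of M {\<omega> \<in> space M. X \<omega> > ennreal B} \<le> ennreal (\<epsilon> / 4)"
      using assms(13)[folded X_def] \<epsilon>4 by (rule bounded_in_probE)
    obtain L where L: "1 \<le> L" "outer_measure_of M {\<omega> \<in> space M. Y \<omega> > ennreal L} \<le> ennreal (\<epsilon> / 4)"
      using assms(14)[folded Y_def] \<epsilon>4 by (rule bounded_in_probE)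
    define l where "l = nat \<lceil>L\<rceil>"
    have B0: "0 < B" and l: "1 \<le> l" using B(1) L(1) unfolding l_def by linarith+
    \<comment> \<open>Chosen after \<open>B\<close> and \<open>l\<close>, hence depending on
      \<open>\<epsilon>\<close>, but before \<open>n\<close> and the outcome. \<open>K\<close> is
      the constant of the stochastic order.\<close>
    obtain s \<eta> K where s: "0 < s" and \<eta>: "0 < \<eta>" and
      close: "\<forall>(I :: nat set) (R :: nat \<Rightarrow> 'j set) D X bh bt. bounded_data B l I R D X \<longrightarrow>
        (\<forall>e\<in>Basis \<union> uminus ` Basis.
          exact_loglik I R D X (\<beta>\<^sub>0 + s *\<^sub>R e) - exact_loglik I R D X \<beta>\<^sub>0 \<le> s\<^sup>2 * real (card I)) \<longrightarrow>
        inverse_sizes I R D \<le> \<eta> * real (card I) \<longrightarrow>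
        is_arg_max (exact_loglik I R D X) (\<lambda>_. True) bh \<longrightarrow>
        is_arg_max (approx_loglik I R D X) (\<lambda>_. True) bt \<longrightarrow>
        (\<forall>b\<in>ball bh r. \<forall>v. norm v = 1 \<longrightarrow> c * real (card I) \<le> approx_info I R D X b v v) \<longrightarrow>
        norm (bt - bh) \<le> K * (inverse_sizes I R D / real (card I))"
      using maximizers_close_of_increments[OF B0 l assms(17,18), of \<beta>\<^sub>0]
      by (elim exE conjE) (rule that)
    define P1 where "P1 = (\<lambda>n \<omega>. \<forall>e\<in>Basis \<union> uminus ` Basis.
      exact_loglik {1..n} (receivers \<omega>) (chosen \<omega>) (covariates \<omega>) (\<beta>\<^sub>0 + s *\<^sub>R e) -
      exact_loglik {1..n} (receivers \<omega>) (chosen \<omega>) (covariates \<omega>) \<beta>\<^sub>0 \<le> s\<^sup>2 * real n)"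
    define P2 where "P2 = (\<lambda>\<omega>. \<forall>m\<ge>1. D m \<omega> \<subseteq> R (T m \<omega>) (S m \<omega>) \<omega>)"
    define P3 where "P3 = (\<lambda>n \<omega>. is_arg_max (log_PL T S D R x (T n \<omega>) \<omega>) (\<lambda>_. True) (\<beta>hat n \<omega>))"
    define P4 where "P4 = (\<lambda>n \<omega>. is_arg_max (log_PL_approx T S D R x (T n \<omega>) \<omega>) (\<lambda>_. True) (\<beta>tilde n \<omega>))"
    define P5 where "P5 = (\<lambda>n \<omega>. \<forall>b \<in> ball (\<beta>hat n \<omega>) r. c \<le> smallest_eigenvalue (neg_hessian_approx T S D R x n \<omega> b))"
    define P6 where "P6 = (\<lambda>n \<omega>. \<bar>G_sum T S D R n \<omega> / real n - 0\<bar> \<le> \<eta>)"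
    \<comment> \<open>Each part of \<open>E\<close> fails with probability tending to zero. The
      bounds \<open>B\<close> and \<open>L\<close> stay outside: their failure does not depend on
      \<open>n\<close> and is only known to be unlikely.\<close>
    define E where "E = (\<lambda>n \<omega>. P1 n \<omega> \<and> P2 \<omega> \<and> P3 n \<omega> \<and> P4 n \<omega> \<and> P5 n \<omega> \<and> P6 n \<omega>)"
    have P1: "with_prob_tending_to_one M P1"
      unfolding P1_def
    proof (rule with_prob_tending_to_one_ball)
      show "finite (Basis \<union> uminus ` Basis :: (real^'p) set)" by (intro finite_UnI finite_imageI finite_Basis)
      show "with_prob_tending_to_one M (\<lambda>n \<omega>.
          exact_loglik {1..n} (receivers \<omega>) (chosen \<omega>) (covariates \<omega>) (\<beta>\<^sub>0 + s *\<^sub>R e) -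
          exact_loglik {1..n} (receivers \<omega>) (chosen \<omega>) (covariates \<omega>) \<beta>\<^sub>0 \<le> s\<^sup>2 * real n)" for e
        by (rule loglik_increment_le) (use s in simp)
    qed
    have P2: "with_prob_tending_to_one M (\<lambda>n. P2)"
      unfolding P2_def by (rule with_prob_tending_to_one_AE[OF AE_receivers_available])
    have P5: "with_prob_tending_to_one M P5"
      by (rule with_prob_tending_to_one_mono[OF assms(20)]) (simp add: P5_def)
    have P6: "with_prob_tending_to_one M P6"
      using assms(21) \<eta> by (simp only: tendsto_in_prob_def with_prob_tending_to_one_def P6_def not_le)
    have "with_prob_tending_to_one M E"
      unfolding E_def
      by (intro with_prob_tending_to_one_conj P1 P2 P5 P6 assms(15)[folded P3_def] assms(16)[folded P4_def])
    then have "(\<lambda>n. outer_measure_of M {\<omega> \<in> space M. \<not> E n \<omega>}) \<longlonglongrightarrow> 0"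
      by (simp only: with_prob_tending_to_one_def)
    moreover have "0 < ennreal (\<epsilon> / 2)" using \<epsilon> by simp
    ultimately have "\<forall>\<^sub>F n in sequentially. outer_measure_of M {\<omega> \<in> space M. \<not> E n \<omega>} < ennreal (\<epsilon> / 2)"
      by (rule order_tendstoD(2))
    \<comment> \<open>Index 0 is not an event, so the description of the events up to
      \<open>T n\<close> starts at \<open>n = 1\<close>.\<close>
    moreover have "\<forall>\<^sub>F n in sequentially. 1 \<le> (n::nat)" by (rule eventually_ge_at_top)
    ultimately have "\<forall>\<^sub>F n in sequentially.
      outer_measure_of M {\<omega> \<in> space M. K * (G_sum T S D R n \<omega> / real n) < norm (\<beta>tilde n \<omega> - \<beta>hat n \<omega>)} \<le> ennreal \<epsilon>"
    proof eventually_elim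
      case (elim n)
      let ?N = "{\<omega> \<in> space M. \<not> E n \<omega>}"
      let ?X = "{\<omega> \<in> space M. X \<omega> > ennreal B}"
      let ?Y = "{\<omega> \<in> space M. Y \<omega> > ennreal L}"
      have main: "norm (\<beta>tilde n \<omega> - \<beta>hat n \<omega>) \<le> K * (G_sum T S D R n \<omega> / real n)"
        if \<omega>: "\<omega> \<in> space M" and E: "E n \<omega>" and XB: "X \<omega> \<le> ennreal B" and YL: "Y \<omega> \<le> ennreal L" for \<omega>
      proof -
        have n: "1 \<le> n" by (rule elim(2))
        have data: "bounded_data B l {1..n} (receivers \<omega>) (chosen \<omega>) (covariates \<omega>)"
          unfolding l_def
          by (rule bounded_data_events[OF \<omega> n])
            (use E XB YL B L in \<open>simp_all add: E_def P2_def X_def Y_def\<close>)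
        have 1: "\<forall>e\<in>Basis \<union> uminus ` Basis.
            exact_loglik {1..n} (receivers \<omega>) (chosen \<omega>) (covariates \<omega>) (\<beta>\<^sub>0 + s *\<^sub>R e) -
            exact_loglik {1..n} (receivers \<omega>) (chosen \<omega>) (covariates \<omega>) \<beta>\<^sub>0 \<le> s\<^sup>2 * real (card {1..n})"
          using E unfolding E_def P1_def card_atLeastAtMost by simp
        have "\<bar>G_sum T S D R n \<omega> / real n - 0\<bar> \<le> \<eta>" using E by (simp only: E_def P6_def)
        then have "G_sum T S D R n \<omega> \<le> \<eta> * real n" using n by (simp add: abs_le_iff field_simps)
        then have 2: "inverse_sizes {1..n} (receivers \<omega>) (chosen \<omega>) \<le> \<eta> * real (card {1..n})"
          unfolding G_sum_eq[OF \<omega> n] by (simp only: card_atLeastAtMost diff_Suc_1 Suc_eq_plus1 add_diff_cancel_right')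
        have 3: "is_arg_max (exact_loglik {1..n} (receivers \<omega>) (chosen \<omega>) (covariates \<omega>)) (\<lambda>_. True) (\<beta>hat n \<omega>)"
          using E unfolding E_def P3_def log_PL_eq[OF \<omega> n] by (elim conjE)
        have 4: "is_arg_max (approx_loglik {1..n} (receivers \<omega>) (chosen \<omega>) (covariates \<omega>)) (\<lambda>_. True) (\<beta>tilde n \<omega>)"
          using E unfolding E_def P4_def log_PL_approx_eq[OF \<omega> n] by (elim conjE)
        have 5: "\<forall>b\<in>ball (\<beta>hat n \<omega>) r. \<forall>v. norm v = 1 \<longrightarrow> c * real (card {1..n}) \<le>
            approx_info {1..n} (receivers \<omega>) (chosen \<omega>) (covariates \<omega>) b v v"
        proof (intro ballI allI impI)
          fix b v :: "real^'p" assume b: "b \<in> ball (\<beta>hat n \<omega>) r" and v: "norm v = 1"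
          have "c \<le> smallest_eigenvalue (neg_hessian_approx T S D R x n \<omega> b)"
            using E b unfolding E_def P5_def by blast
          from approx_info_ge[OF \<omega> n data this v]
          show "c * real (card {1..n}) \<le> approx_info {1..n} (receivers \<omega>) (chosen \<omega>) (covariates \<omega>) b v v"
            by (simp only: card_atLeastAtMost diff_Suc_1 Suc_eq_plus1 add_diff_cancel_right')
        qed
        have "norm (\<beta>tilde n \<omega> - \<beta>hat n \<omega>) \<le>
            K * (inverse_sizes {1..n} (receivers \<omega>) (chosen \<omega>) / real (card {1..n}))"
          by (rule close[THEN spec, THEN spec, THEN spec, THEN spec, THEN spec, THEN spec, THEN mp, OF data,
              THEN mp, OF 1, THEN mp, OF 2, THEN mp, OF 3, THEN mp, OF 4, THEN mp, OF 5])
        then show ?thesis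
          unfolding G_sum_eq[OF \<omega> n]
          by (simp only: card_atLeastAtMost diff_Suc_1 Suc_eq_plus1 add_diff_cancel_right')
      qed
      have "{\<omega> \<in> space M. K * (G_sum T S D R n \<omega> / real n) < norm (\<beta>tilde n \<omega> - \<beta>hat n \<omega>)} \<subseteq> ?N \<union> (?X \<union> ?Y)"
      proof (rule subsetI, rule ccontr)
        fix \<omega> assume far: "\<omega> \<in> {\<omega> \<in> space M. K * (G_sum T S D R n \<omega> / real n) < norm (\<beta>tilde n \<omega> - \<beta>hat n \<omega>)}"
          and out: "\<omega> \<notin> ?N \<union> (?X \<union> ?Y)"
        have \<omega>: "\<omega> \<in> space M" using far by (simp only: mem_Collect_eq)
        have "E n \<omega>" "X \<omega> \<le> ennreal B" "Y \<omega> \<le> ennreal L" using out \<omega> by (simp_all add: not_less)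
        from main[OF \<omega> this] show False using far by (simp add: not_less[symmetric])
      qed
      then have "outer_measure_of M {\<omega> \<in> space M. K * (G_sum T S D R n \<omega> / real n) < norm (\<beta>tilde n \<omega> - \<beta>hat n \<omega>)} \<le>
          outer_measure_of M (?N \<union> (?X \<union> ?Y))"
        by (rule outer_measure_of_mono)
      also have "\<dots> \<le> outer_measure_of M ?N + outer_measure_of M (?X \<union> ?Y)"
        by (rule outer_measure_of_Un_le) blast+
      also have "\<dots> \<le> outer_measure_of M ?N + (outer_measure_of M ?X + outer_measure_of M ?Y)"
        by (intro add_left_mono outer_measure_of_Un_le) blast+
      also have "\<dots> \<le> ennreal (\<epsilon> / 2) + (ennreal (\<epsilon> / 4) + ennreal (\<epsilon> / 4))"
        by (intro add_mono less_imp_le[OF elim(1)] B(2) L(2))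
      also have "\<dots> = ennreal \<epsilon>" using \<epsilon> by (simp add: ennreal_plus[symmetric] del: ennreal_plus)
      finally show ?case .
    qed
    then show "\<exists>C. \<forall>\<^sub>F n in sequentially. outer_measure_of M
        {\<omega> \<in> space M. C * (G_sum T S D R n \<omega> / real n) < norm (\<beta>tilde n \<omega> - \<beta>hat n \<omega>)} \<le> ennreal \<epsilon>"
      by (rule exI)
  qed
qed

end
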